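(* Let $\mathcal{C}$ be a regular virtual holonomic constraint (VHC) of order $m$ for the Lagrangian control system $(\mathcal{Q},g,P,\{F^1,\dots,F^m\})$ such that, for every $q\in\mathcal{C}$, $T_q\mathcal{Q}=T_q\mathcal{C}\oplus\mathcal{D}_A(q)$ with the two summands orthogonal with respect to the metric $g$. Then the constrained dynamics $$\nabla^{\mathcal{C}}_{\dot q}\,\dot q=-\sigma_q\big(\operatorname{grad}P(q)\big)$$ are Lagrangian with Lagrangian structure $(\mathcal{C},g_{\mathcal{C}},P_{\mathcal{C}})$, where $g_{\mathcal{C}}=\iota^*g$ and $P_{\mathcal{C}}=P|_{\mathcal{C}}=P\circ\iota$, with $\iota:\mathcal{C}\to\mathcal{Q}$ the inclusion map.
   Context: All manifolds, maps, vector fields and forms are smooth. A Lagrangian control system $(\mathcal{Q},g,P,\{F^1,\dots,F^m\})$ consists of an $n$-dimensional Riemannian manifold $(\mathcal{Q},g)$ with Levi-Civita connection $\nabla$, a smooth potential $P:\mathcal{Q}\to\mathbb{R}$, and one-forms $F^1,\dots,F^m$ on $\mathcal{Q}$, assumed linearly independent at every point. $(F^i)^\sharp$ is the vector field with $F^i(X)=g((F^i)^\sharp,X)$ for all $X$, and $\operatorname{grad}P=(dP)^\sharp$. The equation of motion is $\nabla_{\dot q}\dot q=-\operatorname{grad}P(q)+\sum_{i=1}^m(F^i)^\sharp_q\,\tau_i$, with control inputs $\tau_i\in\mathbb{R}$. The acceleration distribution is $\mathcal{D}_A=\operatorname{span}\{(F^1)^\sharp,\dots,(F^m)^\sharp\}$.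 A regular VHC of order $m$ is a closed embedded submanifold $\mathcal{C}\subset\mathcal{Q}$ of codimension $m$ with $T_q\mathcal{C}\oplus\mathcal{D}_A(q)=T_q\mathcal{Q}$ for all $q\in\mathcal{C}$. For $q\in\mathcal{C}$, $\sigma_q:T_q\mathcal{Q}\to T_q\mathcal{C}$ is the linear projection onto $T_q\mathcal{C}$ along $\mathcal{D}_A(q)$; together these define a smooth vector bundle map $\sigma:T\mathcal{Q}|_{\mathcal{C}}\to T\mathcal{C}$. The induced connection on $\mathcal{C}$ is $\nabla^{\mathcal{C}}_XY:=\sigma(\nabla_XY)$ for vector fields $X,Y$ on $\mathcal{C}$, where $\nabla_XY$ on $\mathcal{C}$ is computed with arbitrary smooth local extensions of $X,Y$ to $\mathcal{Q}$ (the result does not depend on the extensions); $\nabla^{\mathcal{C}}$ is a symmetric (torsion-free) affine connection on $\mathcal{C}$. A Lagrangian system (or Lagrangian structure) on $\mathcal{C}$ is a triple $(\mathcal{C},g_{\mathcal{C}},P_{\mathcal{C}})$ with $g_{\mathcal{C}}$ a Riemannian metric on $\mathcal{C}$ and $P_{\mathcal{C}}:\mathcal{C}\to\mathbb{R}$ smooth; its base integral curves are the smooth curves $q:I\to\mathcal{C}$ ($I$ an open interval) with $\bar\nabla_{\dot q}\dot q=-\operatorname{grad}_{\mathcal{C}}P_{\mathcal{C}}(q)$, where $\bar\nabla$ is the Levi-Civita connection of $g_{\mathcal{C}}$ and $\operatorname{grad}_{\mathcal{C}}$ is the gradient with respect to $g_{\mathcal{C}}$. The constrained dynamics are Lagrangian,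 with Lagrangian structure $(\mathcal{C},g_{\mathcal{C}},P_{\mathcal{C}})$, if they are generated by such a triple: a smooth curve $q:I\to\mathcal{C}$ satisfies $\nabla^{\mathcal{C}}_{\dot q}\dot q=-\sigma_q(\operatorname{grad}P(q))$ if and only if it is a base integral curve of $(\mathcal{C},g_{\mathcal{C}},P_{\mathcal{C}})$. *)

theory Defs
  imports "HOL-Analysis.Analysis" "HOL-Library.Function_Algebras"
begin

text \<open>Tangent vectors are functionals on real-valued functions, so pointwise function spaces
  are made real vector spaces; \<open>span\<close>, \<open>sum\<close> etc. then come from the library.\<close>

instantiation "fun" :: (type, real_vector) real_vector
begin

definition scaleR_fun :: "real \<Rightarrow> ('a \<Rightarrow> 'b) \<Rightarrow> 'a \<Rightarrow> 'b"
  where "scaleR_fun c f = (\<lambda>x. c *\<^sub>R f x)"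

instance
  by standard (auto simp: scaleR_fun_def plus_fun_def scaleR_add_right scaleR_add_left)

end


section \<open>Smooth maps between Euclidean spaces\<close>

primrec higher_differentiable_on ::
  "'e::real_normed_vector set \<Rightarrow> ('e \<Rightarrow> 'b::real_normed_vector) \<Rightarrow> nat \<Rightarrow> bool" where
  "higher_differentiable_on V f 0 \<longleftrightarrow> continuous_on V f"
| "higher_differentiable_on V f (Suc n) \<longleftrightarrow>
     (\<forall>x\<in>V. f differentiable (at x)) \<and>
     (\<forall>v. higher_differentiable_on V (\<lambda>x. frechet_derivative f (at x) v) n)"

text \<open>Smoothness on an arbitrary subset means local extendability to a smooth function on an open
  set. For open sets, and for relatively open subsets of a linear subspace (the only cases used
  below), this is the usual notion of a \<open>C\<^sup>\<infinity>\<close> function.\<close>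

definition smooth_on :: "'e::real_normed_vector set \<Rightarrow> ('e \<Rightarrow> 'b::real_normed_vector) \<Rightarrow> bool" where
  "smooth_on A f \<longleftrightarrow>
     (\<forall>x\<in>A. \<exists>V h. open V \<and> x \<in> V \<and> (\<forall>n. higher_differentiable_on V h n) \<and>
        (\<forall>y\<in>V \<inter> A. h y = f y))"


section \<open>Manifolds\<close>

text \<open>A manifold has an underlying set, topologised as a subspace of the Hausdorff, second countable
  type \<open>'a\<close>; a model space, which is a linear subspace of the Euclidean space \<open>'e\<close> (so the dimension
  is the number \<open>dim (model M)\<close>, may be zero, and a submanifold needs no new type); and an atlas of
  charts \<open>(U, \<phi>)\<close> with values in the model space. The values of \<open>\<phi>\<close> outside \<open>U\<close> are irrelevant.\<close>

record ('a, 'e) manifold =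
  points :: "'a set"
  model :: "'e set"
  atlas :: "('a set \<times> ('a \<Rightarrow> 'e)) set"

definition is_chart ::
  "('a::{t2_space,second_countable_topology}, 'e::euclidean_space) manifold \<Rightarrow>
     'a set \<times> ('a \<Rightarrow> 'e) \<Rightarrow> bool" where
  "is_chart M c \<longleftrightarrow> (case c of (U, \<phi>) \<Rightarrow>
     openin (top_of_set (points M)) U \<and>
     openin (top_of_set (model M)) (\<phi> ` U) \<and>
     homeomorphism U (\<phi> ` U) \<phi> (inv_into U \<phi>))"

definition compatible ::
  "'a set \<times> ('a \<Rightarrow> 'e::euclidean_space) \<Rightarrow> 'a set \<times> ('a \<Rightarrow> 'e) \<Rightarrow> bool" where
  "compatible c d \<longleftrightarrow> (case c of (U, \<phi>) \<Rightarrow> case d of (V, \<psi>) \<Rightarrow>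
     smooth_on (\<phi> ` (U \<inter> V)) (\<psi> \<circ> inv_into U \<phi>) \<and>
     smooth_on (\<psi> ` (U \<inter> V)) (\<phi> \<circ> inv_into V \<psi>))"

definition smooth_manifold ::
  "('a::{t2_space,second_countable_topology}, 'e::euclidean_space) manifold \<Rightarrow> bool" where
  "smooth_manifold M \<longleftrightarrow>
     subspace (model M) \<and>
     (\<forall>c\<in>atlas M. is_chart M c) \<and>
     (\<Union>c\<in>atlas M. fst c) = points M \<and>
     (\<forall>c\<in>atlas M. \<forall>d\<in>atlas M. compatible c d)"

text \<open>The maximal atlas.\<close>

definition charts ::
  "('a::{t2_space,second_countable_topology}, 'e::euclidean_space) manifold \<Rightarrow>
     ('a set \<times> ('a \<Rightarrow> 'e)) set" where
  "charts M = {c. is_chart M c \<and> (\<forall>d\<in>atlas M. compatible c d)}"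

text \<open>\<open>smooth_at M p f\<close>: \<open>f\<close> is smooth on a neighbourhood of the point \<open>p\<close> of \<open>M\<close>.\<close>

definition smooth_at ::
  "('a::{t2_space,second_countable_topology}, 'e::euclidean_space) manifold \<Rightarrow> 'a \<Rightarrow>
     ('a \<Rightarrow> real) \<Rightarrow> bool" where
  "smooth_at M p f \<longleftrightarrow>
     (\<exists>(U, \<phi>)\<in>atlas M. \<exists>W. openin (top_of_set (points M)) W \<and> p \<in> W \<and> W \<subseteq> U \<and>
        smooth_on (\<phi> ` W) (f \<circ> inv_into U \<phi>))"

definition smooth_curve ::
  "('a::{t2_space,second_countable_topology}, 'e::euclidean_space) manifold \<Rightarrow> real set \<Rightarrow>
     (real \<Rightarrow> 'a) \<Rightarrow> bool" where
  "smooth_curve M I \<gamma> \<longleftrightarrow>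
     \<gamma> ` I \<subseteq> points M \<and> continuous_on I \<gamma> \<and>
     (\<forall>(U, \<phi>)\<in>atlas M. smooth_on {t\<in>I. \<gamma> t \<in> U} (\<phi> \<circ> \<gamma>))"


section \<open>Tangent vectors, vector fields and one-forms\<close>

text \<open>Tangent vectors are velocities of smooth curves, two velocities being identified when they
  differentiate every germ of a smooth function in the same way. A tangent vector at \<open>p\<close> is
  represented by the resulting derivation, with value 0 at functions not smooth near \<open>p\<close>.\<close>

type_synonym 'a tvec = "('a \<Rightarrow> real) \<Rightarrow> real"

definition velocity ::
  "('a::{t2_space,second_countable_topology}, 'e::euclidean_space) manifold \<Rightarrow>
     (real \<Rightarrow> 'a) \<Rightarrow> real \<Rightarrow> 'a tvec" where
  "velocity M \<gamma> t = (\<lambda>f. if smooth_at M (\<gamma> t) f then deriv (f \<circ> \<gamma>) t else 0)"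

definition tangent_space ::
  "('a::{t2_space,second_countable_topology}, 'e::euclidean_space) manifold \<Rightarrow> 'a \<Rightarrow>
     'a tvec set" where
  "tangent_space M p =
     {velocity M \<gamma> 0 | \<gamma>. \<exists>e>0. smooth_curve M {-e<..<e} \<gamma> \<and> \<gamma> 0 = p}"

text \<open>The differential at \<open>p\<close> of a smooth map \<open>\<Phi>\<close> into \<open>N\<close>.\<close>

definition pushforward ::
  "('a::{t2_space,second_countable_topology}, 'e::euclidean_space) manifold \<Rightarrow> ('b \<Rightarrow> 'a) \<Rightarrow>
     'b \<Rightarrow> 'b tvec \<Rightarrow> 'a tvec" where
  "pushforward N \<Phi> p v = (\<lambda>f. if smooth_at N (\<Phi> p) f then v (f \<circ> \<Phi>) else 0)"

text \<open>Vector fields are total functions, of which only the values on the open set \<open>U\<close> matter.\<close>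

definition smooth_vector_field ::
  "('a::{t2_space,second_countable_topology}, 'e::euclidean_space) manifold \<Rightarrow> 'a set \<Rightarrow>
     ('a \<Rightarrow> 'a tvec) \<Rightarrow> bool" where
  "smooth_vector_field M U X \<longleftrightarrow>
     openin (top_of_set (points M)) U \<and>
     (\<forall>p\<in>U. X p \<in> tangent_space M p \<and>
        (\<forall>f. smooth_at M p f \<longrightarrow> smooth_at M p (\<lambda>x. X x f)))"

definition lie_bracket ::
  "('a::{t2_space,second_countable_topology}, 'e::euclidean_space) manifold \<Rightarrow>
     ('a \<Rightarrow> 'a tvec) \<Rightarrow> ('a \<Rightarrow> 'a tvec) \<Rightarrow> 'a \<Rightarrow> 'a tvec" where
  "lie_bracket M X Y p =
     (\<lambda>f. if smooth_at M p f then X p (\<lambda>x. Y x f) - Y p (\<lambda>x. X x f) else 0)"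

definition linear_form_on :: "'v::real_vector set \<Rightarrow> ('v \<Rightarrow> real) \<Rightarrow> bool" where
  "linear_form_on T l \<longleftrightarrow>
     (\<forall>u\<in>T. \<forall>v\<in>T. l (u + v) = l u + l v) \<and> (\<forall>c. \<forall>v\<in>T. l (c *\<^sub>R v) = c * l v)"

definition one_form ::
  "('a::{t2_space,second_countable_topology}, 'e::euclidean_space) manifold \<Rightarrow>
     ('a \<Rightarrow> 'a tvec \<Rightarrow> real) \<Rightarrow> bool" where
  "one_form M \<omega> \<longleftrightarrow>
     (\<forall>p\<in>points M. linear_form_on (tangent_space M p) (\<omega> p)) \<and>
     (\<forall>U X. smooth_vector_field M U X \<longrightarrow> (\<forall>p\<in>U. smooth_at M p (\<lambda>x. \<omega> x (X x))))"

definition differential :: "('a \<Rightarrow> real) \<Rightarrow> 'a \<Rightarrow> 'a tvec \<Rightarrow> real" where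
  "differential f p v = v f"


section \<open>Riemannian metrics and connections\<close>

type_synonym 'a metric = "'a \<Rightarrow> 'a tvec \<Rightarrow> 'a tvec \<Rightarrow> real"

definition riemannian_metric ::
  "('a::{t2_space,second_countable_topology}, 'e::euclidean_space) manifold \<Rightarrow> 'a metric \<Rightarrow>
     bool" where
  "riemannian_metric M g \<longleftrightarrow>
     (\<forall>p\<in>points M.
        (\<forall>u\<in>tangent_space M p. linear_form_on (tangent_space M p) (g p u)) \<and>
        (\<forall>u\<in>tangent_space M p. \<forall>v\<in>tangent_space M p. g p u v = g p v u) \<and>
        (\<forall>u\<in>tangent_space M p. u \<noteq> 0 \<longrightarrow> g p u u > 0)) \<and>
     (\<forall>U X Y. smooth_vector_field M U X \<and> smooth_vector_field M U Y \<longrightarrow>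
        (\<forall>p\<in>U. smooth_at M p (\<lambda>x. g x (X x) (Y x))))"

definition pullback_metric ::
  "('a::{t2_space,second_countable_topology}, 'e::euclidean_space) manifold \<Rightarrow> ('b \<Rightarrow> 'a) \<Rightarrow>
     'a metric \<Rightarrow> 'b metric" where
  "pullback_metric N \<Phi> g = (\<lambda>p u v. g (\<Phi> p) (pushforward N \<Phi> p u) (pushforward N \<Phi> p v))"

definition sharp ::
  "('a::{t2_space,second_countable_topology}, 'e::euclidean_space) manifold \<Rightarrow> 'a metric \<Rightarrow>
     ('a \<Rightarrow> 'a tvec \<Rightarrow> real) \<Rightarrow> 'a \<Rightarrow> 'a tvec" where
  "sharp M g \<omega> p =
     (THE v. v \<in> tangent_space M p \<and> (\<forall>w\<in>tangent_space M p. \<omega> p w = g p v w))"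

definition grad ::
  "('a::{t2_space,second_countable_topology}, 'e::euclidean_space) manifold \<Rightarrow> 'a metric \<Rightarrow>
     ('a \<Rightarrow> real) \<Rightarrow> 'a \<Rightarrow> 'a tvec" where
  "grad M g f = sharp M g (differential f)"

text \<open>\<open>nabla p v Y\<close> is the covariant derivative at \<open>p\<close>, in the direction of the tangent vector \<open>v\<close> at \<open>p\<close>,
  of a vector field \<open>Y\<close> that need only be defined near \<open>p\<close>; that is, \<open>(nabla_X Y) p = nabla p (X p) Y\<close>.
  Tensoriality in \<open>X\<close> is linearity in \<open>v\<close>; real homogeneity in \<open>Y\<close> is the
  Leibniz rule for constant functions.\<close>

type_synonym 'a connection = "'a \<Rightarrow> 'a tvec \<Rightarrow> ('a \<Rightarrow> 'a tvec) \<Rightarrow> 'a tvec"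

definition affine_connection ::
  "('a::{t2_space,second_countable_topology}, 'e::euclidean_space) manifold \<Rightarrow> 'a connection \<Rightarrow>
     bool" where
  "affine_connection M nabla \<longleftrightarrow>
     (\<forall>U Y. smooth_vector_field M U Y \<longrightarrow>
        (\<forall>p\<in>U. \<forall>u\<in>tangent_space M p. \<forall>v\<in>tangent_space M p. \<forall>a b.
           nabla p (a *\<^sub>R u + b *\<^sub>R v) Y = a *\<^sub>R nabla p u Y + b *\<^sub>R nabla p v Y)) \<and>
     (\<forall>U Y Z. smooth_vector_field M U Y \<and> smooth_vector_field M U Z \<longrightarrow>
        (\<forall>p\<in>U. \<forall>v\<in>tangent_space M p.
           nabla p v (\<lambda>x. Y x + Z x) = nabla p v Y + nabla p v Z)) \<and>
     (\<forall>U Y f. smooth_vector_field M U Y \<and> (\<forall>x\<in>U. smooth_at M x f) \<longrightarrow>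
        (\<forall>p\<in>U. \<forall>v\<in>tangent_space M p.
           nabla p v (\<lambda>x. f x *\<^sub>R Y x) = v f *\<^sub>R Y p + f p *\<^sub>R nabla p v Y)) \<and>
     (\<forall>U Y Z. smooth_vector_field M U Y \<and> smooth_vector_field M U Z \<and> (\<forall>x\<in>U. Y x = Z x) \<longrightarrow>
        (\<forall>p\<in>U. \<forall>v\<in>tangent_space M p. nabla p v Y = nabla p v Z)) \<and>
     (\<forall>U X Y. smooth_vector_field M U X \<and> smooth_vector_field M U Y \<longrightarrow>
        smooth_vector_field M U (\<lambda>x. nabla x (X x) Y))"

definition levi_civita ::
  "('a::{t2_space,second_countable_topology}, 'e::euclidean_space) manifold \<Rightarrow> 'a metric \<Rightarrow>
     'a connection \<Rightarrow> bool" where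
  "levi_civita M g nabla \<longleftrightarrow>
     affine_connection M nabla \<and>
     (\<forall>U X Y. smooth_vector_field M U X \<and> smooth_vector_field M U Y \<longrightarrow>
        (\<forall>p\<in>U. nabla p (X p) Y - nabla p (Y p) X = lie_bracket M X Y p)) \<and>
     (\<forall>U Y Z. smooth_vector_field M U Y \<and> smooth_vector_field M U Z \<longrightarrow>
        (\<forall>p\<in>U. \<forall>v\<in>tangent_space M p.
           v (\<lambda>x. g x (Y x) (Z x)) = g p (nabla p v Y) (Z p) + g p (Y p) (nabla p v Z)))"

text \<open>Covariant derivative at \<open>t\<close> of a vector field \<open>V\<close> along a curve \<open>\<gamma>\<close>: near \<open>t\<close> write
  \<open>V s = (\<Sum>i<k. a\<^sub>i s *\<^sub>R Y\<^sub>i (\<gamma> s))\<close> with smooth \<open>a\<^sub>i\<close> and smooth vector fields \<open>Y\<^sub>i\<close> (for smooth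
  \<open>V\<close> a local frame provides this) and differentiate by the Leibniz rule. The outcome does not depend
  on the representation chosen.\<close>

definition covariant_deriv_along ::
  "('a::{t2_space,second_countable_topology}, 'e::euclidean_space) manifold \<Rightarrow> 'a connection \<Rightarrow>
     (real \<Rightarrow> 'a) \<Rightarrow> (real \<Rightarrow> 'a tvec) \<Rightarrow> real \<Rightarrow> 'a tvec" where
  "covariant_deriv_along M nabla \<gamma> V t =
     (THE w. \<exists>(k::nat) a Y U e. e > 0 \<and>
        (\<forall>i<k. smooth_on (ball t e) (a i :: real \<Rightarrow> real) \<and> smooth_vector_field M U (Y i)) \<and>
        (\<forall>s\<in>ball t e. \<gamma> s \<in> U \<and> V s = (\<Sum>i<k. a i s *\<^sub>R Y i (\<gamma> s))) \<and>
        w = (\<Sum>i<k. deriv (a i) t *\<^sub>R Y i (\<gamma> t) + a i t *\<^sub>R nabla (\<gamma> t) (velocity M \<gamma> t) (Y i)))"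

definition acceleration ::
  "('a::{t2_space,second_countable_topology}, 'e::euclidean_space) manifold \<Rightarrow> 'a connection \<Rightarrow>
     (real \<Rightarrow> 'a) \<Rightarrow> real \<Rightarrow> 'a tvec" where
  "acceleration M nabla \<gamma> t = covariant_deriv_along M nabla \<gamma> (velocity M \<gamma>) t"


section \<open>Embedded submanifolds\<close>

text \<open>Charts of the maximal atlas of \<open>Q\<close> in which \<open>C\<close> is the subspace \<open>S\<close>.\<close>

definition slice_charts ::
  "('a::{t2_space,second_countable_topology}, 'e::euclidean_space) manifold \<Rightarrow> 'e set \<Rightarrow> 'a set \<Rightarrow>
     ('a set \<times> ('a \<Rightarrow> 'e)) set" where
  "slice_charts Q S C = {(U, \<phi>). (U, \<phi>) \<in> charts Q \<and> \<phi> ` (U \<inter> C) = \<phi> ` U \<inter> S}"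

text \<open>An embedded submanifold of dimension \<open>dim S\<close>. Which subspace \<open>S\<close> of that dimension is used is
  immaterial, as one can compose the charts with a linear automorphism of the model space.\<close>

definition embedded_submanifold ::
  "('a::{t2_space,second_countable_topology}, 'e::euclidean_space) manifold \<Rightarrow> 'e set \<Rightarrow> 'a set \<Rightarrow>
     bool" where
  "embedded_submanifold Q S C \<longleftrightarrow>
     C \<subseteq> points Q \<and> subspace S \<and> S \<subseteq> model Q \<and>
     (\<forall>p\<in>C. \<exists>(U, \<phi>)\<in>slice_charts Q S C. p \<in> U)"

text \<open>The submanifold as a manifold in its own right. Its points have the same type as those of
  \<open>Q\<close>, so the inclusion map is \<open>id\<close>.\<close>

definition submanifold ::
  "('a::{t2_space,second_countable_topology}, 'e::euclidean_space) manifold \<Rightarrow> 'e set \<Rightarrow> 'a set \<Rightarrow>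
     ('a, 'e) manifold" where
  "submanifold Q S C =
     \<lparr>points = C, model = S, atlas = {(U \<inter> C, \<phi>) | U \<phi>. (U, \<phi>) \<in> slice_charts Q S C}\<rparr>"

text \<open>The tangent space of the submanifold as a subspace of the tangent space of \<open>Q\<close>.\<close>

definition sub_tangent_space ::
  "('a::{t2_space,second_countable_topology}, 'e::euclidean_space) manifold \<Rightarrow> 'e set \<Rightarrow> 'a set \<Rightarrow>
     'a \<Rightarrow> 'a tvec set" where
  "sub_tangent_space Q S C q = pushforward Q id q ` tangent_space (submanifold Q S C) q"


section \<open>Lagrangian control systems and virtual holonomic constraints\<close>

definition lagrangian_control_system ::
  "('a::{t2_space,second_countable_topology}, 'e::euclidean_space) manifold \<Rightarrow> 'a metric \<Rightarrow>
     'a connection \<Rightarrow> ('a \<Rightarrow> real) \<Rightarrow> nat \<Rightarrow> (nat \<Rightarrow> 'a \<Rightarrow> 'a tvec \<Rightarrow> real) \<Rightarrow> bool" where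
  "lagrangian_control_system Q g nabla P m F \<longleftrightarrow>
     smooth_manifold Q \<and> riemannian_metric Q g \<and> levi_civita Q g nabla \<and>
     (\<forall>q\<in>points Q. smooth_at Q q P) \<and>
     (\<forall>i\<in>{1..m}. one_form Q (F i)) \<and>
     (\<forall>q\<in>points Q. \<forall>c. (\<forall>v\<in>tangent_space Q q. (\<Sum>i=1..m. c i * F i q v) = 0) \<longrightarrow>
        (\<forall>i\<in>{1..m}. c i = 0))"

definition acceleration_distribution ::
  "('a::{t2_space,second_countable_topology}, 'e::euclidean_space) manifold \<Rightarrow> 'a metric \<Rightarrow>
     nat \<Rightarrow> (nat \<Rightarrow> 'a \<Rightarrow> 'a tvec \<Rightarrow> real) \<Rightarrow> 'a \<Rightarrow> 'a tvec set" where
  "acceleration_distribution Q g m F q = span ((\<lambda>i. sharp Q g (F i) q) ` {1..m})"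

definition is_direct_sum :: "'v::real_vector set \<Rightarrow> 'v set \<Rightarrow> 'v set \<Rightarrow> bool" where
  "is_direct_sum T A B \<longleftrightarrow> T = {a + b | a b. a \<in> A \<and> b \<in> B} \<and> A \<inter> B = {0}"

definition regular_VHC ::
  "('a::{t2_space,second_countable_topology}, 'e::euclidean_space) manifold \<Rightarrow> 'a metric \<Rightarrow>
     nat \<Rightarrow> (nat \<Rightarrow> 'a \<Rightarrow> 'a tvec \<Rightarrow> real) \<Rightarrow> 'e set \<Rightarrow> 'a set \<Rightarrow> bool" where
  "regular_VHC Q g m F S C \<longleftrightarrow>
     embedded_submanifold Q S C \<and> closedin (top_of_set (points Q)) C \<and>
     dim S + m = dim (model Q) \<and>
     (\<forall>q\<in>C. is_direct_sum (tangent_space Q q)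
        (sub_tangent_space Q S C q) (acceleration_distribution Q g m F q))"

text \<open>The projection \<open>\<sigma>\<^sub>q\<close>, with values in the intrinsic tangent space of the submanifold.\<close>

definition vhc_projection ::
  "('a::{t2_space,second_countable_topology}, 'e::euclidean_space) manifold \<Rightarrow> 'a metric \<Rightarrow>
     nat \<Rightarrow> (nat \<Rightarrow> 'a \<Rightarrow> 'a tvec \<Rightarrow> real) \<Rightarrow> 'e set \<Rightarrow> 'a set \<Rightarrow> 'a \<Rightarrow> 'a tvec \<Rightarrow> 'a tvec" where
  "vhc_projection Q g m F S C q w =
     (THE v. v \<in> tangent_space (submanifold Q S C) q \<and>
        w - pushforward Q id q v \<in> acceleration_distribution Q g m F q)"

text \<open>In the induced connection, \<open>Z\<close> is an arbitrary smooth extension of \<open>Y\<close> to a neighbourhood of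
  \<open>p\<close> in \<open>Q\<close>; all of them give the same value.\<close>

definition induced_connection ::
  "('a::{t2_space,second_countable_topology}, 'e::euclidean_space) manifold \<Rightarrow> 'a metric \<Rightarrow>
     'a connection \<Rightarrow> nat \<Rightarrow> (nat \<Rightarrow> 'a \<Rightarrow> 'a tvec \<Rightarrow> real) \<Rightarrow> 'e set \<Rightarrow> 'a set \<Rightarrow>
     'a connection" where
  "induced_connection Q g nabla m F S C p v Y =
     (THE w. \<exists>V Z. smooth_vector_field Q V Z \<and> p \<in> V \<and>
        (\<forall>x\<in>V \<inter> C. Z x = pushforward Q id x (Y x)) \<and>
        w = vhc_projection Q g m F S C p (nabla p (pushforward Q id p v) Z))"


section \<open>Lagrangian structures\<close>

definition lagrangian_system ::
  "('a::{t2_space,second_countable_topology}, 'e::euclidean_space) manifold \<Rightarrow> 'a metric \<Rightarrow>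
     ('a \<Rightarrow> real) \<Rightarrow> bool" where
  "lagrangian_system M g P \<longleftrightarrow>
     smooth_manifold M \<and> riemannian_metric M g \<and> (\<forall>q\<in>points M. smooth_at M q P)"

definition base_integral_curve ::
  "('a::{t2_space,second_countable_topology}, 'e::euclidean_space) manifold \<Rightarrow> 'a metric \<Rightarrow>
     ('a \<Rightarrow> real) \<Rightarrow> real set \<Rightarrow> (real \<Rightarrow> 'a) \<Rightarrow> bool" where
  "base_integral_curve M g P I \<gamma> \<longleftrightarrow>
     smooth_curve M I \<gamma> \<and>
     (\<exists>nabla. levi_civita M g nabla \<and> (\<forall>t\<in>I. acceleration M nabla \<gamma> t = - grad M g P (\<gamma> t)))"

definition satisfies_constrained_dynamics ::
  "('a::{t2_space,second_countable_topology}, 'e::euclidean_space) manifold \<Rightarrow> 'a metric \<Rightarrow>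
     'a connection \<Rightarrow> ('a \<Rightarrow> real) \<Rightarrow> nat \<Rightarrow> (nat \<Rightarrow> 'a \<Rightarrow> 'a tvec \<Rightarrow> real) \<Rightarrow> 'e set \<Rightarrow> 'a set \<Rightarrow>
     real set \<Rightarrow> (real \<Rightarrow> 'a) \<Rightarrow> bool" where
  "satisfies_constrained_dynamics Q g nabla P m F S C I \<gamma> \<longleftrightarrow>
     (\<forall>t\<in>I. acceleration (submanifold Q S C) (induced_connection Q g nabla m F S C) \<gamma> t =
        - vhc_projection Q g m F S C (\<gamma> t) (grad Q g P (\<gamma> t)))"

definition constrained_dynamics_lagrangian ::
  "('a::{t2_space,second_countable_topology}, 'e::euclidean_space) manifold \<Rightarrow> 'a metric \<Rightarrow>
     'a connection \<Rightarrow> ('a \<Rightarrow> real) \<Rightarrow> nat \<Rightarrow> (nat \<Rightarrow> 'a \<Rightarrow> 'a tvec \<Rightarrow> real) \<Rightarrow> 'e set \<Rightarrow> 'a set \<Rightarrow>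
     'a metric \<Rightarrow> ('a \<Rightarrow> real) \<Rightarrow> bool" where
  "constrained_dynamics_lagrangian Q g nabla P m F S C g\<^sub>C P\<^sub>C \<longleftrightarrow>
     lagrangian_system (submanifold Q S C) g\<^sub>C P\<^sub>C \<and>
     (\<forall>I \<gamma>. open I \<and> is_interval I \<and> smooth_curve (submanifold Q S C) I \<gamma> \<longrightarrow>
        (satisfies_constrained_dynamics Q g nabla P m F S C I \<gamma> \<longleftrightarrow>
         base_integral_curve (submanifold Q S C) g\<^sub>C P\<^sub>C I \<gamma>))"

end

theory Submission
  imports Defs
begin

text \<open>
  Orthogonality says that \<open>\<sigma>\<close> is the \<open>g\<close>-orthogonal projection onto the tangent spaces of \<open>C\<close>. So
  \<open>\<sigma>\<^sub>q w\<close> is the tangent vector of \<open>C\<close> with \<open>g\<^sub>C (\<sigma>\<^sub>q w, u) = g (w, u)\<close> for all \<open>u\<close> tangent to \<open>C\<close>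
  (\<open>proj_metric\<close>), and this one identity carries the whole argument.

  For \<open>w = grad P\<close> it says that \<open>\<sigma> (grad P)\<close> represents the differential of the restriction of \<open>P\<close>,
  hence is the gradient of \<open>P\<^sub>C\<close> for \<open>g\<^sub>C\<close> (\<open>grad_restrict\<close>). For \<open>w = \<nabla>\<^sub>X Y\<close> it turns the metric
  compatibility of \<open>\<nabla>\<close> into that of the induced connection. The bracket of two fields tangent to \<open>C\<close>
  is tangent to \<open>C\<close>, so projecting the torsion identity shows that the induced connection is
  torsion-free. Thus \<open>\<nabla>\<^sup>C\<close> is a Levi-Civita connection of \<open>g\<^sub>C\<close> (\<open>induced_levi_civita\<close>): the tangential
  part of the ambient Levi-Civita connection is the Levi-Civita connection of the induced metric.
  A Levi-Civita connection is unique (\<open>levi_civita_unique\<close>), so the accelerations in the two equations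
  of motion are equal, and so are their right-hand sides.

  Making this precise requires that objects on \<open>C\<close> extend locally to \<open>Q\<close> and restrict back. In a slice
  chart \<open>(U, \<phi>)\<close> both manifolds use the same map \<open>\<phi>\<close>. A function on \<open>C\<close> that is smooth near \<open>p\<close> has, by
  definition of smoothness on a relatively open part of the subspace \<open>S\<close>, the form \<open>h \<circ> \<phi>\<close> with \<open>h\<close>
  smooth on an open set of the Euclidean space, and \<open>h \<circ> \<phi>\<close> is then an extension to \<open>Q\<close>
  (\<open>smooth_at_extend\<close>). Vector fields extend through their components (\<open>field_extend\<close>), and the
  ambient covariant derivative in a direction tangent to \<open>C\<close> is independent of the extension
  (\<open>nabla_extension_independent\<close>). That \<open>\<sigma>\<close> maps smooth fields to smooth fields follows by expanding
  in a \<open>g\<^sub>C\<close>-orthogonal frame, which the Gram-Schmidt process provides (\<open>orthogonal_frame\<close>).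
\<close>

section \<open>Smooth maps on open sets\<close>

lemma higher_differentiable_on_subset:
  "higher_differentiable_on V f n \<Longrightarrow> W \<subseteq> V \<Longrightarrow> higher_differentiable_on W f n"
  by (induction n arbitrary: f) (auto intro: continuous_on_subset)

lemma higher_differentiable_on_cong:
  assumes "open V" "\<And>x. x \<in> V \<Longrightarrow> f x = g x" "higher_differentiable_on V f n"
  shows "higher_differentiable_on V g n"
  using assms(2,3)
proof (induction n arbitrary: f g)
  case 0
  then show ?case by (metis continuous_on_cong higher_differentiable_on.simps(1))
next
  case (Suc n)
  have d: "(g has_derivative frechet_derivative f (at x)) (at x)" if "x \<in> V" for x
  proof -
    have "(f has_derivative frechet_derivative f (at x)) (at x)"
      using Suc.prems that frechet_derivative_works by auto
    then show ?thesis
      using has_derivative_transform_within_open[OF _ assms(1) that] Suc.prems(1) by blast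
  qed
  have "frechet_derivative g (at x) = frechet_derivative f (at x)" if "x \<in> V" for x
    using d[OF that] frechet_derivative_at by metis
  moreover have "g differentiable at x" if "x \<in> V" for x
    using d[OF that] differentiable_def by blast
  ultimately show ?case
    using Suc.prems(2) Suc.IH[of "\<lambda>x. frechet_derivative f (at x) v" "\<lambda>x. frechet_derivative g (at x) v" for v]
    by auto
qed

lemma higher_differentiable_on_SucD:
  "higher_differentiable_on V f (Suc n) \<Longrightarrow> higher_differentiable_on V f n"
proof (induction n arbitrary: f)
  case 0
  then show ?case
    by (auto intro!: continuous_at_imp_continuous_on differentiable_imp_continuous_within)
next
  case (Suc n)
  then show ?case by (metis higher_differentiable_on.simps(2))
qed

text \<open>The defining recursion refers to \<open>frechet_derivative\<close>. Here it is enough to know some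
  derivative \<open>D x\<close> at every point, which is how all closure properties below are proved.\<close>

lemma higher_differentiable_on_SucI:
  assumes "open V" "\<And>x. x \<in> V \<Longrightarrow> (f has_derivative D x) (at x)"
    and "\<And>v. higher_differentiable_on V (\<lambda>x. D x v) n"
  shows "higher_differentiable_on V f (Suc n)"
proof -
  have "frechet_derivative f (at x) = D x" if "x \<in> V" for x
    using assms(2)[OF that] frechet_derivative_at by metis
  then have "higher_differentiable_on V (\<lambda>x. frechet_derivative f (at x) v) n" for v
    by (intro higher_differentiable_on_cong[OF assms(1) _ assms(3)[of v]]) simp
  then show ?thesis
    using assms(2) by (auto simp: differentiable_def)
qed

lemma higher_differentiable_on_derivative:
  assumes "higher_differentiable_on V f (Suc n)" "x \<in> V"
  shows "(f has_derivative frechet_derivative f (at x)) (at x)"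
  using assms frechet_derivative_works by auto

lemma higher_differentiable_on_const:
  "open V \<Longrightarrow> higher_differentiable_on V (\<lambda>x. c) n"
  by (induction n arbitrary: c) (auto intro!: higher_differentiable_on_SucI[where D="\<lambda>_ _. 0"]
      simp del: higher_differentiable_on.simps(2))

lemma higher_differentiable_on_linear:
  "open V \<Longrightarrow> bounded_linear f \<Longrightarrow> higher_differentiable_on V f n"
  by (cases n) (auto intro!: higher_differentiable_on_SucI[where D="\<lambda>_. f"]
      higher_differentiable_on_const bounded_linear_imp_has_derivative linear_continuous_on
      simp del: higher_differentiable_on.simps(2))

lemma higher_differentiable_on_linear_compose:
  assumes "open V" "bounded_linear L"
  shows "higher_differentiable_on V f n \<Longrightarrow> higher_differentiable_on V (\<lambda>x. L (f x)) n"
proof (induction n arbitrary: f)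
  case 0
  then show ?case
    by (simp add: assms(2) bounded_linear.continuous_on)
next
  case (Suc n)
  show ?case
  proof (rule higher_differentiable_on_SucI[OF assms(1), where D="\<lambda>x v. L (frechet_derivative f (at x) v)"])
    show "((\<lambda>x. L (f x)) has_derivative (\<lambda>v. L (frechet_derivative f (at x) v))) (at x)" if "x \<in> V" for x
      using bounded_linear.has_derivative[OF assms(2) higher_differentiable_on_derivative[OF Suc.prems that]] .
    show "higher_differentiable_on V (\<lambda>x. L (frechet_derivative f (at x) v)) n" for v
      using Suc by auto
  qed
qed

lemma higher_differentiable_on_add:
  assumes "open V"
  shows "higher_differentiable_on V f n \<Longrightarrow> higher_differentiable_on V g n \<Longrightarrow>
    higher_differentiable_on V (\<lambda>x. f x + g x) n"
proof (induction n arbitrary: f g)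
  case 0
  then show ?case by (simp add: continuous_on_add)
next
  case (Suc n)
  show ?case
  proof (rule higher_differentiable_on_SucI[OF assms])
    show "((\<lambda>x. f x + g x) has_derivative (\<lambda>v. frechet_derivative f (at x) v + frechet_derivative g (at x) v)) (at x)"
      if "x \<in> V" for x
      using Suc.prems that by (intro has_derivative_add higher_differentiable_on_derivative)
    show "higher_differentiable_on V (\<lambda>x. frechet_derivative f (at x) v + frechet_derivative g (at x) v) n" for v
      using Suc by auto
  qed
qed

lemma higher_differentiable_on_scaleR:
  assumes "open V"
  shows "higher_differentiable_on V f n \<Longrightarrow> higher_differentiable_on V g n \<Longrightarrow>
    higher_differentiable_on V (\<lambda>x. f x *\<^sub>R g x) n"
proof (induction n arbitrary: f g)
  case 0
  then show ?case by (simp add: continuous_on_scaleR)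
next
  case (Suc n)
  show ?case
  proof (rule higher_differentiable_on_SucI[OF assms])
    show "((\<lambda>x. f x *\<^sub>R g x) has_derivative
        (\<lambda>v. f x *\<^sub>R frechet_derivative g (at x) v + frechet_derivative f (at x) v *\<^sub>R g x)) (at x)"
      if "x \<in> V" for x
      using Suc.prems that by (intro has_derivative_scaleR higher_differentiable_on_derivative)
    have "higher_differentiable_on V f n" "higher_differentiable_on V g n"
      using Suc.prems higher_differentiable_on_SucD by blast+
    then show "higher_differentiable_on V
        (\<lambda>x. f x *\<^sub>R frechet_derivative g (at x) v + frechet_derivative f (at x) v *\<^sub>R g x) n" for v
      using Suc.prems by (intro higher_differentiable_on_add Suc.IH assms) auto
  qed
qed

lemma higher_differentiable_on_inverse:
  fixes f :: "'e::real_normed_vector \<Rightarrow> real"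
  assumes "open V" "\<And>x. x \<in> V \<Longrightarrow> f x \<noteq> 0"
  shows "higher_differentiable_on V f n \<Longrightarrow> higher_differentiable_on V (\<lambda>x. inverse (f x)) n"
proof (induction n)
  case 0
  then show ?case using assms(2) by (simp add: continuous_on_inverse)
next
  case (Suc n)
  show ?case
  proof (rule higher_differentiable_on_SucI[OF assms(1)])
    show "((\<lambda>x. inverse (f x)) has_derivative
        (\<lambda>v. - (inverse (f x) *\<^sub>R frechet_derivative f (at x) v *\<^sub>R inverse (f x)))) (at x)"
      if "x \<in> V" for x
      using Deriv.has_derivative_inverse[OF assms(2)[OF that] higher_differentiable_on_derivative[OF Suc.prems that]]
      by (simp add: mult.assoc)
    have i: "higher_differentiable_on V (\<lambda>x. inverse (f x)) n"
      using Suc higher_differentiable_on_SucD by blast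
    have "bounded_linear (uminus :: real \<Rightarrow> real)"
      by (simp add: bounded_linear_minus bounded_linear_ident)
    then show "higher_differentiable_on V (\<lambda>x. - (inverse (f x) *\<^sub>R frechet_derivative f (at x) v *\<^sub>R inverse (f x))) n" for v
      using Suc.prems i
      by (intro higher_differentiable_on_linear_compose[OF assms(1), of uminus]
          higher_differentiable_on_scaleR assms(1)) auto
  qed
qed

lemma higher_differentiable_on_sum:
  assumes "open V" "\<And>i. i \<in> I \<Longrightarrow> higher_differentiable_on V (f i) n"
  shows "higher_differentiable_on V (\<lambda>x. \<Sum>i\<in>I. f i x) n"
  using assms(2)
  by (induction I rule: infinite_finite_induct)
    (auto intro: higher_differentiable_on_const higher_differentiable_on_add assms(1))

text \<open>By the chain rule, the derivative of the composition in direction \<open>v\<close> is the sum over the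
  basis of the components of \<open>Dk v\<close> times partial derivatives of \<open>h\<close> composed with \<open>k\<close>. It is a
  combination of sums, products and compositions to which the induction hypothesis applies.\<close>

lemma higher_differentiable_on_compose:
  fixes k :: "'c::real_normed_vector \<Rightarrow> 'e::euclidean_space"
  assumes "open V" "open W" "k ` V \<subseteq> W"
  shows "higher_differentiable_on W h n \<Longrightarrow> higher_differentiable_on V k n \<Longrightarrow>
    higher_differentiable_on V (\<lambda>x. h (k x)) n"
proof (induction n arbitrary: h)
  case 0
  then show ?case
    using assms(3) continuous_on_compose2[of W h V k] by auto
next
  case (Suc n)
  show ?case
  proof (rule higher_differentiable_on_SucI[OF assms(1)])
    show "((\<lambda>x. h (k x)) has_derivative
        (\<lambda>v. \<Sum>b\<in>Basis. (frechet_derivative k (at x) v \<bullet> b) *\<^sub>R frechet_derivative h (at (k x)) b)) (at x)"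
      if x: "x \<in> V" for x
    proof -
      have "k x \<in> W" using assms(3) x by auto
      then have h: "(h has_derivative frechet_derivative h (at (k x))) (at (k x))"
        using higher_differentiable_on_derivative Suc.prems(1) by blast
      have k: "(k has_derivative frechet_derivative k (at x)) (at x)"
        using higher_differentiable_on_derivative Suc.prems(2) x by blast
      have "linear (frechet_derivative h (at (k x)))"
        using h has_derivative_linear by blast
      then have e: "frechet_derivative h (at (k x)) w = (\<Sum>b\<in>Basis. (w \<bullet> b) *\<^sub>R frechet_derivative h (at (k x)) b)" for w
        using linear_sum[of "frechet_derivative h (at (k x))" "\<lambda>b. (w \<bullet> b) *\<^sub>R b" Basis]
        by (simp add: linear_scale euclidean_representation)
      show ?thesis
        by (rule has_derivative_eq_rhs[OF has_derivative_compose[OF k h]]) (rule ext, rule e)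
    qed
    have k: "higher_differentiable_on V k n"
      using Suc.prems(2) higher_differentiable_on_SucD by blast
    show "higher_differentiable_on V (\<lambda>x. \<Sum>b\<in>Basis. (frechet_derivative k (at x) v \<bullet> b) *\<^sub>R
        frechet_derivative h (at (k x)) b) n" for v
    proof (intro higher_differentiable_on_sum higher_differentiable_on_scaleR assms(1))
      fix b :: 'e
      show "higher_differentiable_on V (\<lambda>x. frechet_derivative k (at x) v \<bullet> b) n"
        using Suc.prems(2)
        by (intro higher_differentiable_on_linear_compose[OF assms(1) bounded_linear_inner_left]) auto
      show "higher_differentiable_on V (\<lambda>x. frechet_derivative h (at (k x)) b) n"
        using Suc.prems(1) k by (intro Suc.IH) auto
    qed
  qed
qed

definition smooth_on_open :: "'e::real_normed_vector set \<Rightarrow> ('e \<Rightarrow> 'b::real_normed_vector) \<Rightarrow> bool"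
  where "smooth_on_open V h \<longleftrightarrow> open V \<and> (\<forall>n. higher_differentiable_on V h n)"

lemma smooth_on_altdef:
  "smooth_on A f \<longleftrightarrow> (\<forall>x\<in>A. \<exists>V h. smooth_on_open V h \<and> x \<in> V \<and> (\<forall>y\<in>V \<inter> A. h y = f y))"
  unfolding smooth_on_def smooth_on_open_def by (simp only: conj_ac)

lemma smooth_on_open_open: "smooth_on_open V h \<Longrightarrow> open V"
  by (simp add: smooth_on_open_def)

lemma smooth_on_open_subset: "smooth_on_open V h \<Longrightarrow> open W \<Longrightarrow> W \<subseteq> V \<Longrightarrow> smooth_on_open W h"
  by (auto simp: smooth_on_open_def intro: higher_differentiable_on_subset)

lemma smooth_on_open_cong:
  "smooth_on_open V f \<Longrightarrow> (\<And>x. x \<in> V \<Longrightarrow> f x = g x) \<Longrightarrow> smooth_on_open V g"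
  by (auto simp: smooth_on_open_def intro: higher_differentiable_on_cong)

lemma smooth_on_open_continuous: "smooth_on_open V h \<Longrightarrow> continuous_on V h"
  by (metis smooth_on_open_def higher_differentiable_on.simps(1))

lemma smooth_on_open_has_derivative:
  "smooth_on_open V h \<Longrightarrow> x \<in> V \<Longrightarrow> (h has_derivative frechet_derivative h (at x)) (at x)"
  using higher_differentiable_on_derivative[of V h 0 x] unfolding smooth_on_open_def by blast

lemma smooth_on_open_frechet:
  "smooth_on_open V h \<Longrightarrow> smooth_on_open V (\<lambda>x. frechet_derivative h (at x) v)"
  unfolding smooth_on_open_def by (metis higher_differentiable_on.simps(2))

lemma smooth_on_open_const: "open V \<Longrightarrow> smooth_on_open V (\<lambda>x. c)"
  by (simp add: smooth_on_open_def higher_differentiable_on_const)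

lemma smooth_on_open_linear: "open V \<Longrightarrow> bounded_linear f \<Longrightarrow> smooth_on_open V f"
  by (simp add: smooth_on_open_def higher_differentiable_on_linear)

lemma smooth_on_open_linear_compose:
  "smooth_on_open V f \<Longrightarrow> bounded_linear L \<Longrightarrow> smooth_on_open V (\<lambda>x. L (f x))"
  by (simp add: smooth_on_open_def higher_differentiable_on_linear_compose)

lemma smooth_on_open_add:
  "smooth_on_open V f \<Longrightarrow> smooth_on_open V g \<Longrightarrow> smooth_on_open V (\<lambda>x. f x + g x)"
  by (simp add: smooth_on_open_def higher_differentiable_on_add)

lemma smooth_on_open_scaleR:
  "smooth_on_open V f \<Longrightarrow> smooth_on_open V g \<Longrightarrow> smooth_on_open V (\<lambda>x. f x *\<^sub>R g x)"
  by (simp add: smooth_on_open_def higher_differentiable_on_scaleR)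

lemma smooth_on_open_inverse:
  fixes f :: "'e::real_normed_vector \<Rightarrow> real"
  assumes "smooth_on_open V f" "\<And>x. x \<in> V \<Longrightarrow> f x \<noteq> 0"
  shows "smooth_on_open V (\<lambda>x. inverse (f x))"
  using assms by (simp add: smooth_on_open_def higher_differentiable_on_inverse)

lemma smooth_on_open_compose:
  fixes k :: "'c::real_normed_vector \<Rightarrow> 'e::euclidean_space"
  assumes "smooth_on_open W h" "smooth_on_open V k" "k ` V \<subseteq> W"
  shows "smooth_on_open V (\<lambda>x. h (k x))"
  using assms higher_differentiable_on_compose[of V W k h] by (simp add: smooth_on_open_def)


section \<open>Functions in charts\<close>

text \<open>Smoothness of a function at a point, seen through one chart: \<open>f \<circ> \<phi>\<inverse>\<close> is the restriction to the
  model space of a smooth function \<open>h\<close> on an open set of the Euclidean space. The condition is written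
  as \<open>h \<circ> \<phi> = f\<close>, free of inverse charts; this makes the passage between a submanifold and
  its ambient manifold trivial.\<close>

definition smooth_near :: "'a set \<times> ('a \<Rightarrow> 'e::euclidean_space) \<Rightarrow> 'a \<Rightarrow> ('a \<Rightarrow> 'b::real_normed_vector) \<Rightarrow> bool"
  where "smooth_near c p f \<longleftrightarrow> p \<in> fst c \<and>
    (\<exists>V h. smooth_on_open V h \<and> snd c p \<in> V \<and> (\<forall>x\<in>fst c. snd c x \<in> V \<longrightarrow> h (snd c x) = f x))"

lemma is_chartD:
  assumes "is_chart M c"
  shows "openin (top_of_set (points M)) (fst c)"
    "openin (top_of_set (model M)) (snd c ` fst c)"
    "homeomorphism (fst c) (snd c ` fst c) (snd c) (inv_into (fst c) (snd c))"
    "inj_on (snd c) (fst c)" "fst c \<subseteq> points M" "snd c ` fst c \<subseteq> model M"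
    "continuous_on (fst c) (snd c)"
    "\<And>x. x \<in> fst c \<Longrightarrow> inv_into (fst c) (snd c) (snd c x) = x"
proof -
  show 1: "openin (top_of_set (points M)) (fst c)" "openin (top_of_set (model M)) (snd c ` fst c)"
    and 2: "homeomorphism (fst c) (snd c ` fst c) (snd c) (inv_into (fst c) (snd c))"
    using assms by (auto simp: is_chart_def split: prod.splits)
  show 3: "\<And>x. x \<in> fst c \<Longrightarrow> inv_into (fst c) (snd c) (snd c x) = x"
    using 2 by (simp add: homeomorphism_def)
  show "inj_on (snd c) (fst c)" using 3 by (metis inj_on_inverseI)
  show "fst c \<subseteq> points M" "snd c ` fst c \<subseteq> model M"
    using 1 by (auto dest: openin_imp_subset)
  show "continuous_on (fst c) (snd c)" using 2 by (simp add: homeomorphism_def)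
qed

text \<open>Charts are open maps onto an open part of the model space, so any neighbourhood of a point of
  the manifold can be recognised by an open set \<open>T\<close> of the Euclidean space.\<close>

lemma chart_neighbourhood:
  assumes "is_chart M c" "openin (top_of_set (points M)) W" "p \<in> fst c" "p \<in> W"
  obtains T where "open T" "snd c p \<in> T" "\<And>x. x \<in> fst c \<Longrightarrow> snd c x \<in> T \<Longrightarrow> x \<in> W"
    "\<And>y. y \<in> T \<Longrightarrow> y \<in> model M \<Longrightarrow> y \<in> snd c ` fst c"
proof -
  note c = is_chartD[OF assms(1)]
  have "openin (top_of_set (fst c)) (fst c \<inter> W)"
    using assms(2) c(5) openin_subset_trans[of "points M" "fst c \<inter> W" "fst c"] c(1)
    by (metis inf_le1 openin_Int)
  then have "openin (top_of_set (snd c ` fst c)) (snd c ` (fst c \<inter> W))"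
    using homeomorphism_imp_open_map[OF c(3)] by blast
  then have "openin (top_of_set (model M)) (snd c ` (fst c \<inter> W))"
    using c(2) openin_trans by blast
  then obtain T where T: "open T" "snd c ` (fst c \<inter> W) = model M \<inter> T"
    by (auto simp: openin_open)
  show ?thesis
  proof (rule that[OF T(1)])
    show "snd c p \<in> T" using assms(3,4) T(2) by blast
    show "x \<in> W" if "x \<in> fst c" "snd c x \<in> T" for x
    proof -
      have "snd c x \<in> snd c ` (fst c \<inter> W)" using that c(6) T(2) by blast
      then show ?thesis using c(4) that(1) by (auto simp: inj_on_def)
    qed
    show "y \<in> snd c ` fst c" if "y \<in> T" "y \<in> model M" for y
      using that T(2) by blast
  qed
qed

lemma openin_chart_vimage:
  assumes "is_chart M c" "open V"
  shows "openin (top_of_set (points M)) {x \<in> fst c. snd c x \<in> V}"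
proof -
  note c = is_chartD[OF assms(1)]
  have "openin (top_of_set (fst c)) (fst c \<inter> snd c -` V)"
    using continuous_openin_preimage_gen[OF c(7) assms(2)] .
  moreover have "fst c \<inter> snd c -` V = {x \<in> fst c. snd c x \<in> V}" by auto
  ultimately show ?thesis using c(1) openin_trans by metis
qed

text \<open>The witness of smoothness can be shrunk so that it lives over a prescribed neighbourhood and,
  within the model space, over the image of the chart.\<close>

lemma smooth_near_restrict:
  assumes "is_chart M c" "openin (top_of_set (points M)) W" "smooth_near c p f" "p \<in> W"
  obtains V h where "smooth_on_open V h" "snd c p \<in> V"
    "\<And>x. x \<in> fst c \<Longrightarrow> snd c x \<in> V \<Longrightarrow> x \<in> W \<and> h (snd c x) = f x"
    "\<And>y. y \<in> V \<Longrightarrow> y \<in> model M \<Longrightarrow> y \<in> snd c ` fst c"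
proof -
  obtain V h where V: "smooth_on_open V h" "snd c p \<in> V" "\<forall>x\<in>fst c. snd c x \<in> V \<longrightarrow> h (snd c x) = f x"
    and p: "p \<in> fst c"
    using assms(3) by (auto simp: smooth_near_def)
  obtain T where T: "open T" "snd c p \<in> T" "\<And>x. x \<in> fst c \<Longrightarrow> snd c x \<in> T \<Longrightarrow> x \<in> W"
    "\<And>y. y \<in> T \<Longrightarrow> y \<in> model M \<Longrightarrow> y \<in> snd c ` fst c"
    using chart_neighbourhood[OF assms(1,2) p assms(4)] by metis
  have "smooth_on_open (V \<inter> T) h"
    using smooth_on_open_subset[OF V(1)] smooth_on_open_open[OF V(1)] T(1) by auto
  then show ?thesis
    using that[of "V \<inter> T" h] V T by auto
qed

lemma smooth_near_local:
  assumes "is_chart M c" "openin (top_of_set (points M)) W" "smooth_near c p f" "p \<in> W"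
    "\<And>x. x \<in> W \<Longrightarrow> f x = g x"
  shows "smooth_near c p g"
proof -
  obtain V h where "smooth_on_open V h" "snd c p \<in> V"
    "\<And>x. x \<in> fst c \<Longrightarrow> snd c x \<in> V \<Longrightarrow> x \<in> W \<and> h (snd c x) = f x"
    using smooth_near_restrict[OF assms(1-4)] by metis
  then show ?thesis
    using assms(3,5) unfolding smooth_near_def by metis
qed

lemma smooth_near_neighbourhood:
  assumes "is_chart M c" "smooth_near c p f"
  obtains W where "openin (top_of_set (points M)) W" "p \<in> W" "W \<subseteq> fst c" "\<And>x. x \<in> W \<Longrightarrow> smooth_near c x f"
proof -
  obtain V h where V: "smooth_on_open V h" "snd c p \<in> V" "\<forall>x\<in>fst c. snd c x \<in> V \<longrightarrow> h (snd c x) = f x"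
    and p: "p \<in> fst c"
    using assms(2) by (auto simp: smooth_near_def)
  show ?thesis
    by (rule that[OF openin_chart_vimage[OF assms(1) smooth_on_open_open[OF V(1)]]])
      (use V p in \<open>auto simp: smooth_near_def\<close>)
qed

lemma smooth_near_chart: "p \<in> fst c \<Longrightarrow> smooth_near c p (snd c)"
  unfolding smooth_near_def
  by (intro conjI exI[of _ UNIV] exI[of _ id]) (auto simp: id_def intro: smooth_on_open_linear bounded_linear_ident)

lemma smooth_near_const: "p \<in> fst c \<Longrightarrow> smooth_near c p (\<lambda>x. k)"
  unfolding smooth_near_def
  by (intro conjI exI[of _ UNIV] exI[of _ "\<lambda>x. k"]) (auto intro: smooth_on_open_const)

lemma smooth_near_linear:
  assumes "smooth_near c p f" "bounded_linear L"
  shows "smooth_near c p (\<lambda>x. L (f x))"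
  using assms unfolding smooth_near_def by (metis smooth_on_open_linear_compose)

lemma smooth_near_binary:
  fixes c :: "'a set \<times> ('a \<Rightarrow> 'e::euclidean_space)"
  assumes "smooth_near c p f" "smooth_near c p g"
    and "\<And>(V :: 'e set) h k. smooth_on_open V h \<Longrightarrow> smooth_on_open V k \<Longrightarrow> smooth_on_open V (\<lambda>x. B (h x) (k x))"
  shows "smooth_near c p (\<lambda>x. B (f x) (g x))"
proof -
  obtain V h where V: "smooth_on_open V h" "snd c p \<in> V" "\<forall>x\<in>fst c. snd c x \<in> V \<longrightarrow> h (snd c x) = f x"
    using assms(1) by (auto simp: smooth_near_def)
  obtain W k where W: "smooth_on_open W k" "snd c p \<in> W" "\<forall>x\<in>fst c. snd c x \<in> W \<longrightarrow> k (snd c x) = g x"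
    using assms(2) by (auto simp: smooth_near_def)
  have "open (V \<inter> W)" using V W by (simp add: open_Int smooth_on_open_open)
  then have "smooth_on_open (V \<inter> W) (\<lambda>x. B (h x) (k x))"
    using V(1) W(1) by (intro assms(3)) (auto intro: smooth_on_open_subset)
  then show ?thesis
    unfolding smooth_near_def using V W assms(1)
    by (intro conjI exI[of _ "V \<inter> W"] exI[of _ "\<lambda>x. B (h x) (k x)"]) (auto simp: smooth_near_def)
qed

lemma smooth_near_add:
  "smooth_near c p f \<Longrightarrow> smooth_near c p g \<Longrightarrow> smooth_near c p (\<lambda>x. f x + g x)"
  by (rule smooth_near_binary) (auto intro: smooth_on_open_add)

lemma smooth_near_scaleR:
  "smooth_near c p f \<Longrightarrow> smooth_near c p g \<Longrightarrow> smooth_near c p (\<lambda>x. f x *\<^sub>R g x)"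
  by (rule smooth_near_binary) (auto intro: smooth_on_open_scaleR)

lemma smooth_near_inverse:
  fixes f :: "'a \<Rightarrow> real"
  assumes "smooth_near c p f" "f p \<noteq> 0"
  shows "smooth_near c p (\<lambda>x. inverse (f x))"
proof -
  obtain V h where V: "smooth_on_open V h" "snd c p \<in> V" "\<forall>x\<in>fst c. snd c x \<in> V \<longrightarrow> h (snd c x) = f x"
    and p: "p \<in> fst c"
    using assms(1) by (auto simp: smooth_near_def)
  let ?V = "V \<inter> h -` (- {0})"
  have "open ?V"
    using smooth_on_open_continuous[OF V(1)] smooth_on_open_open[OF V(1)]
    by (intro continuous_open_preimage) auto
  then have "smooth_on_open ?V h" by (rule smooth_on_open_subset[OF V(1)]) auto
  then have "smooth_on_open ?V (\<lambda>x. inverse (h x))" by (rule smooth_on_open_inverse) auto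
  then show ?thesis
    unfolding smooth_near_def using V(2,3) p assms(2)
    by (intro conjI exI[of _ ?V] exI[of _ "\<lambda>x. inverse (h x)"]) auto
qed

text \<open>The witness in the new chart is the old one composed with a local extension of the transition
  map.\<close>

lemma smooth_near_change_chart:
  assumes "is_chart M c" "is_chart M d" "smooth_near c p f" "smooth_near d p (snd c)"
  shows "smooth_near d p f"
proof -
  obtain V h where V: "smooth_on_open V h" "snd c p \<in> V" "\<forall>x\<in>fst c. snd c x \<in> V \<longrightarrow> h (snd c x) = f x"
    and p: "p \<in> fst c"
    using assms(3) by (auto simp: smooth_near_def)
  obtain W k where W: "smooth_on_open W k" "snd d p \<in> W"
     "\<And>x. x \<in> fst d \<Longrightarrow> snd d x \<in> W \<Longrightarrow> x \<in> fst c \<and> k (snd d x) = snd c x" and pd: "p \<in> fst d"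
    using smooth_near_restrict[OF assms(2) is_chartD(1)[OF assms(1)] assms(4) p] assms(4)
    by (metis smooth_near_def)
  let ?W = "W \<inter> k -` V"
  have o: "open ?W"
    using smooth_on_open_continuous[OF W(1)] smooth_on_open_open[OF W(1)] smooth_on_open_open[OF V(1)]
    by (intro continuous_open_preimage) auto
  have "smooth_on_open ?W (\<lambda>x. h (k x))"
    by (rule smooth_on_open_compose[OF V(1) smooth_on_open_subset[OF W(1) o]]) auto
  then show ?thesis
    unfolding smooth_near_def using V W p pd
    by (intro conjI exI[of _ ?W] exI[of _ "\<lambda>x. h (k x)"]) auto
qed

text \<open>Since \<open>smooth_near\<close> also makes sense for vector-valued functions, compatibility of two charts
  says that each chart map is smooth as seen through the other chart.\<close>

lemma compatible_iff_smooth_near: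
  assumes "is_chart M c" "is_chart M d"
  shows "compatible c d \<longleftrightarrow> (\<forall>p\<in>fst c \<inter> fst d. smooth_near c p (snd d) \<and> smooth_near d p (snd c))"
proof -
  have *: "smooth_on (snd c ` (fst c \<inter> fst d)) (snd d \<circ> inv_into (fst c) (snd c)) \<longleftrightarrow>
     (\<forall>p\<in>fst c \<inter> fst d. smooth_near c p (snd d))" if c: "is_chart M c" and d: "is_chart M d" for c d
  proof
    assume l: "smooth_on (snd c ` (fst c \<inter> fst d)) (snd d \<circ> inv_into (fst c) (snd c))"
    show "\<forall>p\<in>fst c \<inter> fst d. smooth_near c p (snd d)"
    proof
      fix p assume p: "p \<in> fst c \<inter> fst d"
      then obtain V h where V: "smooth_on_open V h" "snd c p \<in> V"
        "\<forall>y\<in>V \<inter> snd c ` (fst c \<inter> fst d). h y = (snd d \<circ> inv_into (fst c) (snd c)) y"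
        using l unfolding smooth_on_altdef by blast
      obtain T where T: "open T" "snd c p \<in> T" "\<And>x. x \<in> fst c \<Longrightarrow> snd c x \<in> T \<Longrightarrow> x \<in> fst d"
        using chart_neighbourhood[OF c is_chartD(1)[OF d]] p by (metis IntD1 IntD2)
      have s: "smooth_on_open (V \<inter> T) h"
        using smooth_on_open_subset[OF V(1)] smooth_on_open_open[OF V(1)] T(1) by auto
      show "smooth_near c p (snd d)"
        unfolding smooth_near_def using p V(2,3) T is_chartD(8)[OF c]
        by (intro conjI exI[of _ "V \<inter> T"] exI[of _ h] s) auto
    qed
  next
    assume r: "\<forall>p\<in>fst c \<inter> fst d. smooth_near c p (snd d)"
    show "smooth_on (snd c ` (fst c \<inter> fst d)) (snd d \<circ> inv_into (fst c) (snd c))"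
      unfolding smooth_on_altdef
    proof
      fix y assume "y \<in> snd c ` (fst c \<inter> fst d)"
      then obtain p where p: "p \<in> fst c \<inter> fst d" "y = snd c p" by auto
      then obtain V h where V: "smooth_on_open V h" "snd c p \<in> V" "\<forall>x\<in>fst c. snd c x \<in> V \<longrightarrow> h (snd c x) = snd d x"
        using r unfolding smooth_near_def by blast
      then show "\<exists>V h. smooth_on_open V h \<and> y \<in> V \<and>
         (\<forall>z\<in>V \<inter> snd c ` (fst c \<inter> fst d). h z = (snd d \<circ> inv_into (fst c) (snd c)) z)"
        using p(2) is_chartD(8)[OF c] by (intro exI[of _ V] exI[of _ h]) auto
    qed
  qed
  show ?thesis
    using *[OF assms] *[OF assms(2,1)]
    by (auto simp: compatible_def Int_commute split: prod.splits)
qed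

lemma atlas_charts: "smooth_manifold M \<Longrightarrow> c \<in> atlas M \<Longrightarrow> c \<in> charts M"
  by (auto simp: smooth_manifold_def charts_def)

lemma charts_is_chart: "c \<in> charts M \<Longrightarrow> is_chart M c"
  by (auto simp: charts_def)

lemma smooth_at_atlas:
  assumes "smooth_manifold M"
  shows "smooth_at M p f \<longleftrightarrow> (\<exists>c\<in>atlas M. smooth_near c p f)"
proof
  assume "smooth_at M p f"
  then obtain c W where c: "c \<in> atlas M" and W: "openin (top_of_set (points M)) W" "p \<in> W" "W \<subseteq> fst c"
     "smooth_on (snd c ` W) (f \<circ> inv_into (fst c) (snd c))"
    unfolding smooth_at_def by force
  have ch: "is_chart M c" using assms c by (auto simp: smooth_manifold_def)
  obtain V h where V: "smooth_on_open V h" "snd c p \<in> V"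
    "\<forall>y\<in>V \<inter> snd c ` W. h y = (f \<circ> inv_into (fst c) (snd c)) y"
    using W unfolding smooth_on_altdef by blast
  obtain T where T: "open T" "snd c p \<in> T" "\<And>x. x \<in> fst c \<Longrightarrow> snd c x \<in> T \<Longrightarrow> x \<in> W"
    using chart_neighbourhood[OF ch W(1)] W by (metis subsetD)
  have s: "smooth_on_open (V \<inter> T) h"
    using smooth_on_open_subset[OF V(1)] smooth_on_open_open[OF V(1)] T(1) by auto
  have "smooth_near c p f"
    unfolding smooth_near_def using W V(2,3) T is_chartD(8)[OF ch]
    by (intro conjI exI[of _ "V \<inter> T"] exI[of _ h] s) auto
  with c show "\<exists>c\<in>atlas M. smooth_near c p f" ..
next
  assume "\<exists>c\<in>atlas M. smooth_near c p f"
  then obtain c V h where c: "c \<in> atlas M" and p: "p \<in> fst c" and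
    V: "smooth_on_open V h" "snd c p \<in> V" "\<forall>x\<in>fst c. snd c x \<in> V \<longrightarrow> h (snd c x) = f x"
    by (auto simp: smooth_near_def)
  have ch: "is_chart M c" using assms c by (auto simp: smooth_manifold_def)
  let ?W = "{x \<in> fst c. snd c x \<in> V}"
  have "smooth_on (snd c ` ?W) (f \<circ> inv_into (fst c) (snd c))"
    unfolding smooth_on_altdef
    using V is_chartD(8)[OF ch] by (intro ballI exI[of _ V] exI[of _ h]) auto
  then show "smooth_at M p f"
    unfolding smooth_at_def case_prod_beta
    using openin_chart_vimage[OF ch smooth_on_open_open[OF V(1)]] p V(2)
    by (intro bexI[OF _ c] exI[of _ ?W]) simp
qed

text \<open>Smoothness at a point may be tested in any single chart of the maximal atlas.\<close>

lemma smooth_at_near: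
  assumes M: "smooth_manifold M" and c: "c \<in> charts M" and p: "p \<in> fst c"
  shows "smooth_at M p f \<longleftrightarrow> smooth_near c p f"
proof -
  have *: "smooth_near c p (snd d)" "smooth_near d p (snd c)" if "d \<in> atlas M" "p \<in> fst d" for d
  proof -
    have "compatible c d" "is_chart M c" "is_chart M d"
      using M c that by (auto simp: charts_def smooth_manifold_def)
    with compatible_iff_smooth_near that p show "smooth_near c p (snd d)" "smooth_near d p (snd c)"
      by blast+
  qed
  have ch: "is_chart M c" "\<And>d. d \<in> atlas M \<Longrightarrow> is_chart M d"
    using M c by (auto simp: charts_def smooth_manifold_def)
  show ?thesis
    unfolding smooth_at_atlas[OF M]
  proof
    assume "\<exists>d\<in>atlas M. smooth_near d p f"
    then obtain d where d: "d \<in> atlas M" "smooth_near d p f" ..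
    then show "smooth_near c p f"
      using smooth_near_change_chart[OF ch(2) ch(1) d(2)] *[OF d(1)] d(2) unfolding smooth_near_def by blast
  next
    assume f: "smooth_near c p f"
    have "p \<in> points M" using is_chartD(5)[OF ch(1)] p by auto
    then obtain d where d: "d \<in> atlas M" "p \<in> fst d" using M unfolding smooth_manifold_def by blast
    then show "\<exists>d\<in>atlas M. smooth_near d p f"
      using smooth_near_change_chart[OF ch(1) ch(2) f] * by blast
  qed
qed

lemma charts_transition:
  assumes M: "smooth_manifold M" and c: "c \<in> charts M" and d: "d \<in> charts M" and p: "p \<in> fst c" "p \<in> fst d"
  shows "smooth_near c p (snd d)"
proof -
  have "p \<in> points M" using is_chartD(5)[OF charts_is_chart[OF c]] p by auto
  then obtain e where e: "e \<in> atlas M" "p \<in> fst e" using M unfolding smooth_manifold_def by blast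
  have ch: "is_chart M c" "is_chart M d" "is_chart M e"
    using M c d e by (auto simp: charts_def smooth_manifold_def)
  have "smooth_near e p (snd d)" "smooth_near c p (snd e)"
    using c d e p compatible_iff_smooth_near[OF ch(1,3)] compatible_iff_smooth_near[OF ch(2,3)]
    unfolding charts_def by blast+
  then show ?thesis using smooth_near_change_chart ch by blast
qed

lemma chart_exists:
  assumes "smooth_manifold M" "p \<in> points M"
  obtains c where "c \<in> charts M" "p \<in> fst c"
  using assms atlas_charts[OF assms(1)] unfolding smooth_manifold_def by blast

context
  fixes M :: "('a::{t2_space,second_countable_topology}, 'e::euclidean_space) manifold"
  assumes M: "smooth_manifold M"
begin

lemma smooth_at_point: "smooth_at M p f \<Longrightarrow> p \<in> points M"
  using M is_chartD(5) by (fastforce simp: smooth_at_atlas[OF M] smooth_near_def smooth_manifold_def)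

lemma smooth_at_local:
  assumes "smooth_at M p f" "openin (top_of_set (points M)) W" "p \<in> W" "\<And>x. x \<in> W \<Longrightarrow> f x = g x"
  shows "smooth_at M p g"
proof -
  obtain c where c: "c \<in> charts M" "p \<in> fst c" using chart_exists[OF M smooth_at_point[OF assms(1)]] .
  then show ?thesis
    using assms smooth_near_local[OF charts_is_chart[OF c(1)] assms(2), of p f g]
    by (auto simp: smooth_at_near[OF M c])
qed

lemma smooth_at_neighbourhood:
  assumes "smooth_at M p f"
  obtains W where "openin (top_of_set (points M)) W" "p \<in> W" "\<And>x. x \<in> W \<Longrightarrow> smooth_at M x f"
proof -
  obtain c where c: "c \<in> charts M" "p \<in> fst c" using chart_exists[OF M smooth_at_point[OF assms(1)]] .
  then have "smooth_near c p f" using assms smooth_at_near[OF M c] by simp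
  then obtain W where "openin (top_of_set (points M)) W" "p \<in> W" "W \<subseteq> fst c" "\<And>x. x \<in> W \<Longrightarrow> smooth_near c x f"
    using smooth_near_neighbourhood[OF charts_is_chart[OF c(1)]] by metis
  then show ?thesis using that[of W] smooth_at_near[OF M c(1)] by blast
qed

lemma smooth_at_const:
  assumes "p \<in> points M"
  shows "smooth_at M p (\<lambda>x. k)"
proof -
  obtain c where c: "c \<in> charts M" "p \<in> fst c" using chart_exists[OF M assms] .
  then show ?thesis by (simp add: smooth_at_near[OF M c] smooth_near_const)
qed

lemma smooth_at_add:
  assumes "smooth_at M p f" "smooth_at M p g"
  shows "smooth_at M p (\<lambda>x. f x + g x)"
proof -
  obtain c where c: "c \<in> charts M" "p \<in> fst c" using chart_exists[OF M smooth_at_point[OF assms(1)]] .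
  then show ?thesis using assms by (simp add: smooth_at_near[OF M c] smooth_near_add)
qed

lemma smooth_at_mult:
  assumes "smooth_at M p f" "smooth_at M p g"
  shows "smooth_at M p (\<lambda>x. f x * g x)"
proof -
  obtain c where c: "c \<in> charts M" "p \<in> fst c" using chart_exists[OF M smooth_at_point[OF assms(1)]] .
  then show ?thesis using assms smooth_near_scaleR[of c p f g] by (simp add: smooth_at_near[OF M c])
qed

lemma smooth_at_inverse:
  assumes "smooth_at M p f" "f p \<noteq> 0"
  shows "smooth_at M p (\<lambda>x. inverse (f x))"
proof -
  obtain c where c: "c \<in> charts M" "p \<in> fst c" using chart_exists[OF M smooth_at_point[OF assms(1)]] .
  then show ?thesis using assms by (simp add: smooth_at_near[OF M c] smooth_near_inverse)
qed

lemma smooth_at_divide: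
  assumes "smooth_at M p f" "smooth_at M p g" "g p \<noteq> 0"
  shows "smooth_at M p (\<lambda>x. f x / g x)"
  unfolding divide_inverse by (intro smooth_at_mult smooth_at_inverse assms)

lemma smooth_at_sum:
  assumes "p \<in> points M" "\<And>i. i \<in> I \<Longrightarrow> smooth_at M p (f i)"
  shows "smooth_at M p (\<lambda>x. \<Sum>i\<in>I. f i x)"
  using assms(2)
  by (induction I rule: infinite_finite_induct) (auto intro: smooth_at_const[OF assms(1)] smooth_at_add)

end


section \<open>Tangent vectors and vector fields in charts\<close>

lemma tvec_apply [simp]:
  "(u + v) f = u f + v f" "(u - v) f = u f - v f" "(- u) f = - u f" "(0 :: 'a tvec) f = 0"
  "(r *\<^sub>R u) f = r * u f"
  for u v :: "'a tvec"
  by (simp_all add: plus_fun_def fun_diff_def fun_Compl_def zero_fun_def scaleR_fun_def)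

lemma tvec_sum_apply [simp]: "(\<Sum>i\<in>I. u i) f = (\<Sum>i\<in>I. u i f)" for u :: "'b \<Rightarrow> 'a tvec"
  by (induction I rule: infinite_finite_induct) auto

text \<open>The coordinate vector with components \<open>v\<close>: for \<open>v\<close> in the model space, the velocity at \<open>p\<close> of the
  curve that is a straight line in the chart.\<close>

definition chart_vec ::
  "('a::{t2_space,second_countable_topology}, 'e::euclidean_space) manifold \<Rightarrow>
     'a set \<times> ('a \<Rightarrow> 'e) \<Rightarrow> 'a \<Rightarrow> 'e \<Rightarrow> 'a tvec" where
  "chart_vec M c p v = (\<lambda>f. if smooth_at M p f
     then deriv (\<lambda>t. f (inv_into (fst c) (snd c) (snd c p + t *\<^sub>R v))) 0 else 0)"

lemma deriv_frechet_line:
  assumes "smooth_on_open V h" "k t \<in> V" "(k has_vector_derivative v) (at t)"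
  shows "deriv (\<lambda>s. h (k s) :: real) t = frechet_derivative h (at (k t)) v"
proof -
  have h: "(h has_derivative frechet_derivative h (at (k t))) (at (k t))"
    using smooth_on_open_has_derivative[OF assms(1,2)] .
  have "((\<lambda>s. h (k s)) has_derivative (\<lambda>s. frechet_derivative h (at (k t)) (s *\<^sub>R v))) (at t)"
    using has_derivative_compose[OF assms(3)[unfolded has_vector_derivative_def] h] .
  moreover have "frechet_derivative h (at (k t)) (s *\<^sub>R v) = frechet_derivative h (at (k t)) v * s" for s
    using linear_scale[OF has_derivative_linear[OF h]] by simp
  ultimately have "((\<lambda>s. h (k s)) has_field_derivative frechet_derivative h (at (k t)) v) (at t)"
    by (simp add: has_field_derivative_def)
  then show ?thesis by (rule DERIV_imp_deriv)
qed

lemma deriv_local: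
  assumes "open J" "t \<in> J" "\<And>s. s \<in> J \<Longrightarrow> f s = g s"
  shows "deriv f t = deriv g t"
proof (rule deriv_cong_ev)
  show "\<forall>\<^sub>F x in nhds t. f x = g x" unfolding eventually_nhds using assms by blast
qed simp

text \<open>A subspace of a Euclidean space is the orthogonal complement of its orthogonal complement.\<close>

lemma subspace_memI:
  fixes E :: "'f::euclidean_space set"
  assumes "subspace E" "\<And>w. (\<And>y. y \<in> E \<Longrightarrow> y \<bullet> w = 0) \<Longrightarrow> v \<bullet> w = 0"
  shows "v \<in> E"
proof -
  obtain y z where y: "y \<in> span E" "\<And>w. w \<in> span E \<Longrightarrow> orthogonal z w" "v = y + z"
    using orthogonal_subspace_decomp_exists[of E v] by metis
  have E: "span E = E" using assms(1) by (simp add: span_eq_iff)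
  have z: "u \<bullet> z = 0" if "u \<in> E" for u
    using y(2)[of u] that E by (simp add: orthogonal_def inner_commute)
  have "v \<bullet> z = 0" by (rule assms(2)[OF z])
  then have "z = 0" using z[of y] y E by (simp add: inner_add_left)
  then show ?thesis using y E by simp
qed

text \<open>A curve in a subspace has vanishing inner product with every vector orthogonal to the subspace,
  and so has its velocity.\<close>

lemma has_vector_derivative_subspace:
  fixes E :: "'f::euclidean_space set"
  assumes "subspace E" "(k has_vector_derivative v) (at t)" "open J" "t \<in> J" "\<And>s. s \<in> J \<Longrightarrow> k s \<in> E"
  shows "v \<in> E"
proof (rule subspace_memI[OF assms(1)])
  fix w assume w: "\<And>y. y \<in> E \<Longrightarrow> y \<bullet> w = 0"
  have 1: "((\<lambda>s. k s \<bullet> w) has_vector_derivative v \<bullet> w) (at t)"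
    using bounded_linear.has_vector_derivative[OF bounded_linear_inner_left assms(2)] .
  have "((\<lambda>s. k s \<bullet> w) has_vector_derivative 0) (at t)"
    by (rule has_vector_derivative_transform_within_open[OF _ assms(3,4), where f="\<lambda>s. 0"])
      (auto simp: w assms(5))
  then show "v \<bullet> w = 0" using vector_derivative_unique_at[OF 1] by simp
qed

lemma chart_vec_outside: "\<not> smooth_at M p f \<Longrightarrow> chart_vec M c p v f = 0"
  by (simp add: chart_vec_def)

lemma tangent_outside:
  assumes "v \<in> tangent_space M p" "\<not> smooth_at M p f"
  shows "v f = 0"
  using assms by (auto simp: tangent_space_def velocity_def)

lemma tangent_space_points: "v \<in> tangent_space M p \<Longrightarrow> p \<in> points M"
  by (force simp: tangent_space_def smooth_curve_def)

lemma smooth_vector_fieldD: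
  assumes "smooth_vector_field M U X" "p \<in> U"
  shows "X p \<in> tangent_space M p" "smooth_at M p f \<Longrightarrow> smooth_at M p (\<lambda>x. X x f)"
    "openin (top_of_set (points M)) U" "p \<in> points M"
  using assms openin_imp_subset by (auto simp: smooth_vector_field_def)

lemma smooth_vector_field_subset:
  assumes "smooth_vector_field M U X" "openin (top_of_set (points M)) V" "V \<subseteq> U"
  shows "smooth_vector_field M V X"
  using assms by (auto simp: smooth_vector_field_def)

context
  fixes M :: "('a::{t2_space,second_countable_topology}, 'e::euclidean_space) manifold"
  assumes M: "smooth_manifold M"
begin

lemma subspace_model: "subspace (model M)"
  using M by (simp add: smooth_manifold_def)

lemma smooth_at_witness:
  assumes c: "c \<in> charts M" "p \<in> fst c" and "smooth_at M p f"
  obtains V h where "smooth_on_open V h" "snd c p \<in> V"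
    "\<And>x. x \<in> fst c \<Longrightarrow> snd c x \<in> V \<Longrightarrow> h (snd c x) = f x"
  using assms(3) unfolding smooth_at_near[OF M c] smooth_near_def by blast

text \<open>A coordinate vector acts as the directional derivative of any ambient extension \<open>h\<close> of \<open>f\<close> in the
  chart. This reduces calculations with coordinate vectors to the Euclidean space.\<close>

lemma chart_vec_eval:
  assumes c: "c \<in> charts M" "p \<in> fst c" and v: "v \<in> model M"
    and h: "smooth_on_open V h" "snd c p \<in> V" "\<And>x. x \<in> fst c \<Longrightarrow> snd c x \<in> V \<Longrightarrow> h (snd c x) = f x"
  shows "chart_vec M c p v f = frechet_derivative h (at (snd c p)) v"
proof -
  note ch = charts_is_chart[OF c(1)]
  have "smooth_near c p f" using c h unfolding smooth_near_def by blast
  then have s: "smooth_at M p f" by (simp add: smooth_at_near[OF M c])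
  obtain T where T: "open T" "snd c p \<in> T" "\<And>y. y \<in> T \<Longrightarrow> y \<in> model M \<Longrightarrow> y \<in> snd c ` fst c"
    using chart_neighbourhood[OF ch is_chartD(1)[OF ch] c(2) c(2)] by metis
  let ?k = "\<lambda>t. snd c p + t *\<^sub>R v"
  have pm: "snd c p \<in> model M" using is_chartD(6)[OF ch] c(2) by auto
  have km: "?k t \<in> model M" for t
    using subspace_add[OF subspace_model pm subspace_scale[OF subspace_model v]] .
  have kc: "continuous_on UNIV ?k" by (intro continuous_intros)
  have o: "open (?k -` (V \<inter> T))"
    by (rule open_vimage[OF open_Int[OF smooth_on_open_open[OF h(1)] T(1)] kc])
  have "deriv (\<lambda>t. f (inv_into (fst c) (snd c) (?k t))) 0 = deriv (\<lambda>t. h (?k t)) 0"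
  proof (rule deriv_local[OF o])
    show "0 \<in> ?k -` (V \<inter> T)" using h(2) T(2) by simp
    fix t assume "t \<in> ?k -` (V \<inter> T)"
    then have "?k t \<in> snd c ` fst c" "?k t \<in> V" using T(3) km by auto
    then show "f (inv_into (fst c) (snd c) (?k t)) = h (?k t)"
      using h(3) by (metis f_inv_into_f inv_into_into)
  qed
  also have "\<dots> = frechet_derivative h (at (?k 0)) v"
    by (rule deriv_frechet_line[OF h(1)]) (use h(2) in \<open>auto intro!: derivative_eq_intros\<close>)
  finally show ?thesis using s by (simp add: chart_vec_def)
qed

lemma chart_vec_lincomb:
  assumes c: "c \<in> charts M" "p \<in> fst c" and v: "v \<in> model M" "w \<in> model M"
  shows "chart_vec M c p (a *\<^sub>R v + b *\<^sub>R w) = a *\<^sub>R chart_vec M c p v + b *\<^sub>R chart_vec M c p w"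
proof
  fix f
  show "chart_vec M c p (a *\<^sub>R v + b *\<^sub>R w) f = (a *\<^sub>R chart_vec M c p v + b *\<^sub>R chart_vec M c p w) f"
  proof (cases "smooth_at M p f")
    case True
    then obtain V h where h: "smooth_on_open V h" "snd c p \<in> V"
      "\<And>x. x \<in> fst c \<Longrightarrow> snd c x \<in> V \<Longrightarrow> h (snd c x) = f x"
      using smooth_at_witness[OF c] by metis
    have "linear (frechet_derivative h (at (snd c p)))"
      using has_derivative_linear[OF smooth_on_open_has_derivative[OF h(1,2)]] .
    moreover have "a *\<^sub>R v + b *\<^sub>R w \<in> model M"
      using v subspace_model by (intro subspace_add subspace_scale)
    ultimately show ?thesis
      using v by (simp add: chart_vec_eval[OF c _ h] linear_add linear_scale)
  qed (simp add: chart_vec_outside)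
qed

text \<open>The chart components of a tangent vector are its values on the coordinate functions. Hence
  coordinate vectors with different components differ, and components of smooth fields are smooth.\<close>

lemma chart_vec_component:
  assumes c: "c \<in> charts M" "p \<in> fst c" and v: "v \<in> model M"
  shows "chart_vec M c p v (\<lambda>x. snd c x \<bullet> b) = v \<bullet> b"
proof -
  have l: "((\<lambda>y. y \<bullet> b) has_derivative (\<lambda>y. y \<bullet> b)) (at y)" for y :: 'e
    by (intro derivative_intros)
  have "chart_vec M c p v (\<lambda>x. snd c x \<bullet> b) = frechet_derivative (\<lambda>y. y \<bullet> b) (at (snd c p)) v"
    by (rule chart_vec_eval[OF c v, of UNIV])
      (auto intro: smooth_on_open_linear bounded_linear_inner_left)
  also have "\<dots> = v \<bullet> b"
    by (simp add: frechet_derivative_at[OF l, symmetric])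
  finally show ?thesis .
qed

lemma smooth_at_component:
  assumes c: "c \<in> charts M" "p \<in> fst c"
  shows "smooth_at M p (\<lambda>x. snd c x \<bullet> b)"
  unfolding smooth_at_near[OF M c]
  by (rule smooth_near_linear[OF smooth_near_chart[OF c(2)] bounded_linear_inner_left])

lemma chart_vec_inj:
  assumes "c \<in> charts M" "p \<in> fst c" "v \<in> model M" "w \<in> model M" "chart_vec M c p v = chart_vec M c p w"
  shows "v = w"
proof (rule euclidean_eqI)
  show "v \<bullet> b = w \<bullet> b" for b
    using chart_vec_component[OF assms(1-3), of b] chart_vec_component[OF assms(1,2,4), of b] assms(5) by simp
qed

text \<open>A smooth curve, defined through the atlas, is smooth in every chart of the maximal atlas.\<close>

lemma curve_in_chart:
  assumes \<gamma>: "smooth_curve M I \<gamma>" and I: "open I" and t: "t \<in> I" and c: "c \<in> charts M" "\<gamma> t \<in> fst c"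
  obtains J where "t \<in> J" "J \<subseteq> I" "\<gamma> ` J \<subseteq> fst c" "smooth_on_open J (\<lambda>s. snd c (\<gamma> s))"
proof -
  have "\<gamma> t \<in> points M" using \<gamma> t by (auto simp: smooth_curve_def)
  then obtain d where d: "d \<in> atlas M" "\<gamma> t \<in> fst d" using M unfolding smooth_manifold_def by blast
  note dc = atlas_charts[OF M d(1)]
  obtain T where T: "open T" "fst d = points M \<inter> T"
    using is_chartD(1)[OF charts_is_chart[OF dc]] by (auto simp: openin_open)
  let ?A = "{s \<in> I. \<gamma> s \<in> fst d}"
  have A: "?A = I \<inter> \<gamma> -` T" using \<gamma> T(2) by (auto simp: smooth_curve_def)
  have oA: "open ?A" unfolding A
    using \<gamma> I T(1) by (intro continuous_open_preimage) (auto simp: smooth_curve_def)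
  have "smooth_on ?A (snd d \<circ> \<gamma>)" using \<gamma> d(1) by (auto simp: smooth_curve_def)
  then obtain J h where J: "smooth_on_open J h" "t \<in> J" "\<And>s. s \<in> J \<inter> ?A \<Longrightarrow> h s = (snd d \<circ> \<gamma>) s"
    unfolding smooth_on_altdef using t d(2) by blast
  obtain V k where V: "smooth_on_open V k" "snd d (\<gamma> t) \<in> V"
    "\<And>x. x \<in> fst d \<Longrightarrow> snd d x \<in> V \<Longrightarrow> x \<in> fst c \<and> k (snd d x) = snd c x"
    using smooth_near_restrict[OF charts_is_chart[OF dc] is_chartD(1)[OF charts_is_chart[OF c(1)]]
        charts_transition[OF M dc c(1) d(2) c(2)] c(2)] by metis
  let ?J = "(J \<inter> ?A) \<inter> h -` V"
  have "open (J \<inter> ?A)" using smooth_on_open_open[OF J(1)] oA by blast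
  then have oJ: "open ?J"
    using smooth_on_open_continuous[OF J(1)] smooth_on_open_open[OF V(1)]
    by (intro continuous_open_preimage) (auto intro: continuous_on_subset)
  have "smooth_on_open ?J (\<lambda>s. k (h s))"
    by (rule smooth_on_open_compose[OF V(1) smooth_on_open_subset[OF J(1) oJ]]) auto
  then have 1: "smooth_on_open ?J (\<lambda>s. snd c (\<gamma> s))"
    by (rule smooth_on_open_cong) (use V(3) J(3) in auto)
  have 2: "t \<in> ?J" using J V(2) t d(2) by auto
  have 3: "\<gamma> ` ?J \<subseteq> fst c" using V(3) J(3) by auto
  show ?thesis by (rule that[OF 2 _ 3 1]) auto
qed

lemma smooth_curveI:
  assumes "\<gamma> ` I \<subseteq> points M" "continuous_on I \<gamma>"
    and loc: "\<And>t. t \<in> I \<Longrightarrow> \<exists>c\<in>charts M. \<exists>J. t \<in> J \<and> \<gamma> ` J \<subseteq> fst c \<and> smooth_on_open J (\<lambda>s. snd c (\<gamma> s))"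
  shows "smooth_curve M I \<gamma>"
proof -
  have "smooth_on {t \<in> I. \<gamma> t \<in> fst d} (snd d \<circ> \<gamma>)" if d: "d \<in> atlas M" for d
    unfolding smooth_on_altdef
  proof
    fix t assume t: "t \<in> {t \<in> I. \<gamma> t \<in> fst d}"
    then obtain c J where c: "c \<in> charts M" and J: "t \<in> J" "\<gamma> ` J \<subseteq> fst c" "smooth_on_open J (\<lambda>s. snd c (\<gamma> s))"
      using loc by blast
    have tc: "\<gamma> t \<in> fst c" using J by auto
    obtain V k where V: "smooth_on_open V k" "snd c (\<gamma> t) \<in> V"
      "\<And>x. x \<in> fst c \<Longrightarrow> snd c x \<in> V \<Longrightarrow> k (snd c x) = snd d x"
      using charts_transition[OF M c atlas_charts[OF M d] tc] t unfolding smooth_near_def by blast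
    let ?J = "J \<inter> (\<lambda>s. snd c (\<gamma> s)) -` V"
    have oJ: "open ?J"
      using smooth_on_open_continuous[OF J(3)] smooth_on_open_open[OF J(3)] smooth_on_open_open[OF V(1)]
      by (intro continuous_open_preimage)
    have "smooth_on_open ?J (\<lambda>s. k (snd c (\<gamma> s)))"
      by (rule smooth_on_open_compose[OF V(1) smooth_on_open_subset[OF J(3) oJ]]) auto
    then show "\<exists>V h. smooth_on_open V h \<and> t \<in> V \<and> (\<forall>y\<in>V \<inter> {t \<in> I. \<gamma> t \<in> fst d}. h y = (snd d \<circ> \<gamma>) y)"
      using J V by (intro exI[of _ ?J] exI[of _ "\<lambda>s. k (snd c (\<gamma> s))"]) auto
  qed
  then show ?thesis using assms(1,2) by (auto simp: smooth_curve_def)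
qed

lemma velocity_chart:
  assumes c: "c \<in> charts M" and J: "t \<in> J" "\<gamma> ` J \<subseteq> fst c" "smooth_on_open J (\<lambda>s. snd c (\<gamma> s))"
    and v: "((\<lambda>s. snd c (\<gamma> s)) has_vector_derivative v) (at t)"
  shows "v \<in> model M" "velocity M \<gamma> t = chart_vec M c (\<gamma> t) v"
proof -
  note ch = charts_is_chart[OF c]
  have p: "\<gamma> t \<in> fst c" using J by auto
  show vm: "v \<in> model M"
    by (rule has_vector_derivative_subspace[OF subspace_model v smooth_on_open_open[OF J(3)] J(1)])
      (use J(2) is_chartD(6)[OF ch] in auto)
  show "velocity M \<gamma> t = chart_vec M c (\<gamma> t) v"
  proof
    fix f
    show "velocity M \<gamma> t f = chart_vec M c (\<gamma> t) v f"
    proof (cases "smooth_at M (\<gamma> t) f")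
      case True
      then obtain V h where h: "smooth_on_open V h" "snd c (\<gamma> t) \<in> V"
        "\<And>x. x \<in> fst c \<Longrightarrow> snd c x \<in> V \<Longrightarrow> h (snd c x) = f x"
        using smooth_at_witness[OF c p] by metis
      let ?J = "J \<inter> (\<lambda>s. snd c (\<gamma> s)) -` V"
      have oJ: "open ?J"
        using smooth_on_open_continuous[OF J(3)] smooth_on_open_open[OF J(3)] smooth_on_open_open[OF h(1)]
        by (intro continuous_open_preimage)
      have "deriv (f \<circ> \<gamma>) t = deriv (\<lambda>s. h (snd c (\<gamma> s))) t"
        by (rule deriv_local[OF oJ]) (use J h in auto)
      also have "\<dots> = frechet_derivative h (at (snd c (\<gamma> t))) v"
        using deriv_frechet_line[where k="\<lambda>s. snd c (\<gamma> s)", OF h(1,2) v] .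
      also have "\<dots> = chart_vec M c (\<gamma> t) v f"
        using chart_vec_eval[OF c p vm h] by simp
      finally show ?thesis using True by (simp add: velocity_def)
    qed (simp add: velocity_def chart_vec_outside)
  qed
qed

lemma velocity_in_chart_vec:
  assumes \<gamma>: "smooth_curve M I \<gamma>" and I: "open I" and t: "t \<in> I" and c: "c \<in> charts M" "\<gamma> t \<in> fst c"
  shows "velocity M \<gamma> t \<in> chart_vec M c (\<gamma> t) ` model M"
proof -
  obtain J where J: "t \<in> J" "J \<subseteq> I" "\<gamma> ` J \<subseteq> fst c" "smooth_on_open J (\<lambda>s. snd c (\<gamma> s))"
    using curve_in_chart[OF assms] .
  have "(\<lambda>s. snd c (\<gamma> s)) differentiable (at t)"
    using smooth_on_open_has_derivative[OF J(4,1)] by (rule differentiableI)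
  then have "((\<lambda>s. snd c (\<gamma> s)) has_vector_derivative vector_derivative (\<lambda>s. snd c (\<gamma> s)) (at t)) (at t)"
    by (simp add: vector_derivative_works)
  from velocity_chart[OF c(1) J(1,3,4) this] show ?thesis by blast
qed

text \<open>Velocities of curves are coordinate vectors by the chain rule; conversely a coordinate vector is
  the velocity of a straight line in the chart. This identifies the tangent space with the model space
  and gives it its linear structure.\<close>

lemma tangent_space_chart:
  assumes c: "c \<in> charts M" "p \<in> fst c"
  shows "tangent_space M p = chart_vec M c p ` model M"
proof
  show "tangent_space M p \<subseteq> chart_vec M c p ` model M"
  proof
    fix v assume "v \<in> tangent_space M p"
    then obtain \<gamma> e where \<gamma>: "v = velocity M \<gamma> 0" "e > 0" "smooth_curve M {-e<..<e} \<gamma>" "\<gamma> 0 = p"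
      by (auto simp: tangent_space_def)
    then show "v \<in> chart_vec M c p ` model M"
      using velocity_in_chart_vec[OF \<gamma>(3), of 0 c] c by auto
  qed
  show "chart_vec M c p ` model M \<subseteq> tangent_space M p"
  proof
    fix u assume "u \<in> chart_vec M c p ` model M"
    then obtain v where v: "v \<in> model M" "u = chart_vec M c p v" ..
    note ch = charts_is_chart[OF c(1)]
    obtain T where T: "open T" "snd c p \<in> T" "\<And>y. y \<in> T \<Longrightarrow> y \<in> model M \<Longrightarrow> y \<in> snd c ` fst c"
      using chart_neighbourhood[OF ch is_chartD(1)[OF ch] c(2) c(2)] by metis
    let ?k = "\<lambda>t. snd c p + t *\<^sub>R v"
    have pm: "snd c p \<in> model M" using is_chartD(6)[OF ch] c(2) by auto
    have km: "?k t \<in> model M" for t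
      using subspace_add[OF subspace_model pm subspace_scale[OF subspace_model v(1)]] .
    have kc: "continuous_on UNIV ?k" by (intro continuous_intros)
    have "open (?k -` T)"
      by (rule open_vimage[OF T(1) kc])
    moreover have "0 \<in> ?k -` T" using T(2) by simp
    ultimately obtain e where e: "e > 0" "ball 0 e \<subseteq> ?k -` T"
      using open_contains_ball by blast
    let ?J = "{-e<..<e}"
    have kJ: "?k t \<in> snd c ` fst c" if "t \<in> ?J" for t
    proof -
      have "t \<in> ball 0 e" using that by (auto simp: dist_real_def)
      then show ?thesis using e(2) T(3) km by auto
    qed
    let ?g = "\<lambda>t. inv_into (fst c) (snd c) (?k t)"
    have g: "?g t \<in> fst c" "snd c (?g t) = ?k t" if "t \<in> ?J" for t
      using kJ[OF that] by (auto intro: inv_into_into f_inv_into_f)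
    have "smooth_on_open ?J ?k"
      by (intro smooth_on_open_add smooth_on_open_const smooth_on_open_linear bounded_linear_scaleR_left) auto
    then have s: "smooth_on_open ?J (\<lambda>t. snd c (?g t))"
      by (rule smooth_on_open_cong) (simp add: g)
    have "continuous_on (snd c ` fst c) (inv_into (fst c) (snd c))"
      using is_chartD(3)[OF ch] by (simp add: homeomorphism_def)
    then have cg: "continuous_on ?J ?g"
      by (rule continuous_on_compose2) (use kJ in \<open>auto intro!: continuous_intros\<close>)
    have 1: "smooth_curve M ?J ?g"
      by (rule smooth_curveI[OF _ cg])
        (use g is_chartD(5)[OF ch] c s in \<open>auto intro!: bexI[OF _ c(1)] exI[of _ ?J]\<close>)
    have g0: "?g 0 = p" using is_chartD(8)[OF ch c(2)] by simp
    have 2: "velocity M ?g 0 = chart_vec M c (?g 0) v"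
    proof (rule velocity_chart[OF c(1) _ _ s])
      have "(?k has_vector_derivative v) (at 0)" by (auto intro!: derivative_eq_intros)
      then show "((\<lambda>t. snd c (?g t)) has_vector_derivative v) (at 0)"
        by (rule has_vector_derivative_transform_within_open[where S="?J"]) (use e g in auto)
    qed (use e g in auto)
    show "u \<in> tangent_space M p"
      unfolding tangent_space_def mem_Collect_eq
      using 2 g0 v(2) by (intro exI[of _ ?g] conjI exI[of _ e] e(1) 1) auto
  qed
qed

lemma velocity_tangent:
  assumes \<gamma>: "smooth_curve M I \<gamma>" and I: "open I" and t: "t \<in> I"
  shows "velocity M \<gamma> t \<in> tangent_space M (\<gamma> t)"
proof -
  have "\<gamma> t \<in> points M" using \<gamma> t by (auto simp: smooth_curve_def)
  then obtain c where c: "c \<in> charts M" "\<gamma> t \<in> fst c" using chart_exists[OF M] by blast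
  then show ?thesis using velocity_in_chart_vec[OF assms c] tangent_space_chart[OF c] by simp
qed

lemma subspace_tangent_space:
  assumes "p \<in> points M"
  shows "subspace (tangent_space M p)"
proof -
  obtain c where c: "c \<in> charts M" "p \<in> fst c" using chart_exists[OF M assms] .
  have add: "chart_vec M c p v + chart_vec M c p w = chart_vec M c p (v + w)"
    if "v \<in> model M" "w \<in> model M" for v w
    using chart_vec_lincomb[OF c that, of 1 1] by simp
  have scale: "r *\<^sub>R chart_vec M c p v = chart_vec M c p (r *\<^sub>R v)" if "v \<in> model M" for v r
    using chart_vec_lincomb[OF c that that, of r 0] by simp
  have "0 = chart_vec M c p 0"
    using scale[of 0 0] subspace_0[OF subspace_model] by simp
  then show ?thesis
    unfolding subspace_def tangent_space_chart[OF c]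
    using subspace_model add scale by (auto simp: subspace_def image_iff)
qed

text \<open>Tangent vectors see only germs, including the germ's smoothness: both sides are zero
  if the functions are not smooth at \<open>p\<close>.\<close>

lemma tangent_local:
  assumes v: "v \<in> tangent_space M p" and W: "openin (top_of_set (points M)) W" "p \<in> W"
    and eq: "\<And>x. x \<in> W \<Longrightarrow> f x = g x"
  shows "v f = v g"
proof (cases "smooth_at M p f")
  case True
  obtain c where c: "c \<in> charts M" "p \<in> fst c" using chart_exists[OF M tangent_space_points[OF v]] .
  obtain w where w: "w \<in> model M" "v = chart_vec M c p w" using v tangent_space_chart[OF c] by auto
  have "smooth_near c p f" using True smooth_at_near[OF M c] by simp
  then obtain V h where h: "smooth_on_open V h" "snd c p \<in> V"
    "\<And>x. x \<in> fst c \<Longrightarrow> snd c x \<in> V \<Longrightarrow> x \<in> W \<and> h (snd c x) = f x"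
    using smooth_near_restrict[OF charts_is_chart[OF c(1)] W(1) _ W(2)] by metis
  then show ?thesis
    using chart_vec_eval[OF c w(1) h(1,2), of f] chart_vec_eval[OF c w(1) h(1,2), of g] eq w(2) by simp
next
  case False
  then have "\<not> smooth_at M p g" using smooth_at_local[OF M _ W, of g f] eq by auto
  then show ?thesis using tangent_outside[OF v False] tangent_outside[OF v] by simp
qed

lemma tangent_components:
  assumes c: "c \<in> charts M" "p \<in> fst c" and v: "v \<in> tangent_space M p"
  obtains w where "w \<in> model M" "v = chart_vec M c p w" "\<And>b. v (\<lambda>x. snd c x \<bullet> b) = w \<bullet> b"
  using v unfolding tangent_space_chart[OF c] using chart_vec_component[OF c] by blast

lemma tangent_orthonormal_expansion:
  assumes c: "c \<in> charts M" "p \<in> fst c" and v: "v \<in> tangent_space M p"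
    and B: "finite B" "B \<subseteq> model M" "span B = model M" "pairwise orthogonal B" "\<And>b. b \<in> B \<Longrightarrow> norm b = 1"
  shows "v = (\<Sum>b\<in>B. v (\<lambda>x. snd c x \<bullet> b) *\<^sub>R chart_vec M c p b)"
proof -
  obtain w where w: "w \<in> model M" "v = chart_vec M c p w" "\<And>b. v (\<lambda>x. snd c x \<bullet> b) = w \<bullet> b"
    using tangent_components[OF c v] by metis
  have sum: "chart_vec M c p (\<Sum>b\<in>A. r b *\<^sub>R b) = (\<Sum>b\<in>A. r b *\<^sub>R chart_vec M c p b) \<and> (\<Sum>b\<in>A. r b *\<^sub>R b) \<in> model M"
    if "finite A" "A \<subseteq> B" for A r
    using that
  proof (induction A)
    case empty
    then show ?case
      using chart_vec_lincomb[OF c, of 0 0 0 0] subspace_0[OF subspace_model] by simp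
  next
    case (insert a A)
    then have "a \<in> model M" "(\<Sum>b\<in>A. r b *\<^sub>R b) \<in> model M" using B(2) by auto
    then show ?case
      using insert chart_vec_lincomb[OF c, of a "\<Sum>b\<in>A. r b *\<^sub>R b" "r a" 1] subspace_model
      by (auto intro: subspace_add subspace_scale)
  qed
  have "w = (\<Sum>b\<in>B. (w \<bullet> b) *\<^sub>R b)"
  proof -
    obtain r where r: "w = (\<Sum>b\<in>B. r b *\<^sub>R b)"
      using w(1) B(3) span_finite[OF B(1)] by auto
    have "w \<bullet> b = r b" if "b \<in> B" for b
    proof -
      have "w \<bullet> b = (\<Sum>a\<in>B. r a * (a \<bullet> b))" using r by (simp add: inner_sum_left)
      also have "\<dots> = (\<Sum>a\<in>B. if a = b then r b else 0)"
        using B(4,5) that by (intro sum.cong) (auto simp: pairwise_def orthogonal_def dot_square_norm)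
      finally show ?thesis using B(1) that by simp
    qed
    then show ?thesis using r by simp
  qed
  then show ?thesis using sum[OF B(1), of "\<lambda>b. w \<bullet> b"] w by simp
qed

lemma chart_vec_smooth_field:
  assumes c: "c \<in> charts M" and v: "v \<in> model M"
  shows "smooth_vector_field M (fst c) (\<lambda>x. chart_vec M c x v)"
  unfolding smooth_vector_field_def
proof (intro conjI ballI allI impI)
  note ch = charts_is_chart[OF c]
  show "openin (top_of_set (points M)) (fst c)" using is_chartD(1)[OF ch] .
  fix p assume p: "p \<in> fst c"
  show "chart_vec M c p v \<in> tangent_space M p" using tangent_space_chart[OF c p] v by simp
  fix f assume "smooth_at M p f"
  then obtain V h where h: "smooth_on_open V h" "snd c p \<in> V"
    "\<And>x. x \<in> fst c \<Longrightarrow> snd c x \<in> V \<Longrightarrow> h (snd c x) = f x"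
    using smooth_at_witness[OF c p] by metis
  have "chart_vec M c x v f = frechet_derivative h (at (snd c x)) v" if "x \<in> fst c" "snd c x \<in> V" for x
    using chart_vec_eval[OF c that(1) v h(1) that(2), of f] h(3) by simp
  then have "smooth_near c p (\<lambda>x. chart_vec M c x v f)"
    unfolding smooth_near_def using h(2) p smooth_on_open_frechet[OF h(1), of v]
    by (intro conjI exI[of _ V] exI[of _ "\<lambda>y. frechet_derivative h (at y) v"]) auto
  then show "smooth_at M p (\<lambda>x. chart_vec M c x v f)" by (simp add: smooth_at_near[OF M c p])
qed

lemma smooth_vector_field_add:
  assumes "smooth_vector_field M U X" "smooth_vector_field M U Y"
  shows "smooth_vector_field M U (\<lambda>x. X x + Y x)"
  unfolding smooth_vector_field_def
  using assms smooth_vector_fieldD[OF assms(1)] smooth_vector_fieldD[OF assms(2)]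
  by (auto simp: smooth_vector_field_def intro!: smooth_at_add[OF M] subspace_add subspace_tangent_space)

lemma smooth_vector_field_scale:
  assumes "smooth_vector_field M U X" "\<And>x. x \<in> U \<Longrightarrow> smooth_at M x f"
  shows "smooth_vector_field M U (\<lambda>x. f x *\<^sub>R X x)"
  unfolding smooth_vector_field_def
  using assms smooth_vector_fieldD[OF assms(1)]
  by (auto simp: smooth_vector_field_def intro!: smooth_at_mult[OF M] subspace_scale subspace_tangent_space)

lemma smooth_vector_field_zero:
  assumes "openin (top_of_set (points M)) U"
  shows "smooth_vector_field M U (\<lambda>x. 0)"
  unfolding smooth_vector_field_def using assms openin_imp_subset[OF assms]
  by (auto intro!: smooth_at_const[OF M] subspace_0 subspace_tangent_space)

lemma smooth_vector_field_sum:
  assumes "openin (top_of_set (points M)) U" "\<And>i. i \<in> I \<Longrightarrow> smooth_vector_field M U (X i)"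
  shows "smooth_vector_field M U (\<lambda>x. \<Sum>i\<in>I. X i x)"
  using assms(2)
  by (induction I rule: infinite_finite_induct)
    (auto intro: smooth_vector_field_zero[OF assms(1)] smooth_vector_field_add)

lemma tangent_extension:
  assumes v: "v \<in> tangent_space M p"
  obtains U X where "smooth_vector_field M U X" "p \<in> U" "X p = v"
proof -
  obtain c where c: "c \<in> charts M" "p \<in> fst c" using chart_exists[OF M tangent_space_points[OF v]] .
  obtain w where "w \<in> model M" "v = chart_vec M c p w" using v tangent_space_chart[OF c] by auto
  then show ?thesis using that[OF chart_vec_smooth_field[OF c(1)] c(2)] by blast
qed

lemma smooth_vector_field_local:
  assumes o: "openin (top_of_set (points M)) U"
    and loc: "\<And>p. p \<in> U \<Longrightarrow> \<exists>W Y. smooth_vector_field M W Y \<and> p \<in> W \<and> (\<forall>x\<in>W. Y x = X x)"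
  shows "smooth_vector_field M U X"
  unfolding smooth_vector_field_def
proof (intro conjI ballI allI impI o)
  fix p assume p: "p \<in> U"
  then obtain W Y where Y: "smooth_vector_field M W Y" "p \<in> W" "\<forall>x\<in>W. Y x = X x" using loc by blast
  show "X p \<in> tangent_space M p" using smooth_vector_fieldD(1)[OF Y(1,2)] Y(2,3) by simp
  fix f assume "smooth_at M p f"
  then have "smooth_at M p (\<lambda>x. Y x f)" by (rule smooth_vector_fieldD(2)[OF Y(1,2)])
  then show "smooth_at M p (\<lambda>x. X x f)"
    by (rule smooth_at_local[OF M _ smooth_vector_fieldD(3)[OF Y(1,2)] Y(2)]) (use Y(3) in simp)
qed

lemma tangent_subspace: "v \<in> tangent_space M p \<Longrightarrow> subspace (tangent_space M p)"
  using subspace_tangent_space[OF tangent_space_points] .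

lemma subspace_chart_vec:
  assumes c: "c \<in> charts M" "p \<in> fst c" and E: "subspace E" "E \<subseteq> model M"
  shows "subspace (chart_vec M c p ` E)"
  unfolding subspace_def
proof (intro conjI ballI allI)
  have cv: "a *\<^sub>R chart_vec M c p v + b *\<^sub>R chart_vec M c p w \<in> chart_vec M c p ` E" if "v \<in> E" "w \<in> E" for a b v w
  proof -
    have "chart_vec M c p (a *\<^sub>R v + b *\<^sub>R w) = a *\<^sub>R chart_vec M c p v + b *\<^sub>R chart_vec M c p w"
      by (rule chart_vec_lincomb[OF c]) (use that E in auto)
    moreover have "a *\<^sub>R v + b *\<^sub>R w \<in> E"
      using that by (intro subspace_add[OF E(1)] subspace_scale[OF E(1)])
    ultimately show ?thesis by (metis imageI)
  qed
  show "0 \<in> chart_vec M c p ` E" using cv[of 0 0 0 0] subspace_0[OF E(1)] by simp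
  fix u assume u: "u \<in> chart_vec M c p ` E"
  then obtain v where v: "v \<in> E" "u = chart_vec M c p v" by blast
  show "u + u' \<in> chart_vec M c p ` E" if u': "u' \<in> chart_vec M c p ` E" for u'
  proof -
    obtain v' where "v' \<in> E" "u' = chart_vec M c p v'" using u' by blast
    then show ?thesis using cv[of v v' 1 1] v by simp
  qed
  show "r *\<^sub>R u \<in> chart_vec M c p ` E" for r
    using cv[of v v r 0] v by simp
qed

end


section \<open>Riemannian metrics and the Levi-Civita connection\<close>

text \<open>An orthogonal frame on \<open>U\<close>. Orthogonality is expressed by what it is used for: every tangent vector
  is the sum of its projections onto the frame vectors, with coefficients computed by \<open>g\<close>.\<close>

definition expanding_frame ::
  "('a::{t2_space,second_countable_topology}, 'e::euclidean_space) manifold \<Rightarrow> 'a metric \<Rightarrow> 'a set \<Rightarrow>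
     nat \<Rightarrow> (nat \<Rightarrow> 'a \<Rightarrow> 'a tvec) \<Rightarrow> bool" where
  "expanding_frame M g U n E \<longleftrightarrow> (\<forall>i<n. smooth_vector_field M U (E i)) \<and>
     (\<forall>x\<in>U. (\<forall>i<n. E i x \<noteq> 0) \<and>
        (\<forall>v\<in>tangent_space M x. v = (\<Sum>i<n. (g x v (E i x) / g x (E i x) (E i x)) *\<^sub>R E i x)))"

lemma expanding_frameD:
  assumes "expanding_frame M g U n E"
  shows "i < n \<Longrightarrow> smooth_vector_field M U (E i)" "x \<in> U \<Longrightarrow> i < n \<Longrightarrow> E i x \<noteq> 0"
    "x \<in> U \<Longrightarrow> v \<in> tangent_space M x \<Longrightarrow> v = (\<Sum>i<n. (g x v (E i x) / g x (E i x) (E i x)) *\<^sub>R E i x)"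
  using assms unfolding expanding_frame_def by blast+

lemma affine_connectionD:
  assumes "affine_connection M nab"
  shows "smooth_vector_field M U Y \<Longrightarrow> p \<in> U \<Longrightarrow> u \<in> tangent_space M p \<Longrightarrow> v \<in> tangent_space M p \<Longrightarrow>
      nab p (a *\<^sub>R u + b *\<^sub>R v) Y = a *\<^sub>R nab p u Y + b *\<^sub>R nab p v Y"
    "smooth_vector_field M U Y \<Longrightarrow> smooth_vector_field M U Z \<Longrightarrow> p \<in> U \<Longrightarrow> v \<in> tangent_space M p \<Longrightarrow>
      nab p v (\<lambda>x. Y x + Z x) = nab p v Y + nab p v Z"
    "smooth_vector_field M U Y \<Longrightarrow> (\<And>x. x \<in> U \<Longrightarrow> smooth_at M x f) \<Longrightarrow> p \<in> U \<Longrightarrow> v \<in> tangent_space M p \<Longrightarrow>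
      nab p v (\<lambda>x. f x *\<^sub>R Y x) = v f *\<^sub>R Y p + f p *\<^sub>R nab p v Y"
    "smooth_vector_field M U Y \<Longrightarrow> smooth_vector_field M U Z \<Longrightarrow> (\<And>x. x \<in> U \<Longrightarrow> Y x = Z x) \<Longrightarrow>
      p \<in> U \<Longrightarrow> v \<in> tangent_space M p \<Longrightarrow> nab p v Y = nab p v Z"
    "smooth_vector_field M U X \<Longrightarrow> smooth_vector_field M U Y \<Longrightarrow> smooth_vector_field M U (\<lambda>x. nab x (X x) Y)"
proof -
  note n = assms[unfolded affine_connection_def]
  note n1 = conjunct1[OF n] and n2 = conjunct1[OF conjunct2[OF n]]
    and n3 = conjunct1[OF conjunct2[OF conjunct2[OF n]]]
    and n4 = conjunct1[OF conjunct2[OF conjunct2[OF conjunct2[OF n]]]]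
    and n5 = conjunct2[OF conjunct2[OF conjunct2[OF conjunct2[OF n]]]]
  show "smooth_vector_field M U Y \<Longrightarrow> p \<in> U \<Longrightarrow> u \<in> tangent_space M p \<Longrightarrow> v \<in> tangent_space M p \<Longrightarrow>
      nab p (a *\<^sub>R u + b *\<^sub>R v) Y = a *\<^sub>R nab p u Y + b *\<^sub>R nab p v Y"
    by (rule n1[rule_format])
  show "smooth_vector_field M U Y \<Longrightarrow> smooth_vector_field M U Z \<Longrightarrow> p \<in> U \<Longrightarrow> v \<in> tangent_space M p \<Longrightarrow>
      nab p v (\<lambda>x. Y x + Z x) = nab p v Y + nab p v Z"
    by (rule n2[rule_format, OF conjI])
  show "smooth_vector_field M U Y \<Longrightarrow> (\<And>x. x \<in> U \<Longrightarrow> smooth_at M x f) \<Longrightarrow> p \<in> U \<Longrightarrow> v \<in> tangent_space M p \<Longrightarrow>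
      nab p v (\<lambda>x. f x *\<^sub>R Y x) = v f *\<^sub>R Y p + f p *\<^sub>R nab p v Y"
    by (rule n3[rule_format, OF conjI]) blast+
  show "smooth_vector_field M U Y \<Longrightarrow> smooth_vector_field M U Z \<Longrightarrow> (\<And>x. x \<in> U \<Longrightarrow> Y x = Z x) \<Longrightarrow>
      p \<in> U \<Longrightarrow> v \<in> tangent_space M p \<Longrightarrow> nab p v Y = nab p v Z"
    by (rule n4[rule_format, OF conjI, OF _ conjI]) blast+
  show "smooth_vector_field M U X \<Longrightarrow> smooth_vector_field M U Y \<Longrightarrow> smooth_vector_field M U (\<lambda>x. nab x (X x) Y)"
    by (rule n5[rule_format, OF conjI])
qed

lemma levi_civitaD:
  assumes "levi_civita M g nab"
  shows "affine_connection M nab"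
    "smooth_vector_field M U X \<Longrightarrow> smooth_vector_field M U Y \<Longrightarrow> p \<in> U \<Longrightarrow>
      nab p (X p) Y - nab p (Y p) X = lie_bracket M X Y p"
    "smooth_vector_field M U Y \<Longrightarrow> smooth_vector_field M U Z \<Longrightarrow> p \<in> U \<Longrightarrow> v \<in> tangent_space M p \<Longrightarrow>
      v (\<lambda>x. g x (Y x) (Z x)) = g p (nab p v Y) (Z p) + g p (Y p) (nab p v Z)"
proof -
  note n = assms[unfolded levi_civita_def]
  show "affine_connection M nab" by (rule conjunct1[OF n])
  show "smooth_vector_field M U X \<Longrightarrow> smooth_vector_field M U Y \<Longrightarrow> p \<in> U \<Longrightarrow>
      nab p (X p) Y - nab p (Y p) X = lie_bracket M X Y p"
    by (rule conjunct1[OF conjunct2[OF n], rule_format, OF conjI])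
  show "smooth_vector_field M U Y \<Longrightarrow> smooth_vector_field M U Z \<Longrightarrow> p \<in> U \<Longrightarrow> v \<in> tangent_space M p \<Longrightarrow>
      v (\<lambda>x. g x (Y x) (Z x)) = g p (nab p v Y) (Z p) + g p (Y p) (nab p v Z)"
    by (rule conjunct2[OF conjunct2[OF n], rule_format, OF conjI])
qed

lemma linear_form_sum:
  assumes T: "subspace T" and l: "linear_form_on T l" and v: "\<And>i. i \<in> I \<Longrightarrow> v i \<in> T"
  shows "l (\<Sum>i\<in>I. r i *\<^sub>R v i) = (\<Sum>i\<in>I. r i * l (v i))"
proof -
  have z: "l 0 = 0" using l subspace_0[OF T] unfolding linear_form_on_def by (metis mult_zero_left scaleR_zero_left)
  have "l (\<Sum>i\<in>J. r i *\<^sub>R v i) = (\<Sum>i\<in>J. r i * l (v i))" if "J \<subseteq> I" for J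
    using that
  proof (induction J rule: infinite_finite_induct)
    case (insert j J)
    then have "r j *\<^sub>R v j \<in> T" "(\<Sum>i\<in>J. r i *\<^sub>R v i) \<in> T" "v j \<in> T"
      using v T by (auto intro!: subspace_scale subspace_sum)
    then show ?case using insert l by (simp add: linear_form_on_def)
  qed (simp_all add: z)
  then show ?thesis by simp
qed

text \<open>Extend the direction to a smooth field; the covariant derivative is then a smooth field, and
  its value at \<open>p\<close> is tangent.\<close>

lemma connection_tangent:
  assumes M: "smooth_manifold M"
    and n: "affine_connection M nab" and Y: "smooth_vector_field M U Y" "p \<in> U" and v: "v \<in> tangent_space M p"
  shows "nab p v Y \<in> tangent_space M p"
proof -
  obtain V X where X: "smooth_vector_field M V X" "p \<in> V" "X p = v" using tangent_extension[OF M v] .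
  have o: "openin (top_of_set (points M)) (U \<inter> V)"
    using smooth_vector_fieldD(3)[OF Y] smooth_vector_fieldD(3)[OF X(1,2)] by blast
  have "smooth_vector_field M (U \<inter> V) X" "smooth_vector_field M (U \<inter> V) Y"
    using smooth_vector_field_subset[OF X(1) o] smooth_vector_field_subset[OF Y(1) o] by auto
  then have "smooth_vector_field M (U \<inter> V) (\<lambda>x. nab x (X x) Y)"
    by (rule affine_connectionD(5)[OF n])
  then show ?thesis using smooth_vector_fieldD(1)[of M "U \<inter> V" _ p] X Y by fastforce
qed

context
  fixes M :: "('a::{t2_space,second_countable_topology}, 'e::euclidean_space) manifold" and g :: "'a metric"
  assumes M: "smooth_manifold M" and g: "riemannian_metric M g"
begin

lemma metric_sym: "u \<in> tangent_space M p \<Longrightarrow> v \<in> tangent_space M p \<Longrightarrow> g p u v = g p v u"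
  using g tangent_space_points[of u M p] by (auto simp: riemannian_metric_def)

lemma metric_pos: "u \<in> tangent_space M p \<Longrightarrow> u \<noteq> 0 \<Longrightarrow> g p u u > 0"
  using g tangent_space_points[of u M p] by (auto simp: riemannian_metric_def)

lemma metric_linear: "u \<in> tangent_space M p \<Longrightarrow> linear_form_on (tangent_space M p) (g p u)"
  using g tangent_space_points[of u M p] by (auto simp: riemannian_metric_def)

lemma metric_add_right:
  "u \<in> tangent_space M p \<Longrightarrow> v \<in> tangent_space M p \<Longrightarrow> w \<in> tangent_space M p \<Longrightarrow> g p u (v + w) = g p u v + g p u w"
  using metric_linear by (auto simp: linear_form_on_def)

lemma metric_scale_right:
  "u \<in> tangent_space M p \<Longrightarrow> v \<in> tangent_space M p \<Longrightarrow> g p u (r *\<^sub>R v) = r * g p u v"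
  using metric_linear by (auto simp: linear_form_on_def)

lemma metric_diff_right:
  assumes "u \<in> tangent_space M p" "v \<in> tangent_space M p" "w \<in> tangent_space M p"
  shows "g p u (v - w) = g p u v - g p u w"
  using metric_add_right[OF assms(1,2), of "(- 1) *\<^sub>R w"] metric_scale_right[OF assms(1,3), of "-1"]
    subspace_scale[OF tangent_subspace[OF M assms(3)] assms(3), of "-1"] by simp

lemma metric_diff_left:
  assumes "u \<in> tangent_space M p" "v \<in> tangent_space M p" "w \<in> tangent_space M p"
  shows "g p (v - w) u = g p v u - g p w u"
  using metric_diff_right[OF assms] assms metric_sym subspace_diff[OF tangent_subspace[OF M assms(1)] assms(2,3)]
  by simp

lemma metric_eqI:
  assumes "u \<in> tangent_space M p" "v \<in> tangent_space M p" "\<And>w. w \<in> tangent_space M p \<Longrightarrow> g p u w = g p v w"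
  shows "u = v"
proof (rule ccontr)
  assume "u \<noteq> v"
  have d: "u - v \<in> tangent_space M p" using assms tangent_subspace[OF M] by (auto intro: subspace_diff)
  have "g p (u - v) (u - v) = 0" using metric_diff_left[OF d assms(1,2)] assms(3)[OF d] by simp
  then show False using metric_pos[OF d] \<open>u \<noteq> v\<close> by simp
qed

lemma metric_smooth:
  assumes "smooth_vector_field M U X" "smooth_vector_field M U Y" "p \<in> U"
  shows "smooth_at M p (\<lambda>x. g x (X x) (Y x))"
  by (rule conjunct2[OF g[unfolded riemannian_metric_def], rule_format, OF conjI, OF assms])

text \<open>One step of Gram-Schmidt without normalisation, so that only divisions, and no square roots,
  are involved. The new vector is nonzero because \<open>X\<close> lies outside the span of the earlier ones.\<close>

lemma gram_schmidt_step:
  fixes n :: nat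
  assumes T: "subspace T" "T \<subseteq> tangent_space M p" and X: "X \<in> tangent_space M p" "X \<notin> T"
    and E: "\<And>i. i < n \<Longrightarrow> E i \<in> T" "\<And>i. i < n \<Longrightarrow> E i \<noteq> 0"
      "\<And>i j. i < n \<Longrightarrow> j < n \<Longrightarrow> i \<noteq> j \<Longrightarrow> g p (E i) (E j) = 0"
  defines "N \<equiv> X + (- 1) *\<^sub>R (\<Sum>i<n. (g p X (E i) / g p (E i) (E i)) *\<^sub>R E i)"
  shows "N \<noteq> 0" "N \<in> tangent_space M p" "\<And>j. j < n \<Longrightarrow> g p N (E j) = 0"
proof -
  let ?S = "\<Sum>i<n. (g p X (E i) / g p (E i) (E i)) *\<^sub>R E i"
  have S: "?S \<in> T" using T(1) E(1) by (auto intro!: subspace_sum subspace_scale)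
  then have St: "?S \<in> tangent_space M p" using T(2) by auto
  have Nd: "N = X - ?S" by (simp add: N_def)
  show "N \<noteq> 0" using X(2) S by (auto simp: Nd)
  show Nt: "N \<in> tangent_space M p" unfolding Nd using tangent_subspace[OF M X(1)] X(1) St by (rule subspace_diff)
  fix j assume j: "j < n"
  have Ej: "E j \<in> tangent_space M p" using E(1)[OF j] T(2) by auto
  have pos: "g p (E j) (E j) > 0" using metric_pos[OF Ej E(2)[OF j]] .
  have "g p (E j) ?S = (\<Sum>i<n. (g p X (E i) / g p (E i) (E i)) * g p (E j) (E i))"
    by (rule linear_form_sum[OF T(1)])
      (use metric_linear[OF Ej] T(2) E(1) in \<open>auto simp: linear_form_on_def subset_iff\<close>)
  also have "\<dots> = (\<Sum>i<n. if i = j then g p X (E j) else 0)"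
    using E(3)[OF j] pos by (intro sum.cong) auto
  also have "\<dots> = g p X (E j)" using j by simp
  finally show "g p N (E j) = 0"
    unfolding Nd using metric_diff_left[OF Ej X(1) St] metric_sym[OF St Ej] by simp
qed

text \<open>Gram-Schmidt applied to the coordinate fields of an orthonormal basis of the model space. The
  divisors \<open>g (E\<^sub>i, E\<^sub>i)\<close> vanish nowhere on the chart domain, as the coordinate vectors are linearly
  independent at each point, so smoothness is preserved.\<close>

lemma orthogonal_frame:
  assumes c: "c \<in> charts M"
  obtains n E where "expanding_frame M g (fst c) n E"
proof -
  obtain B where B: "B \<subseteq> model M" "pairwise orthogonal B" "\<And>x. x \<in> B \<Longrightarrow> norm x = 1"
    "independent B" "span B = model M"
    using orthonormal_basis_subspace[OF subspace_model[OF M]] by metis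
  have finB: "finite B" using B(4) independent_imp_finite by blast
  note U = is_chartD(1)[OF charts_is_chart[OF c]]
  \<comment> \<open>the invariant of the process: the first \<open>n\<close> fields are orthogonal and span the same subspaces as
    the coordinate fields of \<open>A\<close>, so the next coordinate vector is independent of them\<close>
  define framed where "framed A n E \<longleftrightarrow> (\<forall>i<n. smooth_vector_field M (fst c) (E i)) \<and>
      (\<forall>x\<in>fst c. (\<forall>i<n. E i x \<noteq> 0 \<and> E i x \<in> chart_vec M c x ` span A) \<and>
         (\<forall>i<n. \<forall>j<n. i \<noteq> j \<longrightarrow> g x (E i x) (E j x) = 0) \<and>
         chart_vec M c x ` A \<subseteq> span ((\<lambda>i. E i x) ` {..<n}))" for A and n :: nat and E
  have "\<exists>n E. framed A n E" if "finite A" "A \<subseteq> B" for A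
    using that
  proof (induction A)
    case empty
    have "framed {} 0 E" for E by (simp add: framed_def)
    then show ?case by blast
  next
    case (insert b A)
    then obtain n E where "framed A n E" by blast
    then have E: "\<And>i. i < n \<Longrightarrow> smooth_vector_field M (fst c) (E i)"
      "\<And>i x. x \<in> fst c \<Longrightarrow> i < n \<Longrightarrow> E i x \<noteq> 0"
      "\<And>i x. x \<in> fst c \<Longrightarrow> i < n \<Longrightarrow> E i x \<in> chart_vec M c x ` span A"
      "\<And>i j x. x \<in> fst c \<Longrightarrow> i < n \<Longrightarrow> j < n \<Longrightarrow> i \<noteq> j \<Longrightarrow> g x (E i x) (E j x) = 0"
      "\<And>x. x \<in> fst c \<Longrightarrow> chart_vec M c x ` A \<subseteq> span ((\<lambda>i. E i x) ` {..<n})"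
      unfolding framed_def by blast+
    define X where "X x = chart_vec M c x b" for x
    define N where "N x = X x + (- 1) *\<^sub>R (\<Sum>i<n. (g x (X x) (E i x) / g x (E i x) (E i x)) *\<^sub>R E i x)" for x
    have b: "b \<in> model M" "b \<in> B" "A \<subseteq> B" using insert B(1) by auto
    have spA: "span A \<subseteq> model M" using b(3) B(5) span_mono by blast
    have spbA: "span (insert b A) \<subseteq> model M" using insert(4) B(5) span_mono by blast
    have bn: "b \<notin> span A"
      using B(4) insert(2) b span_mono[of A "B - {b}"] unfolding dependent_def by blast
    have Xs: "smooth_vector_field M (fst c) X"
      unfolding X_def[abs_def] by (rule chart_vec_smooth_field[OF M c b(1)])
    have Ns: "smooth_vector_field M (fst c) N"
      unfolding N_def[abs_def]
    proof (intro smooth_vector_field_add[OF M Xs] smooth_vector_field_scale[OF M] smooth_vector_field_sum[OF M U])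
      fix i assume i: "i \<in> {..<n}"
      then show "smooth_vector_field M (fst c) (E i)" using E(1) by auto
      fix x assume x: "x \<in> fst c"
      have "E i x \<in> tangent_space M x" using smooth_vector_fieldD(1)[OF E(1) x] i by auto
      then have "g x (E i x) (E i x) \<noteq> 0" using metric_pos[of "E i x" x] E(2)[OF x] i by auto
      then show "smooth_at M x (\<lambda>x. g x (X x) (E i x) / g x (E i x) (E i x))"
        using i by (intro smooth_at_divide[OF M] metric_smooth[OF Xs _ x] metric_smooth[OF _ _ x] E(1)) auto
    next
      show "\<And>x. x \<in> fst c \<Longrightarrow> smooth_at M x (\<lambda>x. - 1)"
        using smooth_at_const[OF M] is_chartD(5)[OF charts_is_chart[OF c]] by blast
    qed
    have gs: "N x \<noteq> 0" "N x \<in> tangent_space M x" "\<And>j. j < n \<Longrightarrow> g x (N x) (E j x) = 0"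
      "N x \<in> chart_vec M c x ` span (insert b A)" if x: "x \<in> fst c" for x
    proof -
      note cx = c x
      have T: "subspace (chart_vec M c x ` span A)" "chart_vec M c x ` span A \<subseteq> tangent_space M x"
        using subspace_chart_vec[OF M cx subspace_span spA] spA tangent_space_chart[OF M cx] by auto
      have Xt: "X x \<in> tangent_space M x" using b(1) tangent_space_chart[OF M cx] by (auto simp: X_def)
      have Xn: "X x \<notin> chart_vec M c x ` span A"
      proof
        assume "X x \<in> chart_vec M c x ` span A"
        then obtain w where "w \<in> span A" "chart_vec M c x b = chart_vec M c x w" by (auto simp: X_def)
        then have "b = w" using chart_vec_inj[OF M cx b(1)] spA by blast
        then show False using bn \<open>w \<in> span A\<close> by simp
      qed
      show "N x \<noteq> 0" "N x \<in> tangent_space M x" "\<And>j. j < n \<Longrightarrow> g x (N x) (E j x) = 0"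
        using gram_schmidt_step[OF T Xt Xn, of n "\<lambda>i. E i x"] E(2-4)[OF x] unfolding N_def by blast+
      have T': "subspace (chart_vec M c x ` span (insert b A))"
        using subspace_chart_vec[OF M cx subspace_span spbA] .
      have "chart_vec M c x ` span A \<subseteq> chart_vec M c x ` span (insert b A)"
        by (intro image_mono span_mono) auto
      then have 1: "E i x \<in> chart_vec M c x ` span (insert b A)" if "i < n" for i
        using E(3)[OF x that] by blast
      have 2: "X x \<in> chart_vec M c x ` span (insert b A)"
        unfolding X_def by (intro imageI span_base) simp
      show "N x \<in> chart_vec M c x ` span (insert b A)"
        unfolding N_def by (intro subspace_add[OF T'] subspace_scale[OF T'] subspace_sum[OF T'] 1 2) auto
    qed
    have "framed (insert b A) (Suc n) (\<lambda>i. if i < n then E i else N)"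
      unfolding framed_def
    proof (intro conjI ballI allI impI)
      fix x assume x: "x \<in> fst c"
      fix i assume i: "i < Suc n"
      show "(if i < n then E i else N) x \<noteq> 0" using gs(1)[OF x] E(2)[OF x] by auto
      have "chart_vec M c x ` span A \<subseteq> chart_vec M c x ` span (insert b A)"
        by (intro image_mono span_mono) auto
      then show "(if i < n then E i else N) x \<in> chart_vec M c x ` span (insert b A)"
        using gs(4)[OF x] E(3)[OF x] by (cases "i < n") auto
      fix j assume j: "j < Suc n" "i \<noteq> j"
      have "g x (E i x) (N x) = 0" if "i < n" for i
        using gs(3)[OF x that] metric_sym[OF smooth_vector_fieldD(1)[OF E(1)[OF that] x] gs(2)[OF x]] by simp
      then show "g x ((if i < n then E i else N) x) ((if j < n then E j else N) x) = 0"
        using i j gs(3)[OF x] E(4)[OF x, of i j] by auto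
    next
      fix x assume x: "x \<in> fst c"
      let ?S = "span ((\<lambda>i. (if i < n then E i else N) x) ` {..<Suc n})"
      have Ei: "E i x \<in> ?S" if "i < n" for i
        by (rule span_base) (use that in \<open>auto simp: image_iff intro!: bexI[of _ i]\<close>)
      have Nx: "N x \<in> ?S"
        by (rule span_base) (auto simp: image_iff intro!: bexI[of _ n])
      have "span ((\<lambda>i. E i x) ` {..<n}) \<subseteq> ?S"
        by (rule span_minimal) (use Ei in \<open>auto simp: subspace_span\<close>)
      moreover have Xx: "X x = N x + (\<Sum>i<n. (g x (X x) (E i x) / g x (E i x) (E i x)) *\<^sub>R E i x)"
        by (simp add: N_def)
      have "X x \<in> ?S" by (rule ssubst[OF Xx], intro span_add[OF Nx] span_sum span_scale Ei) simp
      ultimately show "chart_vec M c x ` insert b A \<subseteq> ?S"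
        using E(5)[OF x] by (auto simp: X_def)
    qed (use E(1) Ns in auto)
    then show ?case by blast
  qed
  from this[OF finB order_refl] obtain n E where "framed B n E" by blast
  then have E:
      "\<And>i. i < n \<Longrightarrow> smooth_vector_field M (fst c) (E i)"
      "\<And>i x. x \<in> fst c \<Longrightarrow> i < n \<Longrightarrow> E i x \<noteq> 0"
      "\<And>i j x. x \<in> fst c \<Longrightarrow> i < n \<Longrightarrow> j < n \<Longrightarrow> i \<noteq> j \<Longrightarrow> g x (E i x) (E j x) = 0"
      "\<And>x. x \<in> fst c \<Longrightarrow> chart_vec M c x ` B \<subseteq> span ((\<lambda>i. E i x) ` {..<n})"
    unfolding framed_def by blast+
  show ?thesis
  proof (rule that[of n E], unfold expanding_frame_def, intro conjI ballI allI impI)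
    fix x v assume x: "x \<in> fst c" and v: "v \<in> tangent_space M x"
    let ?T = "span ((\<lambda>i. E i x) ` {..<n})"
    have Et: "E i x \<in> tangent_space M x" if "i < n" for i using smooth_vector_fieldD(1)[OF E(1)[OF that] x] .
    have T: "?T \<subseteq> tangent_space M x"
      by (rule span_minimal) (use Et tangent_subspace[OF M v] in auto)
    have vT: "v \<in> ?T"
    proof -
      have "v = (\<Sum>b\<in>B. v (\<lambda>x. snd c x \<bullet> b) *\<^sub>R chart_vec M c x b)"
        using tangent_orthonormal_expansion[OF M c x v finB B(1,5,2,3)] .
      moreover have "\<dots> \<in> ?T" using E(4)[OF x] by (intro span_sum span_scale) auto
      ultimately show ?thesis by simp
    qed
    show "v = (\<Sum>i<n. (g x v (E i x) / g x (E i x) (E i x)) *\<^sub>R E i x)"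
    proof (rule ccontr)
      assume ne: "v \<noteq> (\<Sum>i<n. (g x v (E i x) / g x (E i x) (E i x)) *\<^sub>R E i x)"
      let ?N = "v + (- 1) *\<^sub>R (\<Sum>i<n. (g x v (E i x) / g x (E i x) (E i x)) *\<^sub>R E i x)"
      have N: "?N \<noteq> 0" using ne by simp
      have NT: "?N \<in> ?T" using vT by (intro span_add span_scale span_sum) (auto intro: span_base)
      then have Nt: "?N \<in> tangent_space M x" using T by blast
      have orth: "g x ?N (E j x) = 0" if j: "j < n" for j
      proof -
        have St: "(\<Sum>i<n. (g x v (E i x) / g x (E i x) (E i x)) *\<^sub>R E i x) \<in> tangent_space M x"
          using Et by (auto intro!: subspace_sum[OF tangent_subspace[OF M v]] subspace_scale[OF tangent_subspace[OF M v]])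
        have "g x (E j x) (\<Sum>i<n. (g x v (E i x) / g x (E i x) (E i x)) *\<^sub>R E i x) =
            (\<Sum>i<n. (g x v (E i x) / g x (E i x) (E i x)) * g x (E j x) (E i x))"
          by (rule linear_form_sum[OF tangent_subspace[OF M v] metric_linear[OF Et[OF j]]]) (use Et in auto)
        also have "\<dots> = (\<Sum>i<n. if i = j then g x v (E j x) else 0)"
          using E(3)[OF x j] metric_pos[OF Et[OF j] E(2)[OF x j]] by (intro sum.cong) auto
        also have "\<dots> = g x v (E j x)" using j by simp
        finally show ?thesis
          using metric_diff_left[OF Et[OF j] v St] metric_sym[OF St Et[OF j]] by simp
      qed
      have "g x ?N ?N = 0"
      proof -
        obtain r where r: "?N = (\<Sum>w\<in>(\<lambda>i. E i x) ` {..<n}. r w *\<^sub>R w)"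
          using NT unfolding span_finite[OF finite_imageI[OF finite_lessThan]] by blast
        have "g x ?N (\<Sum>w\<in>(\<lambda>i. E i x) ` {..<n}. r w *\<^sub>R w) = (\<Sum>w\<in>(\<lambda>i. E i x) ` {..<n}. r w * g x ?N w)"
          by (rule linear_form_sum[OF tangent_subspace[OF M v] metric_linear[OF Nt]]) (use Et in auto)
        also have "\<dots> = 0" using orth by (intro sum.neutral) auto
        finally show ?thesis using r by metis
      qed
      then show False using metric_pos[OF Nt N] by simp
    qed
  qed (use E in auto)
qed

text \<open>An orthogonal basis of the tangent space, obtained from a frame, gives the representing vector
  explicitly.\<close>

lemma riesz:
  assumes p: "p \<in> points M" and l: "linear_form_on (tangent_space M p) l"
  obtains v where "v \<in> tangent_space M p" "\<And>w. w \<in> tangent_space M p \<Longrightarrow> l w = g p v w"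
proof -
  obtain c where c: "c \<in> charts M" "p \<in> fst c" using chart_exists[OF M p] .
  obtain n E where "expanding_frame M g (fst c) n E" using orthogonal_frame[OF c(1)] .
  note E = expanding_frameD[OF this]
  note T = subspace_tangent_space[OF M p]
  have Et: "E i p \<in> tangent_space M p" if "i < n" for i using smooth_vector_fieldD(1)[OF E(1)[OF that] c(2)] .
  let ?v = "\<Sum>i<n. (l (E i p) / g p (E i p) (E i p)) *\<^sub>R E i p"
  have v: "?v \<in> tangent_space M p" using Et by (auto intro!: subspace_sum[OF T] subspace_scale[OF T])
  show ?thesis
  proof (rule that[OF v])
    fix w assume w: "w \<in> tangent_space M p"
    have "l w = l (\<Sum>i<n. (g p w (E i p) / g p (E i p) (E i p)) *\<^sub>R E i p)"
      using E(3)[OF c(2) w] by simp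
    also have "\<dots> = (\<Sum>i<n. (g p w (E i p) / g p (E i p) (E i p)) * l (E i p))"
      by (rule linear_form_sum[OF T l]) (use Et in auto)
    also have "\<dots> = (\<Sum>i<n. (l (E i p) / g p (E i p) (E i p)) * g p w (E i p))"
      by (intro sum.cong) auto
    also have "\<dots> = g p w ?v"
      by (rule linear_form_sum[OF T metric_linear[OF w], symmetric]) (use Et in auto)
    finally show "l w = g p ?v w" using metric_sym[OF v w] by simp
  qed
qed

lemma sharp_eqI:
  assumes "v \<in> tangent_space M p" "\<And>w. w \<in> tangent_space M p \<Longrightarrow> \<omega> p w = g p v w"
  shows "sharp M g \<omega> p = v"
  unfolding sharp_def
proof (rule the_equality)
  fix u assume u: "u \<in> tangent_space M p \<and> (\<forall>w\<in>tangent_space M p. \<omega> p w = g p u w)"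
  show "u = v" by (rule metric_eqI) (use u assms in auto)
qed (use assms in auto)

lemma grad_property:
  assumes "p \<in> points M"
  shows "grad M g f p \<in> tangent_space M p" "w \<in> tangent_space M p \<Longrightarrow> w f = g p (grad M g f p) w"
proof -
  have l: "linear_form_on (tangent_space M p) (differential f p)"
    by (simp add: linear_form_on_def differential_def)
  obtain v where v: "v \<in> tangent_space M p" "\<And>w. w \<in> tangent_space M p \<Longrightarrow> differential f p w = g p v w"
    using riesz[OF assms l] by metis
  have e: "grad M g f p = v" unfolding grad_def by (rule sharp_eqI) (use v in auto)
  then show "grad M g f p \<in> tangent_space M p" "w \<in> tangent_space M p \<Longrightarrow> w f = g p (grad M g f p) w"
    using v by (auto simp: differential_def)
qed

text \<open>Let \<open>A (X, Y, Z) = g (\<nabla>\<^sub>X Y - \<nabla>'\<^sub>X Y, Z)\<close>. Metric compatibility makes \<open>A\<close> skew in \<open>Y, Z\<close>, and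
  torsion-freeness makes it symmetric in \<open>X, Y\<close>; alternating the two symmetries leads back to \<open>(X, Y, Z)\<close>
  with the opposite sign. So \<open>A = 0\<close>, for all fields extending given vectors at \<open>p\<close>.\<close>

lemma levi_civita_unique:
  assumes n: "levi_civita M g n1" "levi_civita M g n2" and Y: "smooth_vector_field M U Y" "p \<in> U"
    and v: "v \<in> tangent_space M p"
  shows "n1 p v Y = n2 p v Y"
proof (rule metric_eqI)
  note a = levi_civitaD(1)[OF n(1)] levi_civitaD(1)[OF n(2)]
  show t: "n1 p v Y \<in> tangent_space M p" "n2 p v Y \<in> tangent_space M p"
    using connection_tangent[OF M _ Y v] a by auto
  fix z assume z: "z \<in> tangent_space M p"
  obtain V X where X: "smooth_vector_field M V X" "p \<in> V" "X p = v" using tangent_extension[OF M v] .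
  obtain W Z where Z: "smooth_vector_field M W Z" "p \<in> W" "Z p = z" using tangent_extension[OF M z] .
  let ?U = "U \<inter> V \<inter> W"
  have o: "openin (top_of_set (points M)) ?U"
    using smooth_vector_fieldD(3)[OF Y] smooth_vector_fieldD(3)[OF X(1,2)]
      smooth_vector_fieldD(3)[OF Z(1,2)] by blast
  have p: "p \<in> ?U" using X Y Z by auto
  have s: "smooth_vector_field M ?U X" "smooth_vector_field M ?U Y" "smooth_vector_field M ?U Z"
    using smooth_vector_field_subset[OF X(1) o] smooth_vector_field_subset[OF Y(1) o]
      smooth_vector_field_subset[OF Z(1) o] by auto
  define A where "A X Y Z = g p (n1 p (X p) Y) (Z p) - g p (n2 p (X p) Y) (Z p)" for X Y Z
  have tan: "n1 p (X p) Y \<in> tangent_space M p" "n2 p (X p) Y \<in> tangent_space M p" "X p \<in> tangent_space M p"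
    if "smooth_vector_field M ?U X" "smooth_vector_field M ?U Y" for X Y
    using connection_tangent[OF M _ that(2) p] smooth_vector_fieldD(1)[OF that(1) p] a by auto
  have skew: "A X Y Z = - A X Z Y"
    if f: "smooth_vector_field M ?U X" "smooth_vector_field M ?U Y" "smooth_vector_field M ?U Z" for X Y Z
  proof -
    have "g p (n1 p (X p) Y) (Z p) + g p (Y p) (n1 p (X p) Z)
        = g p (n2 p (X p) Y) (Z p) + g p (Y p) (n2 p (X p) Z)"
      using levi_civitaD(3)[OF n(1) f(2,3) p tan(3)[OF f(1,1)]] levi_civitaD(3)[OF n(2) f(2,3) p tan(3)[OF f(1,1)]]
      by simp
    moreover have "g p (Y p) (n1 p (X p) Z) = g p (n1 p (X p) Z) (Y p)" "g p (Y p) (n2 p (X p) Z) = g p (n2 p (X p) Z) (Y p)"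
      using tan[OF f(1,3)] tan(3)[OF f(2,2)] by (auto intro: metric_sym)
    ultimately show ?thesis by (simp add: A_def)
  qed
  have sym: "A X Y Z = A Y X Z"
    if f: "smooth_vector_field M ?U X" "smooth_vector_field M ?U Y" "smooth_vector_field M ?U Z" for X Y Z
  proof -
    have "n1 p (X p) Y - n1 p (Y p) X = n2 p (X p) Y - n2 p (Y p) X"
      using levi_civitaD(2)[OF n(1) f(1,2) p] levi_civitaD(2)[OF n(2) f(1,2) p] by simp
    then have "g p (n1 p (X p) Y - n1 p (Y p) X) (Z p) = g p (n2 p (X p) Y - n2 p (Y p) X) (Z p)" by simp
    then show ?thesis
      using metric_diff_left[OF tan(3)[OF f(3,3)] tan(1)[OF f(1,2)] tan(1)[OF f(2,1)]]
        metric_diff_left[OF tan(3)[OF f(3,3)] tan(2)[OF f(1,2)] tan(2)[OF f(2,1)]]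
      by (simp add: A_def)
  qed
  \<comment> \<open>the cycle \<open>XYZ, XZY, ZXY, ZYX, YZX, YXZ, XYZ\<close>, with a sign at every other step\<close>
  have "A X Y Z = - A X Y Z"
    using skew[OF s(1,2,3)] sym[OF s(1,3,2)] skew[OF s(3,1,2)] sym[OF s(3,2,1)] skew[OF s(2,3,1)] sym[OF s(2,1,3)]
    by simp
  then show "g p (n1 p v Y) z = g p (n2 p v Y) z" by (simp add: A_def X Z)
qed

text \<open>The definite descriptions of the two accelerations have the same defining predicate, since the
  connection occurs there only in covariant derivatives of smooth fields in the direction of the
  velocity.\<close>

lemma levi_civita_same_acceleration:
  assumes n: "levi_civita M g n1" "levi_civita M g n2"
    and \<gamma>: "smooth_curve M I \<gamma>" "open I" "t \<in> I"
  shows "acceleration M n1 \<gamma> t = acceleration M n2 \<gamma> t"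
proof -
  have eq: "(\<Sum>i<k. deriv (a i) t *\<^sub>R Y i (\<gamma> t) + a i t *\<^sub>R n1 (\<gamma> t) (velocity M \<gamma> t) (Y i))
     = (\<Sum>i<k. deriv (a i) t *\<^sub>R Y i (\<gamma> t) + a i t *\<^sub>R n2 (\<gamma> t) (velocity M \<gamma> t) (Y i))"
    if "\<forall>i<k. smooth_on (ball t e) (a i :: real \<Rightarrow> real) \<and> smooth_vector_field M U (Y i)"
      "e > 0" "\<forall>s\<in>ball t e. \<gamma> s \<in> U \<and> Q s" for k :: nat and a Y U e Q
  proof (rule sum.cong)
    fix i assume i: "i \<in> {..<k}"
    have "t \<in> ball t e" using that(2) by simp
    then have "\<gamma> t \<in> U" using that(3) by blast
    then have "n1 (\<gamma> t) (velocity M \<gamma> t) (Y i) = n2 (\<gamma> t) (velocity M \<gamma> t) (Y i)"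
      using levi_civita_unique[OF n _ _ velocity_tangent[OF M \<gamma>]] that(1) i by blast
    then show "deriv (a i) t *\<^sub>R Y i (\<gamma> t) + a i t *\<^sub>R n1 (\<gamma> t) (velocity M \<gamma> t) (Y i)
      = deriv (a i) t *\<^sub>R Y i (\<gamma> t) + a i t *\<^sub>R n2 (\<gamma> t) (velocity M \<gamma> t) (Y i)" by simp
  qed simp
  show ?thesis
    unfolding acceleration_def covariant_deriv_along_def
    by (intro arg_cong[where f=The] ext ex_cong1 conj_cong refl)
      (rule arg_cong[where f="(=) _"], erule (2) eq)
qed

end


section \<open>Submanifolds\<close>

lemma pushforward_id_apply:
  "pushforward Q id p v f = (if smooth_at Q p f then v f else 0)"
  by (simp add: pushforward_def)

lemma pushforward_id_lincomb:
  "pushforward Q id p (a *\<^sub>R u + b *\<^sub>R v) = a *\<^sub>R pushforward Q id p u + b *\<^sub>R pushforward Q id p v"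
  by (rule ext) (simp add: pushforward_id_apply)

lemma pushforward_id_add:
  "pushforward Q id p (u + v) = pushforward Q id p u + pushforward Q id p v"
  by (rule ext) (simp add: pushforward_id_apply)

lemma pushforward_id_diff:
  "pushforward Q id p (u - v) = pushforward Q id p u - pushforward Q id p v"
  by (rule ext) (simp add: pushforward_id_apply)

lemma pushforward_id_scale:
  "pushforward Q id p (a *\<^sub>R v) = a *\<^sub>R pushforward Q id p v"
  by (rule ext) (simp add: pushforward_id_apply)

lemma pushforward_id_zero: "pushforward Q id p 0 = 0"
  by (rule ext) (simp add: pushforward_id_apply)

lemma pushforward_id_sum:
  "pushforward Q id p (\<Sum>i\<in>I. v i) = (\<Sum>i\<in>I. pushforward Q id p (v i))"
  by (rule ext) (simp add: pushforward_id_apply)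

lemma submanifold_simps [simp]:
  "points (submanifold Q S C) = C" "model (submanifold Q S C) = S"
  by (simp_all add: submanifold_def)

text \<open>The chart of the submanifold cut out by a slice chart. The chart map is unchanged.\<close>

definition slice :: "'a set \<Rightarrow> 'a set \<times> ('a \<Rightarrow> 'e) \<Rightarrow> 'a set \<times> ('a \<Rightarrow> 'e)"
  where "slice C c = (fst c \<inter> C, snd c)"

lemma slice_simps [simp]: "fst (slice C c) = fst c \<inter> C" "snd (slice C c) = snd c"
  by (simp_all add: slice_def)

lemma atlas_submanifold: "atlas (submanifold Q S C) = slice C ` slice_charts Q S C"
  by (force simp: submanifold_def slice_def)

lemma slice_chartsD:
  assumes "c \<in> slice_charts Q S C"
  shows "c \<in> charts Q" "snd c ` (fst c \<inter> C) = snd c ` fst c \<inter> S"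
  using assms by (auto simp: slice_charts_def)

text \<open>The same witness serves on \<open>C\<close>, as the condition on it is only tested at fewer points.\<close>

lemma smooth_near_slice: "smooth_near c p f \<Longrightarrow> p \<in> C \<Longrightarrow> smooth_near (slice C c) p f"
  unfolding smooth_near_def by auto

lemma tangent_const:
  assumes M: "smooth_manifold M" and v: "v \<in> tangent_space M p"
  shows "v (\<lambda>x. k) = 0"
proof -
  obtain c where c: "c \<in> charts M" "p \<in> fst c" using chart_exists[OF M tangent_space_points[OF v]] .
  obtain w where w: "w \<in> model M" "v = chart_vec M c p w" using v tangent_space_chart[OF M c] by auto
  have "v (\<lambda>x. k) = frechet_derivative (\<lambda>x. k) (at (snd c p)) w"
    unfolding w(2) by (rule chart_vec_eval[OF M c w(1), of UNIV]) (auto intro: smooth_on_open_const)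
  then show ?thesis by simp
qed

locale submanifold_of =
  fixes Q :: "('a::{t2_space,second_countable_topology}, 'e::euclidean_space) manifold"
    and S :: "'e set" and C :: "'a set"
  assumes Q: "smooth_manifold Q" and embedded: "embedded_submanifold Q S C"
begin

lemma C_points: "C \<subseteq> points Q" and S_subspace: "subspace S" and S_model: "S \<subseteq> model Q"
  using embedded by (auto simp: embedded_submanifold_def)

lemma slice_chart_exists:
  assumes "p \<in> C"
  obtains c where "c \<in> slice_charts Q S C" "p \<in> fst c"
  using embedded assms unfolding embedded_submanifold_def by force

lemma openin_submanifold: "openin (top_of_set (points Q)) V \<Longrightarrow> openin (top_of_set C) (V \<inter> C)"
  using C_points by (auto simp: openin_open)

lemma openin_submanifold_extend:
  assumes "openin (top_of_set C) W"
  obtains V where "openin (top_of_set (points Q)) V" "V \<inter> C = W"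
proof -
  obtain T where T: "open T" "W = C \<inter> T" using assms by (auto simp: openin_open)
  show ?thesis
    by (rule that[of "points Q \<inter> T"]) (use T C_points in \<open>auto simp: openin_open\<close>)
qed

lemma slice_is_chart:
  assumes c: "c \<in> slice_charts Q S C"
  shows "is_chart (submanifold Q S C) (slice C c)"
proof -
  note ch = charts_is_chart[OF slice_chartsD(1)[OF c]]
  have o: "openin (top_of_set C) (fst c \<inter> C)" by (rule openin_submanifold[OF is_chartD(1)[OF ch]])
  obtain T where T: "open T" "snd c ` fst c = model Q \<inter> T" using is_chartD(2)[OF ch] by (auto simp: openin_open)
  have "snd c ` (fst c \<inter> C) = S \<inter> T" using slice_chartsD(2)[OF c] T(2) S_model by auto
  then have o2: "openin (top_of_set S) (snd c ` (fst c \<inter> C))" using T(1) by (auto simp: openin_open)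
  have inj: "inj_on (snd c) (fst c \<inter> C)" using is_chartD(4)[OF ch] by (rule inj_on_subset) auto
  have hom: "homeomorphism (fst c \<inter> C) (snd c ` (fst c \<inter> C)) (snd c) (inv_into (fst c) (snd c))"
    by (rule homeomorphism_of_subsets[OF is_chartD(3)[OF ch]]) auto
  have "inv_into (fst c \<inter> C) (snd c) y = inv_into (fst c) (snd c) y" if y: "y \<in> snd c ` (fst c \<inter> C)" for y
  proof -
    obtain x where "x \<in> fst c \<inter> C" "y = snd c x" using y by blast
    then show ?thesis using inv_into_f_f[OF inj] inv_into_f_f[OF is_chartD(4)[OF ch]] by simp
  qed
  then have "homeomorphism (fst c \<inter> C) (snd c ` (fst c \<inter> C)) (snd c) (inv_into (fst c \<inter> C) (snd c))"
    by (intro homeomorphism_cong[OF hom]) auto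
  then show ?thesis using o o2 by (simp add: is_chart_def slice_def split: prod.splits)
qed

lemma smooth_manifold_submanifold: "smooth_manifold (submanifold Q S C)"
  unfolding smooth_manifold_def
proof (intro conjI ballI)
  show "subspace (model (submanifold Q S C))" using S_subspace by simp
  show "(\<Union>c\<in>atlas (submanifold Q S C). fst c) = points (submanifold Q S C)"
    unfolding atlas_submanifold using slice_chart_exists by auto
  show "is_chart (submanifold Q S C) c" if "c \<in> atlas (submanifold Q S C)" for c
    using that slice_is_chart unfolding atlas_submanifold by blast
  fix c d assume "c \<in> atlas (submanifold Q S C)" "d \<in> atlas (submanifold Q S C)"
  then obtain c' d' where c: "c = slice C c'" "c' \<in> slice_charts Q S C" and d: "d = slice C d'" "d' \<in> slice_charts Q S C"
    unfolding atlas_submanifold by blast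
  have "smooth_near (slice C c') p (snd d') \<and> smooth_near (slice C d') p (snd c')"
    if "p \<in> fst c' \<inter> C" "p \<in> fst d' \<inter> C" for p
    using smooth_near_slice[OF charts_transition[OF Q slice_chartsD(1)[OF c(2)] slice_chartsD(1)[OF d(2)]]]
      smooth_near_slice[OF charts_transition[OF Q slice_chartsD(1)[OF d(2)] slice_chartsD(1)[OF c(2)]]] that
    by simp
  then show "compatible c d"
    using compatible_iff_smooth_near[OF slice_is_chart[OF c(2)] slice_is_chart[OF d(2)]] c(1) d(1) by auto
qed

abbreviation "M \<equiv> submanifold Q S C"

lemmas M = smooth_manifold_submanifold

lemma slice_in_charts: "c \<in> slice_charts Q S C \<Longrightarrow> slice C c \<in> charts M"
  by (rule atlas_charts[OF M]) (simp add: atlas_submanifold)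

lemma smooth_at_restrict:
  assumes "smooth_at Q p f" "p \<in> C"
  shows "smooth_at M p f"
proof -
  obtain c where c: "c \<in> slice_charts Q S C" "p \<in> fst c" using slice_chart_exists[OF assms(2)] .
  have "smooth_near c p f" using smooth_at_near[OF Q slice_chartsD(1)[OF c(1)] c(2)] assms(1) by simp
  then show ?thesis
    using smooth_at_near[OF M slice_in_charts[OF c(1)], of p f] smooth_near_slice[of c p f C] c(2) assms(2) by simp
qed

text \<open>The witness \<open>h\<close> of smoothness on \<open>C\<close> is defined on an open set of the Euclidean space, so \<open>h \<circ> \<phi>\<close>
  makes sense on the whole slice chart and extends \<open>f\<close>.\<close>

lemma smooth_at_extend:
  assumes f: "smooth_at M p f"
  obtains F V where "openin (top_of_set (points Q)) V" "p \<in> V" "\<forall>x\<in>V. smooth_at Q x F" "\<forall>x\<in>V \<inter> C. F x = f x"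
proof -
  have p: "p \<in> C" using smooth_at_point[OF M f] by simp
  obtain c where c: "c \<in> slice_charts Q S C" "p \<in> fst c" using slice_chart_exists[OF p] .
  note cQ = slice_chartsD(1)[OF c(1)]
  have ps: "p \<in> fst (slice C c)" using c p by simp
  obtain V h where h: "smooth_on_open V h" "snd c p \<in> V"
    "\<And>x. x \<in> fst c \<inter> C \<Longrightarrow> snd c x \<in> V \<Longrightarrow> h (snd c x) = f x"
    using smooth_at_witness[OF M slice_in_charts[OF c(1)] ps f] by (metis slice_simps)
  let ?V = "{x \<in> fst c. snd c x \<in> V}"
  let ?F = "\<lambda>x. h (snd c x)"
  have 1: "openin (top_of_set (points Q)) ?V"
    by (rule openin_chart_vimage[OF charts_is_chart[OF cQ] smooth_on_open_open[OF h(1)]])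
  have 2: "\<forall>x\<in>?V. smooth_at Q x ?F"
  proof
    fix x assume x: "x \<in> ?V"
    then have "smooth_near c x ?F" unfolding smooth_near_def using h(1) by blast
    then show "smooth_at Q x ?F" using smooth_at_near[OF Q cQ] x by simp
  qed
  have 3: "\<forall>x\<in>?V \<inter> C. ?F x = f x" using h(3) by simp
  have 4: "p \<in> ?V" using c h(2) by simp
  show ?thesis by (rule that[OF 1 4 2 3])
qed

text \<open>Both vectors differentiate the same witness \<open>h\<close> in the direction \<open>w\<close>.\<close>

lemma push_chart_vec:
  assumes c: "c \<in> slice_charts Q S C" "p \<in> fst c" "p \<in> C" and w: "w \<in> S"
  shows "pushforward Q id p (chart_vec M (slice C c) p w) = chart_vec Q c p w"
proof
  fix f
  show "pushforward Q id p (chart_vec M (slice C c) p w) f = chart_vec Q c p w f"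
  proof (cases "smooth_at Q p f")
    case True
    note cQ = slice_chartsD(1)[OF c(1)]
    obtain V h where h: "smooth_on_open V h" "snd c p \<in> V"
      "\<And>x. x \<in> fst c \<Longrightarrow> snd c x \<in> V \<Longrightarrow> h (snd c x) = f x"
      using smooth_at_witness[OF Q cQ c(2) True] by metis
    have "chart_vec M (slice C c) p w f = frechet_derivative h (at (snd (slice C c) p)) w"
      by (rule chart_vec_eval[OF M slice_in_charts[OF c(1)] _ _ h(1)]) (use c h w in auto)
    moreover have "chart_vec Q c p w f = frechet_derivative h (at (snd c p)) w"
      by (rule chart_vec_eval[OF Q cQ c(2) _ h]) (use w S_model in auto)
    ultimately show ?thesis using True by (simp add: pushforward_id_apply)
  qed (simp add: pushforward_id_apply chart_vec_outside)
qed

lemma sub_tangent_chart: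
  assumes c: "c \<in> slice_charts Q S C" "p \<in> fst c" "p \<in> C"
  shows "tangent_space M p = chart_vec M (slice C c) p ` S"
  using tangent_space_chart[OF M slice_in_charts[OF c(1)], of p] c by simp

lemma push_tangent:
  assumes v: "v \<in> tangent_space M p"
  shows "pushforward Q id p v \<in> tangent_space Q p"
proof -
  have p: "p \<in> C" using tangent_space_points[OF v] by simp
  obtain c where c: "c \<in> slice_charts Q S C" "p \<in> fst c" using slice_chart_exists[OF p] .
  obtain w where w: "w \<in> S" "v = chart_vec M (slice C c) p w" using v sub_tangent_chart[OF c p] by blast
  then show ?thesis
    using push_chart_vec[OF c p w(1)] tangent_space_chart[OF Q slice_chartsD(1)[OF c(1)] c(2)] S_model by auto
qed

lemma push_inj:
  assumes u: "u \<in> tangent_space M p" and v: "v \<in> tangent_space M p" and eq: "pushforward Q id p u = pushforward Q id p v"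
  shows "u = v"
proof -
  have p: "p \<in> C" using tangent_space_points[OF v] by simp
  obtain c where c: "c \<in> slice_charts Q S C" "p \<in> fst c" using slice_chart_exists[OF p] .
  obtain w where w: "w \<in> S" "v = chart_vec M (slice C c) p w" using v sub_tangent_chart[OF c p] by blast
  obtain z where z: "z \<in> S" "u = chart_vec M (slice C c) p z" using u sub_tangent_chart[OF c p] by blast
  have "z = w"
    by (rule chart_vec_inj[OF Q slice_chartsD(1)[OF c(1)] c(2)])
      (use eq w z push_chart_vec[OF c p] S_model in auto)
  then show ?thesis using w z by simp
qed

lemma push_apply: "smooth_at Q p f \<Longrightarrow> pushforward Q id p v f = v f"
  by (simp add: pushforward_id_apply)

text \<open>The components of \<open>Y\<close> with respect to an orthonormal basis of \<open>S\<close> are smooth functions on \<open>C\<close>; extend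
  them to \<open>Q\<close> and use them as coefficients of the ambient coordinate fields of the slice chart.\<close>

lemma field_extend:
  assumes Y: "smooth_vector_field M U Y" "p \<in> U"
  obtains V Z where "smooth_vector_field Q V Z" "p \<in> V" "V \<inter> C \<subseteq> U"
    "\<forall>x\<in>V \<inter> C. Z x = pushforward Q id x (Y x)"
proof -
  have p: "p \<in> C" using smooth_vector_fieldD(4)[OF Y] by simp
  have oU: "openin (top_of_set C) U" using smooth_vector_fieldD(3)[OF Y] by simp
  obtain W where W: "openin (top_of_set (points Q)) W" "W \<inter> C = U" using openin_submanifold_extend[OF oU] .
  obtain c where c: "c \<in> slice_charts Q S C" "p \<in> fst c" using slice_chart_exists[OF p] .
  note cQ = slice_chartsD(1)[OF c(1)]
  have ps: "p \<in> fst (slice C c)" using c p by simp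
  obtain B where B: "B \<subseteq> S" "pairwise orthogonal B" "\<And>x. x \<in> B \<Longrightarrow> norm x = 1" "independent B" "span B = S"
    using orthonormal_basis_subspace[OF S_subspace] by metis
  have finB: "finite B" using B(4) independent_imp_finite by blast
  have "\<exists>F V. openin (top_of_set (points Q)) V \<and> p \<in> V \<and> (\<forall>x\<in>V. smooth_at Q x F) \<and>
      (\<forall>x\<in>V \<inter> C. F x = Y x (\<lambda>y. snd c y \<bullet> b))" for b
  proof -
    have "smooth_at M p (\<lambda>x. Y x (\<lambda>y. snd c y \<bullet> b))"
      using smooth_vector_fieldD(2)[OF Y] smooth_at_component[OF M slice_in_charts[OF c(1)] ps] by simp
    from smooth_at_extend[OF this] show ?thesis by metis
  qed
  then obtain F V where F: "\<And>b. openin (top_of_set (points Q)) (V b)" "\<And>b. p \<in> V b"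
    "\<And>b x. x \<in> V b \<Longrightarrow> smooth_at Q x (F b)" "\<And>b x. x \<in> V b \<inter> C \<Longrightarrow> F b x = Y x (\<lambda>y. snd c y \<bullet> b)"
    by metis
  define V0 where "V0 = (fst c \<inter> W) \<inter> (points Q \<inter> (\<Inter>b\<in>B. V b))"
  define Z where "Z x = (\<Sum>b\<in>B. F b x *\<^sub>R chart_vec Q c x b)" for x
  have "openin (top_of_set (points Q)) (points Q \<inter> (\<Inter>b\<in>B. V b))"
    using finB F(1) by (induction B rule: finite_induct) (auto simp: Int_left_commute[of "points Q"] intro!: openin_Int)
  then have oV: "openin (top_of_set (points Q)) V0"
    unfolding V0_def using is_chartD(1)[OF charts_is_chart[OF cQ]] W(1) by blast
  have "smooth_vector_field Q V0 Z"
    unfolding Z_def[abs_def]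
  proof (intro smooth_vector_field_sum[OF Q oV] smooth_vector_field_scale[OF Q])
    fix b assume b: "b \<in> B"
    show "smooth_vector_field Q V0 (\<lambda>x. chart_vec Q c x b)"
      by (rule smooth_vector_field_subset[OF chart_vec_smooth_field[OF Q cQ] oV])
        (use b B(1) S_model in \<open>auto simp: V0_def\<close>)
    show "smooth_at Q x (F b)" if "x \<in> V0" for x
      using that b F(3) by (auto simp: V0_def)
  qed
  moreover have "p \<in> V0" using c(2) p W(2) Y(2) F(2) C_points by (auto simp: V0_def)
  moreover have "V0 \<inter> C \<subseteq> U" using W(2) by (auto simp: V0_def)
  moreover have "\<forall>x\<in>V0 \<inter> C. Z x = pushforward Q id x (Y x)"
  proof
    fix x assume x: "x \<in> V0 \<inter> C"
    then have xc: "x \<in> fst c" "x \<in> C" "x \<in> U" using W(2) by (auto simp: V0_def)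
    then have xs: "x \<in> fst (slice C c)" by simp
    have Bm: "B \<subseteq> model M" "span B = model M" using B by auto
    have "Y x = (\<Sum>b\<in>B. Y x (\<lambda>y. snd (slice C c) y \<bullet> b) *\<^sub>R chart_vec M (slice C c) x b)"
      by (rule tangent_orthonormal_expansion[OF M slice_in_charts[OF c(1)] xs
          smooth_vector_fieldD(1)[OF Y(1) xc(3)] finB Bm B(2,3)])
    then have "pushforward Q id x (Y x) =
        pushforward Q id x (\<Sum>b\<in>B. Y x (\<lambda>y. snd c y \<bullet> b) *\<^sub>R chart_vec M (slice C c) x b)"
      by simp
    also have "\<dots> = (\<Sum>b\<in>B. Y x (\<lambda>y. snd c y \<bullet> b) *\<^sub>R chart_vec Q c x b)"
      unfolding pushforward_id_sum pushforward_id_scale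
      by (intro sum.cong refl) (use push_chart_vec[OF c(1) xc(1,2)] B(1) in auto)
    also have "\<dots> = Z x"
      unfolding Z_def by (intro sum.cong refl) (use F(4) x in \<open>auto simp: V0_def\<close>)
    finally show "Z x = pushforward Q id x (Y x)" by simp
  qed
  ultimately show ?thesis by (rule that)
qed

text \<open>The fields \<open>X'\<close>, \<open>Y'\<close> on \<open>Q\<close> extend \<open>X\<close>, \<open>Y\<close>. Along \<open>C\<close>, the function \<open>Y' f\<close> is \<open>Y h\<close>, and \<open>X'\<close> at \<open>p\<close>
  differentiates along \<open>C\<close>.\<close>

lemma related_second_derivative:
  assumes X: "smooth_vector_field M U X" "smooth_vector_field Q V X'" "\<forall>x\<in>V \<inter> C. X' x = pushforward Q id x (X x)"
    and Y: "smooth_vector_field M U Y" "smooth_vector_field Q V Y'" "\<forall>x\<in>V \<inter> C. Y' x = pushforward Q id x (Y x)"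
    and p: "p \<in> V" "p \<in> U"
    and f: "smooth_at Q p f" and W: "openin (top_of_set (points Q)) W" "p \<in> W" "\<forall>x\<in>W \<inter> C. f x = h x"
  shows "X' p (\<lambda>x. Y' x f) = X p (\<lambda>x. Y x h)"
proof -
  have pC: "p \<in> C" using smooth_vector_fieldD(4)[OF X(1) p(2)] by simp
  obtain N where N: "openin (top_of_set (points Q)) N" "p \<in> N" "\<And>x. x \<in> N \<Longrightarrow> smooth_at Q x f"
    using smooth_at_neighbourhood[OF Q f] by metis
  have oV: "openin (top_of_set (points Q)) V" using smooth_vector_fieldD(3)[OF X(2) p(1)] .
  have oU: "openin (top_of_set C) U" using smooth_vector_fieldD(3)[OF X(1) p(2)] by simp
  have oW: "openin (top_of_set C) (W \<inter> C)" by (rule openin_submanifold[OF W(1)])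
  have oN: "openin (top_of_set C) ((N \<inter> V \<inter> W) \<inter> C)"
    by (rule openin_submanifold) (use N(1) oV W(1) in blast)
  have o: "openin (top_of_set C) (U \<inter> ((N \<inter> V \<inter> W) \<inter> C))" using oU oN by blast
  have "X' p (\<lambda>x. Y' x f) = X p (\<lambda>x. Y' x f)"
    using X(3) p(1) pC push_apply[OF smooth_vector_fieldD(2)[OF Y(2) p(1) f]] by simp
  also have "\<dots> = X p (\<lambda>x. Y x h)"
  proof (rule tangent_local[OF M smooth_vector_fieldD(1)[OF X(1) p(2)]])
    show "openin (top_of_set (points M)) (U \<inter> ((N \<inter> V \<inter> W) \<inter> C))" using o by simp
    show "p \<in> U \<inter> ((N \<inter> V \<inter> W) \<inter> C)" using p pC N(2) W(2) by simp
    fix x assume x: "x \<in> U \<inter> ((N \<inter> V \<inter> W) \<inter> C)"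
    have "Y' x f = Y x f" using Y(3) x push_apply[OF N(3)] by simp
    also have "\<dots> = Y x h"
      by (rule tangent_local[OF M smooth_vector_fieldD(1)[OF Y(1)], of x "W \<inter> C"]) (use x oW W(3) in auto)
    finally show "Y' x f = Y x h" .
  qed
  finally show ?thesis .
qed

text \<open>Brackets of related fields are related. The ambient bracket at \<open>p\<close> kills every function that
  vanishes on \<open>C\<close>, in particular the coordinate functions belonging to directions orthogonal to \<open>S\<close>;
  hence its components lie in \<open>S\<close> and it is tangent to \<open>C\<close>. Agreement with the intrinsic bracket is
  checked on extensions of functions.\<close>

lemma lie_bracket_restrict:
  assumes X: "smooth_vector_field M U X" "smooth_vector_field Q V X'" "\<forall>x\<in>V \<inter> C. X' x = pushforward Q id x (X x)"
    and Y: "smooth_vector_field M U Y" "smooth_vector_field Q V Y'" "\<forall>x\<in>V \<inter> C. Y' x = pushforward Q id x (Y x)"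
    and p: "p \<in> V" "p \<in> U" and B: "lie_bracket Q X' Y' p \<in> tangent_space Q p"
  shows "lie_bracket M X Y p \<in> tangent_space M p"
    "pushforward Q id p (lie_bracket M X Y p) = lie_bracket Q X' Y' p"
proof -
  let ?B = "lie_bracket Q X' Y' p"
  have pC: "p \<in> C" using smooth_vector_fieldD(4)[OF X(1) p(2)] by simp
  obtain c where c: "c \<in> slice_charts Q S C" "p \<in> fst c" using slice_chart_exists[OF pC] .
  note cQ = slice_chartsD(1)[OF c(1)]
  have key: "?B f = X p (\<lambda>x. Y x h) - Y p (\<lambda>x. X x h)"
    if f: "smooth_at Q p f" and W: "openin (top_of_set (points Q)) W" "p \<in> W" "\<forall>x\<in>W \<inter> C. f x = h x" for f h W
    using f related_second_derivative[OF X Y p f W] related_second_derivative[OF Y X p f W]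
    by (simp add: lie_bracket_def)
  obtain \<beta> where \<beta>: "\<beta> \<in> model Q" "?B = chart_vec Q c p \<beta>" "\<And>b. ?B (\<lambda>x. snd c x \<bullet> b) = \<beta> \<bullet> b"
    using tangent_components[OF Q cQ c(2) B] by metis
  \<comment> \<open>test against vectors orthogonal to \<open>S\<close>, whose coordinate functions vanish on \<open>C\<close>\<close>
  have "\<beta> \<in> S"
  proof (rule subspace_memI[OF S_subspace])
    fix w assume w: "\<And>y. y \<in> S \<Longrightarrow> y \<bullet> w = 0"
    have zero: "Z p (\<lambda>x. Z' x (\<lambda>_. 0)) = 0" if Z: "smooth_vector_field M U Z" "smooth_vector_field M U Z'" for Z Z'
    proof -
      have "Z p (\<lambda>x. Z' x (\<lambda>_. 0)) = Z p (\<lambda>_. 0)"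
        by (rule tangent_local[OF M smooth_vector_fieldD(1)[OF Z(1) p(2)] smooth_vector_fieldD(3)[OF Z(1) p(2)] p(2)])
          (rule tangent_const[OF M smooth_vector_fieldD(1)[OF Z(2)]])
      then show ?thesis using tangent_const[OF M smooth_vector_fieldD(1)[OF Z(1) p(2)]] by simp
    qed
    have "?B (\<lambda>x. snd c x \<bullet> w) = X p (\<lambda>x. Y x (\<lambda>_. 0)) - Y p (\<lambda>x. X x (\<lambda>_. 0))"
    proof (rule key[OF smooth_at_component[OF Q cQ c(2)] is_chartD(1)[OF charts_is_chart[OF cQ]] c(2)])
      show "\<forall>x\<in>fst c \<inter> C. snd c x \<bullet> w = 0"
        using slice_chartsD(2)[OF c(1)] w by blast
    qed
    then show "\<beta> \<bullet> w = 0" using \<beta>(3) zero[OF X(1) Y(1)] zero[OF Y(1) X(1)] by simp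
  qed
  define b where "b = chart_vec M (slice C c) p \<beta>"
  have bT: "b \<in> tangent_space M p" unfolding b_def using sub_tangent_chart[OF c pC] \<open>\<beta> \<in> S\<close> by blast
  have pb: "pushforward Q id p b = ?B" unfolding b_def using push_chart_vec[OF c pC \<open>\<beta> \<in> S\<close>] \<beta>(2) by simp
  have "lie_bracket M X Y p = b"
  proof
    fix h
    show "lie_bracket M X Y p h = b h"
    proof (cases "smooth_at M p h")
      case True
      obtain f W where f: "openin (top_of_set (points Q)) W" "p \<in> W" "\<forall>x\<in>W. smooth_at Q x f" "\<forall>x\<in>W \<inter> C. f x = h x"
        using smooth_at_extend[OF True] .
      have fp: "smooth_at Q p f" using f(2,3) by blast
      have "lie_bracket M X Y p h = ?B f" using True key[OF fp f(1,2,4)] by (simp add: lie_bracket_def)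
      also have "\<dots> = b f" using push_apply[OF fp] pb by metis
      also have "\<dots> = b h"
        by (rule tangent_local[OF M bT, of "W \<inter> C"]) (use f pC openin_submanifold in auto)
      finally show ?thesis .
    next
      case False
      then show ?thesis using tangent_outside[OF bT] by (simp add: lie_bracket_def)
    qed
  qed
  then show "lie_bracket M X Y p \<in> tangent_space M p"
    "pushforward Q id p (lie_bracket M X Y p) = lie_bracket Q X' Y' p"
    using bT pb by auto
qed

end


section \<open>Orthogonal virtual holonomic constraints\<close>

locale orthogonal_vhc =
  fixes Q :: "('a::{t2_space,second_countable_topology}, 'e::euclidean_space) manifold"
    and g :: "'a metric" and nabla :: "'a connection" and P :: "'a \<Rightarrow> real"
    and m :: nat and F :: "nat \<Rightarrow> 'a \<Rightarrow> 'a tvec \<Rightarrow> real"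
    and S :: "'e set" and C :: "'a set"
  assumes system: "lagrangian_control_system Q g nabla P m F"
    and vhc: "regular_VHC Q g m F S C"
    and orthogonal: "\<forall>q\<in>C. \<forall>u\<in>sub_tangent_space Q S C q. \<forall>w\<in>acceleration_distribution Q g m F q. g q u w = 0"

sublocale orthogonal_vhc \<subseteq> submanifold_of Q S C
  using system vhc by unfold_locales (auto simp: lagrangian_control_system_def regular_VHC_def)

context orthogonal_vhc
begin

abbreviation "D \<equiv> acceleration_distribution Q g m F"
abbreviation "\<sigma> \<equiv> vhc_projection Q g m F S C"
abbreviation "g\<^sub>C \<equiv> pullback_metric Q id g"
abbreviation "nabla\<^sub>C \<equiv> induced_connection Q g nabla m F S C"
abbreviation "push \<equiv> pushforward Q id"

lemma g: "riemannian_metric Q g" and nabla: "levi_civita Q g nabla"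
  and P_smooth: "q \<in> points Q \<Longrightarrow> smooth_at Q q P"
  using system by (auto simp: lagrangian_control_system_def)

lemma pullback_apply: "g\<^sub>C p u v = g p (push p u) (push p v)"
  by (simp add: pullback_metric_def)

lemma decomposition:
  assumes "q \<in> C"
  shows "tangent_space Q q = {a + b | a b. a \<in> push q ` tangent_space M q \<and> b \<in> D q}"
    "push q ` tangent_space M q \<inter> D q = {0}"
  using vhc assms unfolding regular_VHC_def is_direct_sum_def sub_tangent_space_def by blast+

lemma D_orthogonal: "q \<in> C \<Longrightarrow> u \<in> tangent_space M q \<Longrightarrow> w \<in> D q \<Longrightarrow> g q (push q u) w = 0"
  using orthogonal unfolding sub_tangent_space_def by blast

lemma D_subspace: "subspace (D q)"
  by (simp add: acceleration_distribution_def)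

lemma proj_unique:
  assumes q: "q \<in> C" and v: "v \<in> tangent_space M q" and d: "w - push q v \<in> D q"
  shows "\<sigma> q w = v"
  unfolding vhc_projection_def
proof (rule the_equality)
  fix u assume u: "u \<in> tangent_space M q \<and> w - push q u \<in> D q"
  have sub: "subspace (tangent_space M q)" using subspace_tangent_space[OF M] q by simp
  have t: "u - v \<in> tangent_space M q" using u v sub by (auto intro: subspace_diff)
  have "(w - push q v) - (w - push q u) \<in> D q" by (rule subspace_diff[OF D_subspace d conjunct2[OF u]])
  then have "push q (u - v) \<in> D q" by (simp add: pushforward_id_diff)
  then have "push q (u - v) = 0" using decomposition(2)[OF q] t by blast
  then show "u = v" using push_inj[OF conjunct1[OF u] v] by (simp add: pushforward_id_diff)
qed (use v d in auto)

lemma proj_mem: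
  assumes q: "q \<in> C" and w: "w \<in> tangent_space Q q"
  shows "\<sigma> q w \<in> tangent_space M q" "w - push q (\<sigma> q w) \<in> D q"
proof -
  obtain v b where v: "v \<in> tangent_space M q" "b \<in> D q" "w = push q v + b"
    using w unfolding decomposition(1)[OF q] by blast
  have "\<sigma> q w = v" by (rule proj_unique[OF q v(1)]) (use v in simp)
  then show "\<sigma> q w \<in> tangent_space M q" "w - push q (\<sigma> q w) \<in> D q" using v by auto
qed

lemma proj_push:
  assumes "v \<in> tangent_space M q"
  shows "\<sigma> q (push q v) = v"
proof -
  have "q \<in> C" using tangent_space_points[OF assms] by simp
  then show ?thesis using assms subspace_0[OF D_subspace] by (intro proj_unique) auto
qed

lemma proj_lincomb:
  assumes q: "q \<in> C" and w: "w \<in> tangent_space Q q" "z \<in> tangent_space Q q"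
  shows "\<sigma> q (a *\<^sub>R w + b *\<^sub>R z) = a *\<^sub>R \<sigma> q w + b *\<^sub>R \<sigma> q z"
proof (rule proj_unique[OF q])
  have sub: "subspace (tangent_space M q)" using subspace_tangent_space[OF M] q by simp
  show "a *\<^sub>R \<sigma> q w + b *\<^sub>R \<sigma> q z \<in> tangent_space M q"
    by (intro subspace_add[OF sub] subspace_scale[OF sub] proj_mem q w)
  have "a *\<^sub>R (w - push q (\<sigma> q w)) + b *\<^sub>R (z - push q (\<sigma> q z)) \<in> D q"
    by (intro subspace_add[OF D_subspace] subspace_scale[OF D_subspace] proj_mem q w)
  then show "a *\<^sub>R w + b *\<^sub>R z - push q (a *\<^sub>R \<sigma> q w + b *\<^sub>R \<sigma> q z) \<in> D q"
    by (simp add: pushforward_id_lincomb algebra_simps)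
qed

text \<open>The difference between \<open>w\<close> and its projection lies in the acceleration distribution, which is
  orthogonal to the tangent space of \<open>C\<close>.\<close>

lemma proj_metric:
  assumes q: "q \<in> C" and w: "w \<in> tangent_space Q q" and u: "u \<in> tangent_space M q"
  shows "g\<^sub>C q (\<sigma> q w) u = g q w (push q u)"
proof -
  note pu = push_tangent[OF u] and ps = push_tangent[OF proj_mem(1)[OF q w]]
  have "g q (push q u) (w - push q (\<sigma> q w)) = 0" using D_orthogonal[OF q u proj_mem(2)[OF q w]] .
  then have "g q (push q u) w = g q (push q u) (push q (\<sigma> q w))"
    using metric_diff_right[OF Q g pu w ps] by simp
  then show ?thesis using metric_sym[OF Q g pu w] metric_sym[OF Q g pu ps] by (simp add: pullback_apply)
qed

lemma pullback_smooth:
  assumes X: "smooth_vector_field M U X" and Y: "smooth_vector_field M U Y" and p: "p \<in> U"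
  shows "smooth_at M p (\<lambda>x. g\<^sub>C x (X x) (Y x))"
proof -
  have pC: "p \<in> C" using smooth_vector_fieldD(4)[OF X p] by simp
  obtain V X' where X': "smooth_vector_field Q V X'" "p \<in> V" "V \<inter> C \<subseteq> U" "\<forall>x\<in>V \<inter> C. X' x = push x (X x)"
    using field_extend[OF X p] .
  obtain W Y' where Y': "smooth_vector_field Q W Y'" "p \<in> W" "W \<inter> C \<subseteq> U" "\<forall>x\<in>W \<inter> C. Y' x = push x (Y x)"
    using field_extend[OF Y p] .
  have o: "openin (top_of_set (points Q)) (V \<inter> W)"
    using smooth_vector_fieldD(3)[OF X'(1,2)] smooth_vector_fieldD(3)[OF Y'(1,2)] by blast
  have "smooth_at Q p (\<lambda>x. g x (X' x) (Y' x))"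
    by (rule metric_smooth[OF Q g, of "V \<inter> W"])
      (use smooth_vector_field_subset[OF X'(1) o] smooth_vector_field_subset[OF Y'(1) o] X' Y' in auto)
  then have s: "smooth_at M p (\<lambda>x. g x (X' x) (Y' x))" using pC by (rule smooth_at_restrict)
  show ?thesis
    by (rule smooth_at_local[OF M s, of "(V \<inter> W) \<inter> C"])
      (use openin_submanifold[OF o] X' Y' pC in \<open>auto simp: pullback_apply\<close>)
qed

lemma pullback_riemannian: "riemannian_metric M g\<^sub>C"
  unfolding riemannian_metric_def
proof (intro conjI ballI allI impI)
  fix p u assume p: "p \<in> points M" and u: "u \<in> tangent_space M p"
  show "linear_form_on (tangent_space M p) (g\<^sub>C p u)"
    using metric_linear[OF Q g push_tangent[OF u]] push_tangent
    by (simp add: linear_form_on_def pullback_apply pushforward_id_add pushforward_id_scale)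
  show "g\<^sub>C p u v = g\<^sub>C p v u" if "v \<in> tangent_space M p" for v
    unfolding pullback_apply using metric_sym[OF Q g push_tangent[OF u] push_tangent[OF that]] .
  show "g\<^sub>C p u u > 0" if "u \<noteq> 0"
  proof -
    have "0 \<in> tangent_space M p" using subspace_0[OF subspace_tangent_space[OF M p]] .
    then have "push p u \<noteq> 0" using push_inj[OF u, of 0] that by (auto simp: pushforward_id_zero)
    then show ?thesis unfolding pullback_apply by (rule metric_pos[OF Q g push_tangent[OF u]])
  qed
qed (use pullback_smooth in blast)

lemma nabla_tangent:
  "smooth_vector_field Q V Z \<Longrightarrow> p \<in> V \<Longrightarrow> u \<in> tangent_space Q p \<Longrightarrow> nabla p u Z \<in> tangent_space Q p"
  by (rule connection_tangent[OF Q levi_civitaD(1)[OF nabla]])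

text \<open>By metric compatibility, \<open>g (\<nabla>\<^sub>v Z, E) = v (g (Z, E)) - g (Z, \<nabla>\<^sub>v E)\<close>. For \<open>v\<close> tangent to \<open>C\<close> the
  right-hand side involves only the values of \<open>Z\<close> on \<open>C\<close>, and \<open>E\<close> may take any value at \<open>p\<close>.\<close>

lemma nabla_extension_independent:
  assumes Z: "smooth_vector_field Q V Z" "p \<in> V" and Z': "smooth_vector_field Q V' Z'" "p \<in> V'"
    and eq: "\<And>x. x \<in> V \<inter> V' \<inter> C \<Longrightarrow> Z x = Z' x" and v: "v \<in> tangent_space M p"
  shows "nabla p (push p v) Z = nabla p (push p v) Z'"
proof (rule metric_eqI[OF Q g])
  have p: "p \<in> C" using tangent_space_points[OF v] by simp
  note pv = push_tangent[OF v]
  show t: "nabla p (push p v) Z \<in> tangent_space Q p" "nabla p (push p v) Z' \<in> tangent_space Q p"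
    using nabla_tangent[OF Z pv] nabla_tangent[OF Z' pv] by auto
  fix e assume e: "e \<in> tangent_space Q p"
  obtain W E where E: "smooth_vector_field Q W E" "p \<in> W" "E p = e" using tangent_extension[OF Q e] .
  let ?U = "V \<inter> V' \<inter> W"
  have o: "openin (top_of_set (points Q)) ?U"
    using smooth_vector_fieldD(3)[OF Z] smooth_vector_fieldD(3)[OF Z'] smooth_vector_fieldD(3)[OF E(1,2)] by blast
  have pU: "p \<in> ?U" using Z Z' E by auto
  have s: "smooth_vector_field Q ?U Z" "smooth_vector_field Q ?U Z'" "smooth_vector_field Q ?U E"
    using smooth_vector_field_subset[OF Z(1) o] smooth_vector_field_subset[OF Z'(1) o]
      smooth_vector_field_subset[OF E(1) o] by auto
  have "push p v (\<lambda>x. g x (Z x) (E x)) = push p v (\<lambda>x. g x (Z' x) (E x))"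
  proof -
    have "v (\<lambda>x. g x (Z x) (E x)) = v (\<lambda>x. g x (Z' x) (E x))"
      by (rule tangent_local[OF M v, of "?U \<inter> C"]) (use openin_submanifold[OF o] pU p eq in auto)
    then show ?thesis
      using push_apply[OF metric_smooth[OF Q g s(1,3) pU]] push_apply[OF metric_smooth[OF Q g s(2,3) pU]] by simp
  qed
  moreover have "Z p = Z' p" using eq p pU by blast
  ultimately show "g p (nabla p (push p v) Z) e = g p (nabla p (push p v) Z') e"
    using levi_civitaD(3)[OF nabla s(1,3) pU pv] levi_civitaD(3)[OF nabla s(2,3) pU pv] E(3) by simp
qed

lemma induced_eq:
  assumes Z: "smooth_vector_field Q V Z" "p \<in> V" "\<forall>x\<in>V \<inter> C. Z x = push x (Y x)"
    and v: "v \<in> tangent_space M p"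
  shows "nabla\<^sub>C p v Y = \<sigma> p (nabla p (push p v) Z)"
  unfolding induced_connection_def
proof (rule the_equality)
  show "\<exists>V' Z'. smooth_vector_field Q V' Z' \<and> p \<in> V' \<and> (\<forall>x\<in>V' \<inter> C. Z' x = push x (Y x)) \<and>
      \<sigma> p (nabla p (push p v) Z) = \<sigma> p (nabla p (push p v) Z')"
    using Z by blast
  fix w assume "\<exists>V' Z'. smooth_vector_field Q V' Z' \<and> p \<in> V' \<and> (\<forall>x\<in>V' \<inter> C. Z' x = push x (Y x)) \<and>
      w = \<sigma> p (nabla p (push p v) Z')"
  then obtain V' Z' where Z': "smooth_vector_field Q V' Z'" "p \<in> V'" "\<forall>x\<in>V' \<inter> C. Z' x = push x (Y x)"
    and w: "w = \<sigma> p (nabla p (push p v) Z')" by blast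
  have "nabla p (push p v) Z' = nabla p (push p v) Z"
    by (rule nabla_extension_independent[OF Z'(1,2) Z(1,2) _ v]) (use Z(3) Z'(3) in auto)
  then show "w = \<sigma> p (nabla p (push p v) Z)" using w by simp
qed

lemma common_extension:
  assumes X: "smooth_vector_field M U X" and Y: "smooth_vector_field M U Y" and p: "p \<in> U"
  obtains V X' Y' where "smooth_vector_field Q V X'" "smooth_vector_field Q V Y'" "p \<in> V" "V \<inter> C \<subseteq> U"
    "\<forall>x\<in>V \<inter> C. X' x = push x (X x)" "\<forall>x\<in>V \<inter> C. Y' x = push x (Y x)"
proof -
  obtain V X' where X': "smooth_vector_field Q V X'" "p \<in> V" "V \<inter> C \<subseteq> U" "\<forall>x\<in>V \<inter> C. X' x = push x (X x)"
    using field_extend[OF X p] .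
  obtain W Y' where Y': "smooth_vector_field Q W Y'" "p \<in> W" "W \<inter> C \<subseteq> U" "\<forall>x\<in>W \<inter> C. Y' x = push x (Y x)"
    using field_extend[OF Y p] .
  have o: "openin (top_of_set (points Q)) (V \<inter> W)"
    using smooth_vector_fieldD(3)[OF X'(1,2)] smooth_vector_fieldD(3)[OF Y'(1,2)] by blast
  have s: "smooth_vector_field Q (V \<inter> W) X'" "smooth_vector_field Q (V \<inter> W) Y'"
    using smooth_vector_field_subset[OF X'(1) o] smooth_vector_field_subset[OF Y'(1) o] by auto
  show ?thesis by (rule that[OF s]) (use X' Y' in auto)
qed

text \<open>In a \<open>g\<^sub>C\<close>-orthogonal frame \<open>E\<close> of \<open>C\<close> the coefficients of \<open>\<sigma> N\<close> are \<open>g (N, E\<^sub>i) / g\<^sub>C (E\<^sub>i, E\<^sub>i)\<close>,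
  which are smooth since each \<open>E\<^sub>i\<close> extends locally to a smooth field on \<open>Q\<close>.\<close>

lemma proj_smooth_field:
  assumes N: "smooth_vector_field Q V N"
  shows "smooth_vector_field M (V \<inter> C) (\<lambda>x. \<sigma> x (N x))"
  unfolding smooth_vector_field_def
proof (intro conjI ballI allI impI)
  have oV: "openin (top_of_set (points Q)) V" using N by (simp add: smooth_vector_field_def)
  show "openin (top_of_set (points M)) (V \<inter> C)" using openin_submanifold[OF oV] by simp
  fix p assume p: "p \<in> V \<inter> C"
  show "\<sigma> p (N p) \<in> tangent_space M p" using p smooth_vector_fieldD(1)[OF N] by (intro proj_mem) auto
  fix f assume f: "smooth_at M p f"
  have pM: "p \<in> points M" using p by simp
  obtain c where c: "c \<in> charts M" "p \<in> fst c" using chart_exists[OF M pM] .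
  obtain n E where "expanding_frame M g\<^sub>C (fst c) n E" using orthogonal_frame[OF M pullback_riemannian c(1)] .
  note E = expanding_frameD[OF this]
  have oc: "openin (top_of_set C) (fst c)" using is_chartD(1)[OF charts_is_chart[OF c(1)]] by simp
  have o: "openin (top_of_set C) (fst c \<inter> (V \<inter> C))" using oc openin_submanifold[OF oV] by blast
  have "smooth_at M p (\<lambda>x. \<Sum>i<n. (g x (N x) (push x (E i x)) / g\<^sub>C x (E i x) (E i x)) * E i x f)"
  proof (rule smooth_at_sum[OF M pM])
    fix i assume "i \<in> {..<n}"
    then have i: "i < n" by simp
    note Ei = E(1)[OF i]
    have nz: "g\<^sub>C p (E i p) (E i p) \<noteq> 0"
      using metric_pos[OF M pullback_riemannian smooth_vector_fieldD(1)[OF Ei c(2)] E(2)[OF c(2) i]] by simp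
    obtain W Z where Z: "smooth_vector_field Q W Z" "p \<in> W" "W \<inter> C \<subseteq> fst c" "\<forall>x\<in>W \<inter> C. Z x = push x (E i x)"
      using field_extend[OF Ei c(2)] .
    have oW: "openin (top_of_set (points Q)) (V \<inter> W)"
      using smooth_vector_fieldD(3)[OF Z(1,2)] oV by blast
    have "smooth_at Q p (\<lambda>x. g x (N x) (Z x))"
      by (rule metric_smooth[OF Q g, of "V \<inter> W"])
        (use smooth_vector_field_subset[OF N oW] smooth_vector_field_subset[OF Z(1) oW] Z p in auto)
    then have s: "smooth_at M p (\<lambda>x. g x (N x) (Z x))" using p by (intro smooth_at_restrict) auto
    have "smooth_at M p (\<lambda>x. g x (N x) (push x (E i x)))"
      by (rule smooth_at_local[OF M s, of "(V \<inter> W) \<inter> C"]) (use openin_submanifold[OF oW] Z p in auto)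
    then show "smooth_at M p (\<lambda>x. (g x (N x) (push x (E i x)) / g\<^sub>C x (E i x) (E i x)) * E i x f)"
      using nz pullback_smooth[OF Ei Ei c(2)] smooth_vector_fieldD(2)[OF Ei c(2) f]
      by (intro smooth_at_mult[OF M] smooth_at_divide[OF M])
  qed
  then show "smooth_at M p (\<lambda>x. \<sigma> x (N x) f)"
  proof (rule smooth_at_local[OF M])
    show "openin (top_of_set (points M)) (fst c \<inter> (V \<inter> C))" using o by simp
    show "p \<in> fst c \<inter> (V \<inter> C)" using p c by simp
    fix x assume x: "x \<in> fst c \<inter> (V \<inter> C)"
    then have xc: "x \<in> C" "x \<in> fst c" and Nx: "N x \<in> tangent_space Q x" using smooth_vector_fieldD(1)[OF N] by auto
    have "\<sigma> x (N x) = (\<Sum>i<n. (g\<^sub>C x (\<sigma> x (N x)) (E i x) / g\<^sub>C x (E i x) (E i x)) *\<^sub>R E i x)"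
      by (rule E(3)[OF xc(2) proj_mem(1)[OF xc(1) Nx]])
    also have "\<dots> = (\<Sum>i<n. (g x (N x) (push x (E i x)) / g\<^sub>C x (E i x) (E i x)) *\<^sub>R E i x)"
      by (intro sum.cong refl)
        (use proj_metric[OF xc(1) Nx] smooth_vector_fieldD(1)[OF E(1) xc(2)] in auto)
    finally have "\<sigma> x (N x) f = (\<Sum>i<n. (g x (N x) (push x (E i x)) / g\<^sub>C x (E i x) (E i x)) *\<^sub>R E i x) f"
      by (rule arg_cong)
    then show "(\<Sum>i<n. (g x (N x) (push x (E i x)) / g\<^sub>C x (E i x) (E i x)) * E i x f) = \<sigma> x (N x) f"
      unfolding tvec_sum_apply tvec_apply by (rule sym)
  qed
qed

text \<open>Each property is that of the ambient connection for local extensions of the fields and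
  functions involved, followed by the fibrewise linear projection.\<close>

lemma induced_affine: "affine_connection M nabla\<^sub>C"
  unfolding affine_connection_def
proof (intro conjI allI impI ballI)
  note aff = affine_connectionD[OF levi_civitaD(1)[OF nabla]]
  {
    fix U Y p u v a b
    assume Y: "smooth_vector_field M U Y" and p: "p \<in> U" and u: "u \<in> tangent_space M p" and v: "v \<in> tangent_space M p"
    have pC: "p \<in> C" using tangent_space_points[OF u] by simp
    obtain V Z where Z: "smooth_vector_field Q V Z" "p \<in> V" "V \<inter> C \<subseteq> U" "\<forall>x\<in>V \<inter> C. Z x = push x (Y x)"
      using field_extend[OF Y p] .
    have uv: "a *\<^sub>R u + b *\<^sub>R v \<in> tangent_space M p"
      using subspace_tangent_space[OF M, of p] pC u v by (auto intro: subspace_add subspace_scale)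
    show "nabla\<^sub>C p (a *\<^sub>R u + b *\<^sub>R v) Y = a *\<^sub>R nabla\<^sub>C p u Y + b *\<^sub>R nabla\<^sub>C p v Y"
      unfolding induced_eq[OF Z(1,2,4) uv] induced_eq[OF Z(1,2,4) u] induced_eq[OF Z(1,2,4) v]
        pushforward_id_lincomb aff(1)[OF Z(1,2) push_tangent[OF u] push_tangent[OF v]]
      by (intro proj_lincomb pC nabla_tangent[OF Z(1,2)] push_tangent u v)
  }
  {
    fix U Y Z p v
    assume YZ: "smooth_vector_field M U Y \<and> smooth_vector_field M U Z" and p: "p \<in> U" and v: "v \<in> tangent_space M p"
    have pC: "p \<in> C" using tangent_space_points[OF v] by simp
    obtain V Y' Z' where E: "smooth_vector_field Q V Y'" "smooth_vector_field Q V Z'" "p \<in> V" "V \<inter> C \<subseteq> U"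
      "\<forall>x\<in>V \<inter> C. Y' x = push x (Y x)" "\<forall>x\<in>V \<inter> C. Z' x = push x (Z x)"
      using common_extension[OF conjunct1[OF YZ] conjunct2[OF YZ] p] .
    have s: "\<forall>x\<in>V \<inter> C. Y' x + Z' x = push x (Y x + Z x)" using E by (simp add: pushforward_id_add)
    show "nabla\<^sub>C p v (\<lambda>x. Y x + Z x) = nabla\<^sub>C p v Y + nabla\<^sub>C p v Z"
      unfolding induced_eq[OF smooth_vector_field_add[OF Q E(1,2)] E(3) s v] induced_eq[OF E(1,3,5) v]
        induced_eq[OF E(2,3,6) v] aff(2)[OF E(1,2,3) push_tangent[OF v]]
      using proj_lincomb[OF pC nabla_tangent[OF E(1,3) push_tangent[OF v]] nabla_tangent[OF E(2,3) push_tangent[OF v]], of 1 1]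
      by simp
  }
  {
    fix U Y f p v
    assume Yf: "smooth_vector_field M U Y \<and> (\<forall>x\<in>U. smooth_at M x f)" and p: "p \<in> U" and v: "v \<in> tangent_space M p"
    have pC: "p \<in> C" using tangent_space_points[OF v] by simp
    have Y: "smooth_vector_field M U Y" and f: "smooth_at M p f" using Yf p by auto
    obtain V Z where Z: "smooth_vector_field Q V Z" "p \<in> V" "V \<inter> C \<subseteq> U" "\<forall>x\<in>V \<inter> C. Z x = push x (Y x)"
      using field_extend[OF Y p] .
    obtain W h where W: "openin (top_of_set (points Q)) W" "p \<in> W" "\<forall>x\<in>W. smooth_at Q x h" "\<forall>x\<in>W \<inter> C. h x = f x"
      using smooth_at_extend[OF f] .
    have o: "openin (top_of_set (points Q)) (V \<inter> W)" using smooth_vector_fieldD(3)[OF Z(1,2)] W(1) by blast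
    note Zs = smooth_vector_field_subset[OF Z(1) o Int_lower1]
    have pVW: "p \<in> V \<inter> W" using Z W by simp
    have hs: "\<And>x. x \<in> V \<inter> W \<Longrightarrow> smooth_at Q x h" using W(3) by simp
    have e: "\<forall>x\<in>V \<inter> W \<inter> C. h x *\<^sub>R Z x = push x (f x *\<^sub>R Y x)" using Z(4) W(4) by (simp add: pushforward_id_scale)
    have e1: "\<forall>x\<in>V \<inter> W \<inter> C. Z x = push x (Y x)" using Z(4) by simp
    have hf: "h p = f p" using W(2,4) pC by simp
    have "v h = v f"
      by (rule tangent_local[OF M v, of "W \<inter> C"]) (use openin_submanifold[OF W(1)] W(2,4) pC in auto)
    then have vf: "push p v h = v f" using push_apply[OF hs[OF pVW]] by simp
    have Zp: "Z p = push p (Y p)" using Z(2,4) pC by simp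
    note nt = nabla_tangent[OF Z(1,2) push_tangent[OF v]] and Yt = smooth_vector_fieldD(1)[OF Y p]
    have "nabla\<^sub>C p v (\<lambda>x. f x *\<^sub>R Y x) = \<sigma> p (nabla p (push p v) (\<lambda>x. h x *\<^sub>R Z x))"
      by (rule induced_eq[OF smooth_vector_field_scale[OF Q Zs hs] pVW e v])
    also have "\<dots> = \<sigma> p (v f *\<^sub>R push p (Y p) + f p *\<^sub>R nabla p (push p v) Z)"
      using aff(3)[OF Zs hs pVW push_tangent[OF v]] vf hf Zp by simp
    also have "\<dots> = v f *\<^sub>R Y p + f p *\<^sub>R nabla\<^sub>C p v Y"
      unfolding induced_eq[OF Z(1,2,4) v] proj_lincomb[OF pC push_tangent[OF Yt] nt] proj_push[OF Yt] ..
    finally show "nabla\<^sub>C p v (\<lambda>x. f x *\<^sub>R Y x) = v f *\<^sub>R Y p + f p *\<^sub>R nabla\<^sub>C p v Y" .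
  }
  {
    fix U Y Z p v
    assume YZ: "smooth_vector_field M U Y \<and> smooth_vector_field M U Z \<and> (\<forall>x\<in>U. Y x = Z x)" and p: "p \<in> U"
      and v: "v \<in> tangent_space M p"
    have Y: "smooth_vector_field M U Y" using YZ by simp
    obtain V Y' where E: "smooth_vector_field Q V Y'" "p \<in> V" "V \<inter> C \<subseteq> U" "\<forall>x\<in>V \<inter> C. Y' x = push x (Y x)"
      using field_extend[OF Y p] .
    have e: "\<forall>x\<in>V \<inter> C. Y' x = push x (Z x)" using E(3,4) YZ by (metis subsetD)
    show "nabla\<^sub>C p v Y = nabla\<^sub>C p v Z"
      unfolding induced_eq[OF E(1,2,4) v] induced_eq[OF E(1,2) e v] ..
  }
  {
    fix U X Y
    assume XY: "smooth_vector_field M U X \<and> smooth_vector_field M U Y"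
    show "smooth_vector_field M U (\<lambda>x. nabla\<^sub>C x (X x) Y)"
    proof (rule smooth_vector_field_local[OF M])
      show "openin (top_of_set (points M)) U" using XY by (simp add: smooth_vector_field_def)
      fix p assume p: "p \<in> U"
      have pC: "p \<in> C" using smooth_vector_fieldD(4)[OF conjunct1[OF XY] p] by simp
      obtain V X' Y' where E: "smooth_vector_field Q V X'" "smooth_vector_field Q V Y'" "p \<in> V" "V \<inter> C \<subseteq> U"
        "\<forall>x\<in>V \<inter> C. X' x = push x (X x)" "\<forall>x\<in>V \<inter> C. Y' x = push x (Y x)"
        using common_extension[OF conjunct1[OF XY] conjunct2[OF XY] p] .
      have "\<forall>x\<in>V \<inter> C. \<sigma> x (nabla x (X' x) Y') = nabla\<^sub>C x (X x) Y"
      proof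
        fix x assume x: "x \<in> V \<inter> C"
        then have "X x \<in> tangent_space M x" using smooth_vector_fieldD(1)[OF conjunct1[OF XY]] E(4) by blast
        then show "\<sigma> x (nabla x (X' x) Y') = nabla\<^sub>C x (X x) Y"
          using induced_eq[OF E(2) _ E(6), of x "X x"] x E(5) by simp
      qed
      then show "\<exists>W Z. smooth_vector_field M W Z \<and> p \<in> W \<and> (\<forall>x\<in>W. Z x = nabla\<^sub>C x (X x) Y)"
        using proj_smooth_field[OF aff(5)[OF E(1,2)]] E(3) pC by blast
    qed
  }
qed

text \<open>The torsion identity is the projection of the ambient one, the ambient bracket being tangent to
  \<open>C\<close>. In the metric identity, \<open>\<sigma>\<close> may be dropped against vectors tangent to \<open>C\<close>.\<close>

lemma induced_levi_civita: "levi_civita M g\<^sub>C nabla\<^sub>C"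
  unfolding levi_civita_def
proof (intro conjI allI impI ballI)
  show "affine_connection M nabla\<^sub>C" by (rule induced_affine)
  {
    fix U X Y p
    assume XY: "smooth_vector_field M U X \<and> smooth_vector_field M U Y" and p: "p \<in> U"
    note X = conjunct1[OF XY] and Y = conjunct2[OF XY]
    have pC: "p \<in> C" using smooth_vector_fieldD(4)[OF X p] by simp
    obtain V X' Y' where E: "smooth_vector_field Q V X'" "smooth_vector_field Q V Y'" "p \<in> V" "V \<inter> C \<subseteq> U"
      "\<forall>x\<in>V \<inter> C. X' x = push x (X x)" "\<forall>x\<in>V \<inter> C. Y' x = push x (Y x)"
      using common_extension[OF X Y p] .
    note Xt = smooth_vector_fieldD(1)[OF X p] and Yt = smooth_vector_fieldD(1)[OF Y p]
    have Xp: "X' p = push p (X p)" "Y' p = push p (Y p)" using E pC by auto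
    have tor: "nabla p (push p (X p)) Y' - nabla p (push p (Y p)) X' = lie_bracket Q X' Y' p"
      using levi_civitaD(2)[OF nabla E(1,2,3)] Xp by simp
    note t = nabla_tangent[OF E(2,3) push_tangent[OF Xt]] nabla_tangent[OF E(1,3) push_tangent[OF Yt]]
    have B: "lie_bracket Q X' Y' p \<in> tangent_space Q p"
      unfolding tor[symmetric] using subspace_diff[OF tangent_subspace[OF Q t(1)] t] .
    note lb = lie_bracket_restrict[OF X E(1,5) Y E(2,6) E(3) p B]
    have "nabla\<^sub>C p (X p) Y - nabla\<^sub>C p (Y p) X
        = \<sigma> p (nabla p (push p (X p)) Y') - \<sigma> p (nabla p (push p (Y p)) X')"
      unfolding induced_eq[OF E(2,3,6) Xt] induced_eq[OF E(1,3,5) Yt] ..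
    also have "\<dots> = \<sigma> p (lie_bracket Q X' Y' p)"
      using proj_lincomb[OF pC t, of 1 "-1"] tor by simp
    also have "\<dots> = lie_bracket M X Y p" using proj_push[OF lb(1)] lb(2) by simp
    finally show "nabla\<^sub>C p (X p) Y - nabla\<^sub>C p (Y p) X = lie_bracket M X Y p" .
  }
  {
    fix U Y Z p v
    assume YZ: "smooth_vector_field M U Y \<and> smooth_vector_field M U Z" and p: "p \<in> U" and v: "v \<in> tangent_space M p"
    note Y = conjunct1[OF YZ] and Z = conjunct2[OF YZ]
    have pC: "p \<in> C" using smooth_vector_fieldD(4)[OF Y p] by simp
    obtain V Y' Z' where E: "smooth_vector_field Q V Y'" "smooth_vector_field Q V Z'" "p \<in> V" "V \<inter> C \<subseteq> U"
      "\<forall>x\<in>V \<inter> C. Y' x = push x (Y x)" "\<forall>x\<in>V \<inter> C. Z' x = push x (Z x)"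
      using common_extension[OF Y Z p] .
    note Yt = smooth_vector_fieldD(1)[OF Y p] and Zt = smooth_vector_fieldD(1)[OF Z p]
    have Yp: "Y' p = push p (Y p)" "Z' p = push p (Z p)" using E pC by auto
    note pv = push_tangent[OF v]
    note t = nabla_tangent[OF E(1,3) pv] nabla_tangent[OF E(2,3) pv]
    have oV: "openin (top_of_set (points Q)) V" using smooth_vector_fieldD(3)[OF E(1,3)] .
    have "v (\<lambda>x. g\<^sub>C x (Y x) (Z x)) = v (\<lambda>x. g x (Y' x) (Z' x))"
      by (rule tangent_local[OF M v, of "V \<inter> C"]) (use openin_submanifold[OF oV] E pC in \<open>auto simp: pullback_apply\<close>)
    also have "\<dots> = push p v (\<lambda>x. g x (Y' x) (Z' x))"
      using push_apply[OF metric_smooth[OF Q g E(1,2,3)]] by simp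
    also have "\<dots> = g p (nabla p (push p v) Y') (push p (Z p)) + g p (push p (Y p)) (nabla p (push p v) Z')"
      using levi_civitaD(3)[OF nabla E(1,2,3) pv] Yp by simp
    also have "\<dots> = g\<^sub>C p (\<sigma> p (nabla p (push p v) Y')) (Z p) + g\<^sub>C p (\<sigma> p (nabla p (push p v) Z')) (Y p)"
      using proj_metric[OF pC t(1) Zt] proj_metric[OF pC t(2) Yt] metric_sym[OF Q g t(2) push_tangent[OF Yt]] by simp
    also have "\<dots> = g\<^sub>C p (nabla\<^sub>C p v Y) (Z p) + g\<^sub>C p (Y p) (nabla\<^sub>C p v Z)"
      unfolding induced_eq[OF E(1,3,5) v] induced_eq[OF E(2,3,6) v]
      using metric_sym[OF M pullback_riemannian proj_mem(1)[OF pC t(2)] Yt] by simp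
    finally show "v (\<lambda>x. g\<^sub>C x (Y x) (Z x)) = g\<^sub>C p (nabla\<^sub>C p v Y) (Z p) + g\<^sub>C p (Y p) (nabla\<^sub>C p v Z)" .
  }
qed

text \<open>Against a vector \<open>w\<close> tangent to \<open>C\<close>, the projection of the ambient gradient pairs like the gradient
  itself, giving the derivative of \<open>P\<close> along \<open>w\<close>. Since \<open>w\<close> depends only on germs along \<open>C\<close>, the values of
  the restriction outside \<open>C\<close> do not matter.\<close>

lemma grad_restrict:
  assumes q: "q \<in> C"
  shows "grad M g\<^sub>C (restrict P C) q = \<sigma> q (grad Q g P q)"
  unfolding grad_def[of M]
proof (rule sharp_eqI[OF M pullback_riemannian])
  have qQ: "q \<in> points Q" using q C_points by blast
  note gr = grad_property[OF Q g qQ, where f=P]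
  show "\<sigma> q (grad Q g P q) \<in> tangent_space M q" by (rule proj_mem(1)[OF q gr(1)])
  fix w assume w: "w \<in> tangent_space M q"
  have "w (restrict P C) = w P"
    by (rule tangent_local[OF M w, of C]) (use q in auto)
  also have "\<dots> = push q w P" using push_apply[OF P_smooth[OF qQ]] by simp
  also have "\<dots> = g q (grad Q g P q) (push q w)" by (rule gr(2)[OF push_tangent[OF w]])
  also have "\<dots> = g\<^sub>C q (\<sigma> q (grad Q g P q)) w" using proj_metric[OF q gr(1) w] by simp
  finally show "differential (restrict P C) q w = g\<^sub>C q (\<sigma> q (grad Q g P q)) w" by (simp add: differential_def)
qed

lemma restricted_lagrangian_system: "lagrangian_system M g\<^sub>C (restrict P C)"
  unfolding lagrangian_system_def
proof (intro conjI ballI M pullback_riemannian)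
  fix q assume "q \<in> points M"
  then have q: "q \<in> C" by simp
  then have "smooth_at M q P" using P_smooth C_points by (intro smooth_at_restrict) auto
  then show "smooth_at M q (restrict P C)"
    by (rule smooth_at_local[OF M, of _ _ C]) (use q in auto)
qed

text \<open>One direction takes the induced connection as the Levi-Civita connection of \<open>g\<^sub>C\<close>; the other
  uses that any Levi-Civita connection of \<open>g\<^sub>C\<close> yields the same accelerations.\<close>

lemma constrained_iff_base_integral_curve:
  assumes I: "open I" and \<gamma>: "smooth_curve M I \<gamma>"
  shows "satisfies_constrained_dynamics Q g nabla P m F S C I \<gamma> \<longleftrightarrow>
    base_integral_curve M g\<^sub>C (restrict P C) I \<gamma>"
proof -
  have \<gamma>C: "\<gamma> t \<in> C" if "t \<in> I" for t using \<gamma> that by (auto simp: smooth_curve_def)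
  have "satisfies_constrained_dynamics Q g nabla P m F S C I \<gamma> \<longleftrightarrow>
      (\<forall>t\<in>I. acceleration M nabla\<^sub>C \<gamma> t = - grad M g\<^sub>C (restrict P C) (\<gamma> t))"
    unfolding satisfies_constrained_dynamics_def by (intro ball_cong refl) (simp only: grad_restrict[OF \<gamma>C])
  also have "\<dots> \<longleftrightarrow> (\<exists>nab. levi_civita M g\<^sub>C nab \<and>
      (\<forall>t\<in>I. acceleration M nab \<gamma> t = - grad M g\<^sub>C (restrict P C) (\<gamma> t)))"
  proof
    assume "\<exists>nab. levi_civita M g\<^sub>C nab \<and> (\<forall>t\<in>I. acceleration M nab \<gamma> t = - grad M g\<^sub>C (restrict P C) (\<gamma> t))"
    then obtain nab where nab: "levi_civita M g\<^sub>C nab"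
      "\<forall>t\<in>I. acceleration M nab \<gamma> t = - grad M g\<^sub>C (restrict P C) (\<gamma> t)" by blast
    show "\<forall>t\<in>I. acceleration M nabla\<^sub>C \<gamma> t = - grad M g\<^sub>C (restrict P C) (\<gamma> t)"
      using levi_civita_same_acceleration[OF M pullback_riemannian induced_levi_civita nab(1) \<gamma> I] nab(2) by simp
  qed (use induced_levi_civita in blast)
  finally show ?thesis using \<gamma> by (simp add: base_integral_curve_def)
qed

end

theorem proposition5p2:
  fixes Q :: "('a::{t2_space,second_countable_topology}, 'e::euclidean_space) manifold"
    and g :: "'a metric" and nabla :: "'a connection" and P :: "'a \<Rightarrow> real"
    and m :: nat and F :: "nat \<Rightarrow> 'a \<Rightarrow> 'a tvec \<Rightarrow> real"
    and S :: "'e set" and C :: "'a set"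
  assumes "lagrangian_control_system Q g nabla P m F"
    and "regular_VHC Q g m F S C"
    and "\<forall>q\<in>C. \<forall>u\<in>sub_tangent_space Q S C q. \<forall>w\<in>acceleration_distribution Q g m F q. g q u w = 0"
  shows "constrained_dynamics_lagrangian Q g nabla P m F S C
           (pullback_metric Q id g) (restrict P C)"
proof -
  interpret orthogonal_vhc Q g nabla P m F S C
    using assms by unfold_locales
  show ?thesis
    unfolding constrained_dynamics_lagrangian_def
    using restricted_lagrangian_system constrained_iff_base_integral_curve by blast
qed

end
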